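(* Let $f(z)=\sum_{j\ge0}g_jz^j$ have $g_0=1$ and radius of convergence $\rho_1\in(0,\infty]$. Let $b_1=1$, $b_k\ge0$, such that every power series $f(z)^{b_k}=\sum_jg_{k,j}z^j$ has nonnegative coefficients, and assume $B_k=\sum_{j\le k}b_j=k^\beta\ell(k)$ with $\beta>0$ and $\ell$ measurable slowly varying. Let $F(x)=\prod_{k\ge1}f(x^k)^{b_k}=\sum_na_nx^n$ with all $a_n>0$, and let $\mu_x$ (grand canonical) and $\mu^{(n)}$ (small canonical) be the associated measures. Let $x_n$ be the unique solution of $\mathbb E_{x_n}N=n$, and suppose that for some $\gamma>0$, $\mu_{x_n}\mathcal P(n)\ge n^{-\gamma}$ for all sufficiently large $n$. If either $\rho_1>1$, or $\rho_1=1$ and $f$ has an isolated pole at $1$, then the measures $\mu^{(n)}$ are ergodic with scaling $\alpha^{(n)}=1/(1-x_n)$ (which has the form $n^{1/(\beta+1)}/\ell_1(n)$ for a slowly varying function $\ell_1$), and with this scaling the limit shape is $$\varphi(t)=\frac1\Omega\left(\int_0^{e^{-t}}\big(h(u)+uh'(u)\big)|\log u|^\beta du-t^\beta h(e^{-t})e^{-t}\right),$$ where $h=f'/f$ and $\Omega=\int_0^1\big(|\log u|^{\beta+1}(h(u)+uh'(u))-|\log u|^\beta h(u)\big)du$.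
   Context: $\mathcal P(n)$ is the set of partitions of $n$, $\mathcal P=\bigcup_n\mathcal P(n)$; for $\lambda\in\mathcal P$, $R_k(\lambda)$ is the number of parts equal to $k$, $N(\lambda)=\sum_kkR_k(\lambda)$, $\varphi_\lambda(t)=\sum_{k>t}R_k(\lambda)$. Grand canonical: $\mu_x\{\lambda\}=\frac{x^{N(\lambda)}}{F(x)}\prod_{k\ge1}g_{k,R_k(\lambda)}$ on $\mathcal P$, expectation $\mathbb E_x$. Small canonical: $\mu^{(n)}\{\lambda\}=\frac1{a_n}\prod_{k\ge1}g_{k,R_k(\lambda)}$ for $\lambda\in\mathcal P(n)$. The family $(\mu^{(n)})$ is ergodic with scaling $\alpha^{(n)}>0$ and limit shape $\varphi$ if $\varphi:[0,\infty)\to[0,\infty)$ is piecewise continuous with $\int_0^\infty\varphi=1$ and, writing $\tilde\varphi^{(n)}_\lambda(t)=\frac{\alpha^{(n)}}{n}\varphi_\lambda(\alpha^{(n)}t)$, for every $\varepsilon>0$ and every finite collection $0<t_1<\dots<t_\ell$ of continuity points of $\varphi$, $\lim_{n\to\infty}\mu^{(n)}\{\lambda:|\tilde\varphi^{(n)}_\lambda(t_j)-\varphi(t_j)|<\varepsilon\ \forall j\}=1$. A measurable $\ell$ is slowly varying if $\ell(xy)/\ell(x)\to1$ as $x\to\infty$ for each fixed $y>0$. *)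

theory Defs
  imports
    "HOL-Complex_Analysis.Complex_Analysis"
    "HOL-Library.Multiset"
begin

section \<open>Partitions\<close>

text \<open>A partition is the multiset of its parts; \<open>count p k\<close> is \<open>R\<^sub>k(p)\<close> and \<open>sum_mset p\<close> is \<open>N(p)\<close>.\<close>

definition partitions :: "nat multiset set" where
  "partitions = {p. 0 \<notin># p}"

definition partitions_of :: "nat \<Rightarrow> nat multiset set" where
  "partitions_of n = {p \<in> partitions. sum_mset p = n}"

definition parts_above :: "nat multiset \<Rightarrow> real \<Rightarrow> real" where
  "parts_above p t = (\<Sum>k\<in>{k \<in> set_mset p. real k > t}. real (count p k))"

section \<open>Generating functions\<close>

text \<open>The formal power \<open>f\<^sup>c\<close> of a series with constant term 1, i.e. the binomial
  series \<open>(1 + X)\<^sup>c\<close> composed with \<open>f - 1\<close>.\<close>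

definition fps_rpow :: "real fps \<Rightarrow> real \<Rightarrow> real fps" where
  "fps_rpow f c = fps_compose (fps_binomial c) (f - 1)"

text \<open>The infinite product over \<open>k \<ge> 1\<close> of \<open>f(X\<^sup>k)\<close> to the power \<open>b\<^sub>k\<close>, taken in the
  \<open>X\<close>-adic topology of formal power series.\<close>

definition gen_fun :: "real fps \<Rightarrow> (nat \<Rightarrow> real) \<Rightarrow> real fps" where
  "gen_fun f b = prodinf (\<lambda>i. fps_rpow (fps_compose f (fps_X ^ Suc i)) (b (Suc i)))"

text \<open>The product of \<open>g\<^bsub>k,R\<^sub>k(p)\<^esub>\<close> over all \<open>k \<ge> 1\<close>. Only the \<open>k\<close> that occur in \<open>p\<close>
  contribute, since \<open>g\<^bsub>k,0\<^esub> = 1\<close>.\<close>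

definition weight :: "real fps \<Rightarrow> (nat \<Rightarrow> real) \<Rightarrow> nat multiset \<Rightarrow> real" where
  "weight f b p = (\<Prod>k\<in>set_mset p. fps_nth (fps_rpow f (b k)) (count p k))"

section \<open>The grand canonical and small canonical measures\<close>

definition grand_canonical :: "real fps \<Rightarrow> (nat \<Rightarrow> real) \<Rightarrow> real \<Rightarrow> nat multiset measure" where
  "grand_canonical f b x = point_measure partitions
     (\<lambda>p. ennreal (x ^ sum_mset p / eval_fps (gen_fun f b) x * weight f b p))"

definition small_canonical :: "real fps \<Rightarrow> (nat \<Rightarrow> real) \<Rightarrow> nat \<Rightarrow> nat multiset measure" where
  "small_canonical f b n = point_measure (partitions_of n)
     (\<lambda>p. ennreal (1 / fps_nth (gen_fun f b) n * weight f b p))"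

section \<open>Ergodicity and limit shapes\<close>

text \<open>Piecewise continuity on the half line, with one-sided limits required only at
  \<open>t > 0\<close>: limit shapes may be unbounded at \<open>0\<close> (e.g. that of uniform partitions), and
  their value at \<open>0\<close> plays no role.\<close>

definition piecewise_continuous_half_line :: "(real \<Rightarrow> real) \<Rightarrow> bool" where
  "piecewise_continuous_half_line \<phi> \<longleftrightarrow>
     (\<forall>c>0. finite {t \<in> {0<..c}. \<not> isCont \<phi> t}) \<and>
     (\<forall>t>0. (\<exists>L. (\<phi> \<longlongrightarrow> L) (at_left t)) \<and> (\<exists>L. (\<phi> \<longlongrightarrow> L) (at_right t)))"

definition ergodic ::
    "(nat \<Rightarrow> nat multiset measure) \<Rightarrow> (nat \<Rightarrow> real) \<Rightarrow> (real \<Rightarrow> real) \<Rightarrow> bool" where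
  "ergodic \<mu> \<alpha> \<phi> \<longleftrightarrow>
     (\<forall>n\<ge>1. \<alpha> n > 0) \<and>
     (\<forall>t\<ge>0. \<phi> t \<ge> 0) \<and>
     piecewise_continuous_half_line \<phi> \<and>
     (\<phi> has_integral 1) {0..} \<and>
     (\<forall>\<epsilon>>0. \<forall>T. finite T \<longrightarrow> (\<forall>t\<in>T. t > 0 \<and> isCont \<phi> t) \<longrightarrow>
        (\<lambda>n. measure (\<mu> n)
           {p \<in> space (\<mu> n). \<forall>t\<in>T. \<bar>\<alpha> n / real n * parts_above p (\<alpha> n * t) - \<phi> t\<bar> < \<epsilon>})
        \<longlonglongrightarrow> 1)"

definition slowly_varying :: "(real \<Rightarrow> real) \<Rightarrow> bool" where
  "slowly_varying l \<longleftrightarrow>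
     l \<in> borel_measurable (lebesgue_on {0<..}) \<and>
     (\<forall>y>0. ((\<lambda>x. l (x * y) / l x) \<longlongrightarrow> 1) at_top)"

text \<open>The sum function extends holomorphically from the unit disc to a punctured
  neighbourhood of 1, with a pole at 1.\<close>

definition isolated_pole_at_1 :: "real fps \<Rightarrow> bool" where
  "isolated_pole_at_1 f \<longleftrightarrow>
     (\<exists>r>0. \<exists>G. G holomorphic_on (ball 1 r - {1}) \<and> is_pole G 1 \<and>
        (\<forall>z \<in> ball 1 r \<inter> ball 0 1.
           G z = eval_fps (Abs_fps (\<lambda>j. complex_of_real (fps_nth f j))) z))"

definition log_deriv :: "real fps \<Rightarrow> real \<Rightarrow> real" where
  "log_deriv f u = deriv (eval_fps f) u / eval_fps f u"

definition shape_const :: "real fps \<Rightarrow> real \<Rightarrow> real" where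
  "shape_const f \<beta> = (let h = log_deriv f in
     integral {0..1} (\<lambda>u. \<bar>ln u\<bar> powr (\<beta> + 1) * (h u + u * deriv h u) - \<bar>ln u\<bar> powr \<beta> * h u))"

definition limit_shape :: "real fps \<Rightarrow> real \<Rightarrow> real \<Rightarrow> real" where
  "limit_shape f \<beta> t = (let h = log_deriv f in
     1 / shape_const f \<beta> *
     (integral {0..exp (- t)} (\<lambda>u. (h u + u * deriv h u) * \<bar>ln u\<bar> powr \<beta>)
      - t powr \<beta> * h (exp (- t)) * exp (- t)))"

end

theory Submission
  imports Defs "HOL-Real_Asymp.Real_Asymp"
begin

text \<open>
  Write \<open>x = e\<^sup>-\<^sup>\<sigma>\<close>, \<open>H(u) = u f'(u)/f(u)\<close> and \<open>B(y) = \<Sum>\<^sub>k\<^sub>\<le>\<^sub>y b\<^sub>k\<close>. Under the grand canonical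
  measure the mean multiplicity of the part \<open>k\<close> is \<open>b\<^sub>k H(e\<^sup>-\<^sup>k\<^sup>\<sigma>)\<close>. Expressing such values as
  integrals of a kernel over \<open>(0, e\<^sup>-\<^sup>k\<^sup>\<sigma>)\<close> and interchanging sum and integral gives
  \<open>\<integral> B(-ln u / \<sigma>) K(u) du\<close>; since \<open>B(v/\<sigma>)/B(1/\<sigma>) \<rightarrow> v\<^sup>\<beta>\<close>, dominated convergence with a Potter
  majorant yields \<open>n \<sim> \<Omega> B(1/\<sigma>)/\<sigma>\<close> (kernel of the mean of \<open>N\<close>) and the limit shape (kernel \<open>H'\<close>
  on \<open>u \<le> e\<^sup>-\<^sup>t\<close>). A pole at 1 enters only through the two-sided bound of \<open>f(u) (1 - u)\<^sup>m\<close>.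

  Since \<open>ln f(e\<^sup>y)\<close> is convex, Chernoff's bound shows that the probability of a deviation is at most
  \<open>exp(-d B(1/\<sigma>))\<close>, and \<open>B(1/\<sigma>)\<close> grows faster than some power of \<open>n\<close>; this survives the
  conditioning on \<open>N = n\<close>, which costs a factor \<open>n\<^sup>\<gamma>\<close>.
\<close>

section \<open>Euler products and partitions\<close>

text \<open>A pole of f makes \<open>dH\<close> as large as (1 - u)^(-2), which is not integrable
  against |ln u|^\<beta> near 1 if \<beta> \<le> 1. Hence \<open>dH\<close> reaches 1 only together
  with a factor -ln u: the mean of N uses the derivative of -ln u * H(u), and the tail kernel is cut
  at exp(-t) with t > 0. The price is paid at t = 0, where the limit shape may be unbounded; its
  total mass is computed from the primitive t \<Phi>(t) - \<beta> J(exp(-t)), whose boundary terms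
  are controlled by the same factor -ln u. On the probabilistic side, independence of the
  multiplicities appears as the product form of the generating function: tilting the factors above a
  threshold multiplies the weight of a partition by the exponential of \<theta> times
  \<open>parts_above\<close>, and one term of the tilted product is at most its value. Infinite
  products are approached by finite ones, whose coefficient at n is final from K = n on;
  nonnegativity of all coefficients then squeezes the values to the limit.\<close>

lemma fps_rpow_nth_0 [simp]: "fps_nth (fps_rpow f c) 0 = 1"
  by (simp add: fps_rpow_def)

lemma fps_rpow_1: "fps_nth f 0 = 1 \<Longrightarrow> fps_rpow f 1 = f"
  by (simp add: fps_rpow_def fps_binomial_1 fps_compose_add_distrib)

lemma fps_rpow_nth_1:
  assumes "fps_nth f 0 = 1"
  shows "fps_nth (fps_rpow f c) 1 = c * fps_nth f 1"
  using assms by (simp add: fps_rpow_def fps_compose_nth)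

lemma fps_rpow_compose_X_power:
  fixes f :: "real fps"
  assumes "fps_nth f 0 = 1" "k \<ge> 1"
  shows "fps_rpow (f oo fps_X ^ k) c = fps_rpow f c oo fps_X ^ k"
proof -
  have "(f - 1) oo fps_X ^ k = (f oo fps_X ^ k) - 1"
    by (simp add: fps_compose_sub_distrib)
  then show ?thesis
    using assms by (simp add: fps_rpow_def) (subst fps_compose_assoc [symmetric]; simp)
qed

lemma fps_nth_compose_X_power:
  fixes P :: "'a::comm_ring_1 fps"
  assumes "k \<ge> 1"
  shows "fps_nth (P oo fps_X ^ k) n = (if k dvd n then fps_nth P (n div k) else 0)"
proof -
  have "fps_nth (P oo fps_X ^ k) n = (\<Sum>i=0..n. if n = k * i then fps_nth P i else 0)"
    unfolding fps_compose_nth by (intro sum.cong) (auto simp flip: power_mult)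
  also have "\<dots> = (\<Sum>i\<in>{i. i \<le> n \<and> n = k * i}. fps_nth P i)"
    by (subst sum.inter_filter [symmetric]) auto
  also have "{i. i \<le> n \<and> n = k * i} = (if k dvd n then {n div k} else {})"
    using assms by auto
  finally show ?thesis
    by auto
qed

text \<open>Substitute f - 1 into (1 + X) B' = c B, the equation of the binomial series, and
  multiply by f'. Both the radius of convergence and the values of the formal power are derived from
  this equation.\<close>

lemma fps_rpow_ODE:
  fixes f :: "real fps"
  assumes "fps_nth f 0 = 1"
  shows "f * fps_deriv (fps_rpow f c) = fps_const c * fps_deriv f * fps_rpow f c"
proof -
  let ?B = "fps_binomial c"
  have "(1 + fps_X) * fps_deriv ?B = fps_const c * ?B"
    by (simp add: fps_binomial_deriv fps_divide_unit)
       (simp add: mult.assoc [symmetric] inverse_mult_eq_1')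
  then have "((1 + fps_X) * fps_deriv ?B) oo (f - 1) = (fps_const c * ?B) oo (f - 1)"
    by simp
  then have *: "f * (fps_deriv ?B oo (f - 1)) = fps_const c * (?B oo (f - 1))"
    using assms by (simp add: fps_compose_mult_distrib fps_compose_add_distrib)
  show ?thesis
    unfolding fps_rpow_def using * assms
    by (simp add: fps_compose_deriv mult_ac flip: mult.assoc)
qed

text \<open>Generic in the factors, so that the powers \<open>fps_rpow f (b k)\<close> and their
  exponentially tilted versions in \<open>exp_moment_le\<close> are covered alike.\<close>

definition gen_partial :: "(nat \<Rightarrow> 'a::comm_ring_1 fps) \<Rightarrow> nat \<Rightarrow> 'a fps" where
  "gen_partial P K = (\<Prod>k=1..K. P k oo fps_X ^ k)"

lemma gen_partial_0 [simp]: "gen_partial P 0 = 1"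
  by (simp add: gen_partial_def)

lemma gen_partial_Suc: "gen_partial P (Suc K) = gen_partial P K * (P (Suc K) oo fps_X ^ Suc K)"
  by (simp add: gen_partial_def)

text \<open>Factor K + 1 has the form 1 + O(X^(K+1)) and leaves the coefficients up to K
  alone.\<close>

lemma gen_partial_stable:
  assumes "\<And>k. fps_nth (P k) 0 = 1" "n \<le> K"
  shows "fps_nth (gen_partial P K) n = fps_nth (gen_partial P n) n"
  using assms(2)
proof (induction K rule: dec_induct)
  case (step K)
  have *: "fps_nth (P (Suc K) oo fps_X ^ Suc K) (n - i) = (if i = n then 1 else 0)" if "i \<le> n" for i
    using that step assms(1)
    by (auto simp: fps_nth_compose_X_power simp del: power_Suc dest!: dvd_imp_le)
  have "fps_nth (gen_partial P (Suc K)) n = fps_nth (gen_partial P K) n"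
    unfolding gen_partial_Suc fps_mult_nth
    by (subst sum.cong[OF refl, of _ _ "\<lambda>i. if i = n then fps_nth (gen_partial P K) n else 0"])
      (auto simp: * simp del: power_Suc)
  with step show ?case by simp
qed simp

lemma fps_nth_gen_fun:
  assumes f0: "fps_nth f 0 = 1" and "n \<le> K"
  shows "fps_nth (gen_fun f b) n = fps_nth (gen_partial (\<lambda>k. fps_rpow f (b k)) K) n"
proof -
  let ?P = "\<lambda>k. fps_rpow f (b k)"
  define a where "a = Abs_fps (\<lambda>n. fps_nth (gen_partial ?P n) n)"
  \<comment> \<open>The summand 0 is the offset in \<open>raw_has_prod\<close>; in this form the
    equation can be unfolded below.\<close>
  have eq: "(\<Prod>i\<le>n. fps_rpow (f oo fps_X ^ Suc (i + 0)) (b (Suc (i + 0)))) = gen_partial ?P (Suc n)" for n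
  proof -
    have "gen_partial ?P (Suc n) = (\<Prod>k\<in>Suc ` {..n}. ?P k oo fps_X ^ k)"
      unfolding gen_partial_def by (intro prod.cong) (auto simp: image_Suc_atMost)
    also have "\<dots> = (\<Prod>i\<le>n. ?P (Suc i) oo fps_X ^ Suc i)"
      by (subst prod.reindex) auto
    finally show ?thesis
      using f0 by (auto intro!: prod.cong simp: fps_rpow_compose_X_power simp del: power_Suc)
  qed
  have "(\<lambda>n. gen_partial ?P (Suc n)) \<longlonglongrightarrow> a"
    unfolding tendsto_fps_iff
  proof
    fix n
    show "eventually (\<lambda>K. fps_nth (gen_partial ?P (Suc K)) n = fps_nth a n) sequentially"
      using eventually_ge_at_top[of n]
      by eventually_elim (auto simp: a_def intro!: gen_partial_stable)
  qed
  \<comment> \<open>\<open>raw_has_prod\<close> asks for a nonzero limit.\<close>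
  moreover have "a \<noteq> 0"
  proof
    assume "a = 0"
    then have "fps_nth a 0 = 0" by simp
    then show False by (simp add: a_def)
  qed
  ultimately have "(\<lambda>i. fps_rpow (f oo fps_X ^ Suc i) (b (Suc i))) has_prod a"
    unfolding has_prod_def raw_has_prod_def eq by simp
  then have "gen_fun f b = a"
    unfolding gen_fun_def by (rule has_prod_unique [symmetric])
  with gen_partial_stable[of ?P n K] assms show ?thesis
    by (simp add: a_def)
qed

section \<open>Coefficients of Euler products as sums over partitions\<close>

definition weight_of :: "(nat \<Rightarrow> 'a::comm_ring_1 fps) \<Rightarrow> nat multiset \<Rightarrow> 'a" where
  "weight_of P p = (\<Prod>k\<in>set_mset p. fps_nth (P k) (count p k))"

lemma weight_eq_weight_of: "weight f b = weight_of (\<lambda>k. fps_rpow f (b k))"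
  by (simp add: weight_def weight_of_def fun_eq_iff)

definition partitions_upto :: "nat \<Rightarrow> nat \<Rightarrow> nat multiset set" where
  "partitions_upto K n = {p. set_mset p \<subseteq> {1..K} \<and> sum_mset p = n}"

lemma partitions_upto_self:
  assumes "n \<le> K"
  shows "partitions_upto K n = partitions_of n"
proof -
  have "k \<le> n" if "k \<in># p" "sum_mset p = n" for k and p :: "nat multiset"
    using sum_mset.remove[OF that(1)] that(2) by simp
  with assms show ?thesis
    unfolding partitions_upto_def partitions_of_def partitions_def
    by (force simp: not_less_eq_eq Suc_le_eq intro!: Nat.gr0I)
qed

lemma partitions_upto_0: "partitions_upto 0 n = (if n = 0 then {{#}} else {})"
  by (auto simp: partitions_upto_def)

text \<open>Here j is the multiplicity of the part \<open>Suc K\<close>. On the side of series this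
  is the choice of the exponent (K + 1) j in the last factor, which makes the two recursions in
  \<open>fps_nth_gen_partial\<close> agree.\<close>

lemma bij_betw_partitions_upto_Suc:
  "bij_betw (\<lambda>(j, p). p + replicate_mset j (Suc K))
     (SIGMA j:{j. Suc K * j \<le> n}. partitions_upto K (n - Suc K * j)) (partitions_upto (Suc K) n)"
proof (rule bij_betwI[where g = "\<lambda>p. (count p (Suc K), filter_mset (\<lambda>k. k \<noteq> Suc K) p)"], goal_cases)
  case 1
  then show ?case by (auto simp: partitions_upto_def split: if_splits)
next
  case 2
  have "p = filter_mset (\<lambda>k. k \<noteq> Suc K) p + replicate_mset (count p (Suc K)) (Suc K)" for p
    by (rule multiset_eqI) auto
  then have "sum_mset p = sum_mset (filter_mset (\<lambda>k. k \<noteq> Suc K) p) + count p (Suc K) * Suc K" for p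
    by (metis sum_mset.union sum_mset_replicate_mset of_nat_id)
  note * = this
  show ?case
  proof
    fix p assume "p \<in> partitions_upto (Suc K) n"
    then show "(count p (Suc K), filter_mset (\<lambda>k. k \<noteq> Suc K) p) \<in>
        (SIGMA j:{j. Suc K * j \<le> n}. partitions_upto K (n - Suc K * j))"
      using *[of p] by (fastforce simp: partitions_upto_def mult.commute le_Suc_eq subset_iff)
  qed
next
  case (3 jp)
  then show ?case
    by (auto simp: partitions_upto_def count_eq_zero_iff intro!: multiset_eqI split: if_splits)
next
  case (4 p)
  then show ?case by (auto intro!: multiset_eqI)
qed

lemma finite_partitions_upto: "finite (partitions_upto K n)"
proof (induction K arbitrary: n)
  case (Suc K)
  have "finite {j. Suc K * j \<le> n}"
    by (rule finite_subset[of _ "{..n}"]) (auto elim: order.trans[rotated])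
  with Suc show ?case
    using bij_betw_finite[OF bij_betw_partitions_upto_Suc[of K n]] by auto
qed (auto simp: partitions_upto_0)

lemma finite_partitions_of: "finite (partitions_of n)"
  using finite_partitions_upto[of n n] by (simp add: partitions_upto_self)

lemma fps_nth_gen_partial:
  assumes P0: "\<And>k. fps_nth (P k) 0 = 1"
  shows "fps_nth (gen_partial P K) n = (\<Sum>p\<in>partitions_upto K n. weight_of P p)"
proof (induction K arbitrary: n)
  case 0
  then show ?case by (auto simp: partitions_upto_0 weight_of_def)
next
  case (Suc K)
  let ?J = "{j. Suc K * j \<le> n}"
  have fin: "finite ?J"
    by (rule finite_subset[of _ "{..n}"]) (auto elim: order.trans[rotated])
  have weight: "weight_of P (p + replicate_mset j (Suc K)) = weight_of P p * fps_nth (P (Suc K)) j"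
    if "p \<in> partitions_upto K m" for p j m
  proof -
    have nin: "Suc K \<notin># p" using that by (auto simp: partitions_upto_def)
    show ?thesis
    \<comment> \<open>For j = 0 the part is missing from the product over \<open>set_mset\<close>;
      the constant term 1 of its factor makes up for that.\<close>
    proof (cases "j = 0")
      case False
      have "weight_of P (p + replicate_mset j (Suc K)) =
          (\<Prod>k\<in>insert (Suc K) (set_mset p). fps_nth (P k) (count (p + replicate_mset j (Suc K)) k))"
        unfolding weight_of_def using False by (intro prod.cong) auto
      also have "\<dots> = fps_nth (P (Suc K)) j *
          (\<Prod>k\<in>set_mset p. fps_nth (P k) (count (p + replicate_mset j (Suc K)) k))"
        using nin by (subst prod.insert) (auto simp: not_in_iff)
      also have "(\<Prod>k\<in>set_mset p. fps_nth (P k) (count (p + replicate_mset j (Suc K)) k)) = weight_of P p"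
        unfolding weight_of_def using nin by (intro prod.cong) auto
      finally show ?thesis by (simp add: mult.commute)
    qed (simp add: P0)
  qed
  have "fps_nth (gen_partial P (Suc K)) n =
      (\<Sum>i=0..n. fps_nth (P (Suc K) oo fps_X ^ Suc K) i * fps_nth (gen_partial P K) (n - i))"
    unfolding gen_partial_Suc by (subst mult.commute, subst fps_mult_nth) simp
  also have "\<dots> = (\<Sum>i\<in>(\<lambda>j. Suc K * j) ` ?J.
      fps_nth (P (Suc K) oo fps_X ^ Suc K) i * fps_nth (gen_partial P K) (n - i))"
    by (intro sum.mono_neutral_right) (auto simp: fps_nth_compose_X_power simp del: power_Suc)
  also have "\<dots> = (\<Sum>j\<in>?J. fps_nth (P (Suc K)) j * fps_nth (gen_partial P K) (n - Suc K * j))"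
    by (subst sum.reindex)
      (auto simp: fps_nth_compose_X_power inj_on_def simp del: power_Suc mult_Suc intro!: sum.cong)
  also have "\<dots> = (\<Sum>j\<in>?J. \<Sum>p\<in>partitions_upto K (n - Suc K * j). weight_of P (p + replicate_mset j (Suc K)))"
    unfolding Suc.IH sum_distrib_left by (intro sum.cong) (auto simp: weight mult.commute)
  also have "\<dots> = (\<Sum>(j, p)\<in>(SIGMA j:?J. partitions_upto K (n - Suc K * j)). weight_of P (p + replicate_mset j (Suc K)))"
    using fin finite_partitions_upto by (subst sum.Sigma) auto
  also have "\<dots> = (\<Sum>p\<in>partitions_upto (Suc K) n. weight_of P p)"
    using sum.reindex_bij_betw[OF bij_betw_partitions_upto_Suc[of K n], of "weight_of P"]
    by (simp add: case_prod_unfold)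
  finally show ?case .
qed

lemma fps_nth_gen_fun_eq_sum_weight:
  assumes "fps_nth f 0 = 1"
  shows "fps_nth (gen_fun f b) n = (\<Sum>p\<in>partitions_of n. weight f b p)"
  using fps_nth_gen_fun[OF assms order.refl, of b n]
  by (simp add: fps_nth_gen_partial partitions_upto_self weight_eq_weight_of)

section \<open>Real powers of a power series\<close>

text \<open>With nonnegative coefficients, convergence at x \<ge> 0 is absolute: Cauchy products
  converge, and coefficientwise inequalities pass to the sums.\<close>

definition nonneg_sums :: "real fps \<Rightarrow> real \<Rightarrow> real \<Rightarrow> bool" where
  "nonneg_sums A x s \<longleftrightarrow> (\<forall>n. fps_nth A n \<ge> 0) \<and> (\<lambda>n. fps_nth A n * x ^ n) sums s"

lemma nonneg_sums_1: "nonneg_sums 1 x 1"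
  using sums_finite[of "{0}" "\<lambda>n. fps_nth 1 n * x ^ n"] by (auto simp: nonneg_sums_def)

lemma nonneg_sums_add:
  assumes "nonneg_sums A x \<alpha>" "nonneg_sums B x \<beta>"
  shows "nonneg_sums (A + B) x (\<alpha> + \<beta>)"
  using assms by (auto simp: nonneg_sums_def ring_distribs intro: sums_add)

lemma nonneg_sums_mult:
  assumes "nonneg_sums A x \<alpha>" "nonneg_sums B x \<beta>" "x \<ge> 0"
  shows "nonneg_sums (A * B) x (\<alpha> * \<beta>)"
proof -
  have "(\<lambda>k. \<Sum>i\<le>k. (fps_nth A i * x ^ i) * (fps_nth B (k - i) * x ^ (k - i))) sums
      ((\<Sum>k. fps_nth A k * x ^ k) * (\<Sum>k. fps_nth B k * x ^ k))"
    by (rule Cauchy_product_sums)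
      (use assms in \<open>auto simp: nonneg_sums_def abs_mult intro: sums_summable\<close>)
  also have "(\<lambda>k. \<Sum>i\<le>k. (fps_nth A i * x ^ i) * (fps_nth B (k - i) * x ^ (k - i))) =
      (\<lambda>k. fps_nth (A * B) k * x ^ k)"
    by (auto simp: fps_mult_nth sum_distrib_right atLeast0AtMost fun_eq_iff
        intro!: sum.cong simp flip: power_add)
  finally show ?thesis
    using assms by (auto simp: nonneg_sums_def fps_mult_nth sums_iff intro!: sum_nonneg)
qed

lemma nonneg_sums_compose_X_power:
  assumes "nonneg_sums P (x ^ k) s" "k \<ge> 1"
  shows "nonneg_sums (P oo fps_X ^ k) x s"
proof -
  have "strict_mono (\<lambda>n. k * n)"
    using assms(2) by (auto intro!: strict_monoI)
  then have "(\<lambda>n. fps_nth (P oo fps_X ^ k) (k * n) * x ^ (k * n)) sums s \<longleftrightarrow>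
      (\<lambda>n. fps_nth (P oo fps_X ^ k) n * x ^ n) sums s"
    using assms(2) by (intro sums_mono_reindex) (auto simp: fps_nth_compose_X_power)
  then show ?thesis
    using assms by (auto simp: nonneg_sums_def fps_nth_compose_X_power power_mult)
qed

text \<open>The Euler operator X d/dX. Applied to a generating function by size it yields the
  numerator of the mean size.\<close>

definition fps_theta :: "real fps \<Rightarrow> real fps" where
  "fps_theta A = fps_X * fps_deriv A"

lemma fps_nth_theta: "fps_nth (fps_theta A) n = real n * fps_nth A n"
  by (cases n) (auto simp: fps_theta_def)

lemma fps_theta_1 [simp]: "fps_theta 1 = 0"
  by (simp add: fps_theta_def)

lemma fps_theta_mult: "fps_theta (A * B) = fps_theta A * B + A * fps_theta B"
  by (simp add: fps_theta_def algebra_simps)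

lemma fps_theta_compose_X_power:
  "k \<ge> 1 \<Longrightarrow> fps_theta (A oo fps_X ^ k) = fps_const (real k) * (fps_theta A oo fps_X ^ k)"
  by (rule fps_ext) (auto simp: fps_nth_theta fps_nth_compose_X_power simp flip: of_nat_mult)

lemma nonneg_sums_cmult: "nonneg_sums A x s \<Longrightarrow> c \<ge> 0 \<Longrightarrow> nonneg_sums (fps_const c * A) x (c * s)"
  by (auto simp: nonneg_sums_def mult.assoc intro: sums_mult)

lemma nonneg_sums_gen_partial:
  assumes "\<And>k. k \<ge> 1 \<Longrightarrow> k \<le> K \<Longrightarrow> nonneg_sums (P k) (x ^ k) (v k)" "x \<ge> 0"
  shows "nonneg_sums (gen_partial P K) x (\<Prod>k=1..K. v k)"
  using assms(1)
proof (induction K)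
  case (Suc K)
  have "nonneg_sums (P (Suc K) oo fps_X ^ Suc K) x (v (Suc K))"
    using Suc.prems[of "Suc K"] by (intro nonneg_sums_compose_X_power) auto
  with Suc assms(2) show ?case
    by (simp add: gen_partial_Suc nonneg_sums_mult del: power_Suc)
qed (auto intro: nonneg_sums_1)

text \<open>Here w k is the logarithmic derivative, in the sense of \<open>fps_theta\<close>, of
  factor k. Logarithmic derivatives of a product add up, and the substitution of X^k contributes the
  factor k.\<close>

lemma nonneg_sums_theta_gen_partial:
  assumes "\<And>k. k \<ge> 1 \<Longrightarrow> k \<le> K \<Longrightarrow> nonneg_sums (P k) (x ^ k) (v k)"
    and "\<And>k. k \<ge> 1 \<Longrightarrow> k \<le> K \<Longrightarrow> nonneg_sums (fps_theta (P k)) (x ^ k) (v k * w k)"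
    and "x \<ge> 0"
  shows "nonneg_sums (fps_theta (gen_partial P K)) x ((\<Prod>k=1..K. v k) * (\<Sum>k=1..K. real k * w k))"
  using assms(1,2)
proof (induction K)
  case (Suc K)
  let ?A = "P (Suc K) oo fps_X ^ Suc K"
  have A: "nonneg_sums ?A x (v (Suc K))"
    using Suc.prems[of "Suc K"] by (intro nonneg_sums_compose_X_power) auto
  have A': "nonneg_sums (fps_theta ?A) x (real (Suc K) * (v (Suc K) * w (Suc K)))"
    using Suc.prems[of "Suc K"]
    by (subst fps_theta_compose_X_power; (intro nonneg_sums_cmult nonneg_sums_compose_X_power)?) auto
  have B: "nonneg_sums (gen_partial P K) x (\<Prod>k=1..K. v k)"
    using Suc.prems assms(3) by (intro nonneg_sums_gen_partial) auto
  have B': "nonneg_sums (fps_theta (gen_partial P K)) x ((\<Prod>k=1..K. v k) * (\<Sum>k=1..K. real k * w k))"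
    using Suc by auto
  have "nonneg_sums (fps_theta (gen_partial P (Suc K))) x
     ((\<Prod>k=1..K. v k) * (\<Sum>k=1..K. real k * w k) * v (Suc K) +
      (\<Prod>k=1..K. v k) * (real (Suc K) * (v (Suc K) * w (Suc K))))"
    unfolding gen_partial_Suc fps_theta_mult using A A' B B' assms(3)
    by (intro nonneg_sums_add nonneg_sums_mult)
  then show ?case by (simp add: algebra_simps)
qed (auto simp: nonneg_sums_def)

section \<open>Convergence and values of the real powers\<close>

lemma fps_conv_radius_greaterI:
  fixes P :: "real fps"
  assumes "\<And>v. 0 \<le> v \<Longrightarrow> ereal v < R \<Longrightarrow> summable (\<lambda>n. fps_nth P n * v ^ n)" "0 \<le> u" "ereal u < R"
  shows "fps_conv_radius P > ereal u"
proof -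
  obtain v where v: "ereal u < ereal v" "ereal v < R"
    using assms(3) ereal_dense2 by blast
  with assms have "summable (\<lambda>n. fps_nth P n * v ^ n)" by auto
  then have "conv_radius (fps_nth P) \<ge> norm v"
    by (intro conv_radius_geI)
  moreover have "ereal u < ereal (norm v)"
    using v by simp
  ultimately show ?thesis
    unfolding fps_conv_radius_def by (rule less_le_trans[rotated])
qed

lemma sum_Cauchy_product_le:
  fixes a b :: "nat \<Rightarrow> real"
  assumes "\<And>i. a i \<ge> 0" "\<And>i. b i \<ge> 0"
  shows "(\<Sum>n<N. \<Sum>i\<le>n. a i * b (n - i)) \<le> (\<Sum>i<N. a i) * (\<Sum>j<N. b j)"
proof -
  have "(\<Sum>n<N. \<Sum>i\<le>n. a i * b (n - i)) = (\<Sum>(i,j)\<in>{(i,j). i + j < N}. a i * b j)"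
    by (simp add: sum.triangle_reindex)
  also have "\<dots> \<le> (\<Sum>(i,j)\<in>{..<N} \<times> {..<N}. a i * b j)"
    using assms by (intro sum_mono2) auto
  finally show ?thesis
    by (simp add: sum_product sum.cartesian_product)
qed

lemma eval_fps_ge_1:
  fixes f :: "real fps"
  assumes f0: "fps_nth f 0 = 1" and f_nonneg: "\<And>n. fps_nth f n \<ge> 0"
    and "0 \<le> u" "ereal u < fps_conv_radius f"
  shows "eval_fps f u \<ge> 1"
proof -
  have "(\<lambda>n. fps_nth f n * u ^ n) sums eval_fps f u"
    using assms by (intro sums_eval_fps) auto
  then have "(\<Sum>n\<in>{0}. fps_nth f n * u ^ n) \<le> eval_fps f u"
    using sum_le_suminf[of "\<lambda>n. fps_nth f n * u ^ n" "{0}"] f_nonneg assms unfolding sums_iff by auto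
  then show ?thesis by (simp add: f0)
qed

context
  fixes f :: "real fps" and c :: real
  assumes f0: "fps_nth f 0 = 1" and f_nonneg: "\<And>n. fps_nth f n \<ge> 0" and c_nonneg: "c \<ge> 0"
    and rpow_nonneg: "\<And>n. fps_nth (fps_rpow f c) n \<ge> 0"
begin

text \<open>A bound on partial sums has to precede any statement on convergence. By nonnegativity
  and f_0 = 1 the differential equation gives P' \<le> c f' P coefficientwise, and Gronwall's
  argument for the truncated polynomial does the rest.\<close>

lemma sum_fps_rpow_le:
  assumes "0 \<le> u" "ereal u < fps_conv_radius f"
  shows "(\<Sum>j\<le>N. fps_nth (fps_rpow f c) j * u ^ j) \<le> exp (c * (eval_fps f u - 1))"
proof -
  let ?P = "fps_rpow f c" let ?f' = "fps_deriv f"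
  let ?S = "\<lambda>t. \<Sum>j\<le>N. fps_nth ?P j * t ^ j"
  let ?S' = "\<lambda>t. \<Sum>n<N. fps_nth (fps_deriv ?P) n * t ^ n"
  have coeff: "fps_nth (fps_deriv ?P) n \<le> c * (\<Sum>i\<le>n. fps_nth ?f' i * fps_nth ?P (n - i))" for n
  proof -
    \<comment> \<open>Only the term i = 0 of the product f P' is kept.\<close>
    have "fps_nth (fps_deriv ?P) n = (\<Sum>i\<in>{0}. fps_nth f i * fps_nth (fps_deriv ?P) (n - i))"
      by (simp add: f0)
    also have "\<dots> \<le> (\<Sum>i=0..n. fps_nth f i * fps_nth (fps_deriv ?P) (n - i))"
      using f_nonneg rpow_nonneg by (intro sum_mono2) auto
    also have "\<dots> = fps_nth (f * fps_deriv ?P) n"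
      by (simp add: fps_mult_nth)
    also have "\<dots> = c * (\<Sum>i\<le>n. fps_nth ?f' i * fps_nth ?P (n - i))"
      unfolding fps_rpow_ODE[OF f0] mult.assoc fps_mult_left_const_nth
      by (simp add: fps_mult_nth atLeast0AtMost)
    finally show ?thesis .
  qed
  have S': "?S' t \<le> c * eval_fps ?f' t * ?S t" if t: "0 \<le> t" "t \<le> u" for t
  proof -
    have t': "ereal t < fps_conv_radius f"
      using t assms by (metis ereal_less_eq(3) order.strict_trans1)
    have "?S' t \<le> (\<Sum>n<N. c * (\<Sum>i\<le>n. fps_nth ?f' i * fps_nth ?P (n - i)) * t ^ n)"
      using coeff t by (intro sum_mono mult_right_mono) auto
    also have "\<dots> = c * (\<Sum>n<N. \<Sum>i\<le>n. (fps_nth ?f' i * t ^ i) * (fps_nth ?P (n - i) * t ^ (n - i)))"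
      by (auto simp: sum_distrib_left sum_distrib_right intro!: sum.cong simp flip: power_add)
    also have "\<dots> \<le> c * ((\<Sum>i<N. fps_nth ?f' i * t ^ i) * (\<Sum>j<N. fps_nth ?P j * t ^ j))"
      using c_nonneg f_nonneg rpow_nonneg t by (intro mult_left_mono sum_Cauchy_product_le) auto
    also have "\<dots> \<le> c * (eval_fps ?f' t * ?S t)"
    proof (intro mult_left_mono mult_mono)
      have "(\<lambda>n. fps_nth ?f' n * t ^ n) sums eval_fps ?f' t"
        using t t' fps_conv_radius_deriv[of f] by (intro sums_eval_fps) (auto elim: less_le_trans)
      moreover have "fps_nth ?f' n * t ^ n \<ge> 0" for n
        using f_nonneg t by simp
      ultimately show "(\<Sum>i<N. fps_nth ?f' i * t ^ i) \<le> eval_fps ?f' t" "0 \<le> eval_fps ?f' t"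
        using sum_le_suminf[of "\<lambda>n. fps_nth ?f' n * t ^ n" "{..<N}"]
          suminf_nonneg[of "\<lambda>n. fps_nth ?f' n * t ^ n"] unfolding sums_iff by auto
      show "(\<Sum>j<N. fps_nth ?P j * t ^ j) \<le> ?S t"
        using rpow_nonneg t by (intro sum_mono2) auto
    qed (use c_nonneg rpow_nonneg t in \<open>auto intro!: sum_nonneg\<close>)
    finally show ?thesis by (simp add: mult_ac)
  qed
  have "(?S has_real_derivative ?S' t) (at t)" for t
  proof -
    have "(?S has_real_derivative (\<Sum>j\<le>N. fps_nth ?P j * (real j * t ^ (j - 1)))) (at t)"
      by (auto intro!: derivative_eq_intros sum.cong)
    also have "(\<Sum>j\<le>N. fps_nth ?P j * (real j * t ^ (j - 1))) = ?S' t"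
      by (subst lessThan_Suc_atMost [symmetric], subst sum.lessThan_Suc_shift) (simp add: mult_ac)
    finally show ?thesis .
  qed
  note dS = this
  \<comment> \<open>Truncated sum divided by the claimed bound; its derivative is nonpositive by
    S'.\<close>
  define E where "E = (\<lambda>t. ?S t * exp (- c * (eval_fps f t - 1)))"
  have dE: "(E has_real_derivative (?S' t - c * eval_fps ?f' t * ?S t) * exp (- c * (eval_fps f t - 1))) (at t)"
    if "0 \<le> t" "t \<le> u" for t
  proof -
    have "ereal \<bar>t\<bar> < fps_conv_radius f"
      using that assms by (metis abs_of_nonneg ereal_less_eq(3) order.strict_trans1)
    then have d: "(eval_fps f has_real_derivative eval_fps ?f' t) (at t)"
      by (intro has_field_derivative_eval_fps) auto
    show ?thesis unfolding E_def
      by (rule derivative_eq_intros dS d refl | simp)+ (simp add: algebra_simps)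
  qed
  have "E u \<le> E 0"
    using assms(1)
  proof (rule DERIV_nonpos_imp_nonincreasing)
    fix t assume "0 \<le> t" "t \<le> u"
    with dE S' show "\<exists>y. (E has_real_derivative y) (at t) \<and> y \<le> 0"
      by (intro exI[of _ "(?S' t - c * eval_fps ?f' t * ?S t) * exp (- c * (eval_fps f t - 1))"])
        (auto intro!: mult_nonpos_nonneg)
  qed
  also have "E 0 = 1"
    by (simp add: E_def eval_fps_at_0 f0 power_0_left mult_delta_right)
  finally have "?S u * exp (- c * (eval_fps f u - 1)) \<le> 1"
    by (simp add: E_def)
  moreover have "exp (- c * (eval_fps f u - 1)) = 1 / exp (c * (eval_fps f u - 1))"
    by (simp add: exp_minus inverse_eq_divide)
  ultimately show ?thesis
    by (simp add: divide_le_eq)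
qed

lemma summable_fps_rpow:
  assumes "0 \<le> u" "ereal u < fps_conv_radius f"
  shows "summable (\<lambda>n. fps_nth (fps_rpow f c) n * u ^ n)"
proof (rule bounded_imp_summable)
  show "(\<Sum>j\<le>N. fps_nth (fps_rpow f c) j * u ^ j) \<le> exp (c * (eval_fps f u - 1))" for N
    using sum_fps_rpow_le[OF assms] .
qed (use rpow_nonneg assms in auto)

lemma fps_conv_radius_rpow:
  "0 \<le> u \<Longrightarrow> ereal u < fps_conv_radius f \<Longrightarrow> ereal u < fps_conv_radius (fps_rpow f c)"
  using summable_fps_rpow by (rule fps_conv_radius_greaterI)

lemma eval_fps_deriv_rpow:
  assumes "0 \<le> u" "ereal u < fps_conv_radius f"
  shows "eval_fps f u * eval_fps (fps_deriv (fps_rpow f c)) u =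
    c * eval_fps (fps_deriv f) u * eval_fps (fps_rpow f c) u"
proof -
  have u: "ereal (norm u) < fps_conv_radius f" "ereal (norm u) < fps_conv_radius (fps_rpow f c)"
    using fps_conv_radius_rpow assms by auto
  have u': "ereal (norm u) < fps_conv_radius (fps_deriv f)" "ereal (norm u) < fps_conv_radius (fps_deriv (fps_rpow f c))"
    using u fps_conv_radius_deriv less_le_trans by blast+
  have "eval_fps (f * fps_deriv (fps_rpow f c)) u = eval_fps (fps_const c * (fps_deriv f * fps_rpow f c)) u"
    by (simp add: fps_rpow_ODE[OF f0] mult.assoc)
  moreover have "ereal (norm u) < fps_conv_radius (fps_deriv f * fps_rpow f c)"
    using u u' fps_conv_radius_mult[of "fps_deriv f" "fps_rpow f c"] by (auto elim!: less_le_trans[rotated])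
  ultimately show ?thesis
    using u u' by (simp add: eval_fps_mult mult.assoc)
qed

text \<open>The quotient of both sides has derivative 0 by the differential equation and equals 1 at
  0.\<close>

lemma eval_fps_rpow:
  assumes "0 \<le> u" "ereal u < fps_conv_radius f"
  shows "eval_fps (fps_rpow f c) u = eval_fps f u powr c"
proof -
  let ?P = "fps_rpow f c"
  define E where "E = (\<lambda>t. eval_fps ?P t * eval_fps f t powr (- c))"
  have "(E has_real_derivative 0) (at t within {0..u})" if t: "t \<in> {0..u}" for t
  proof -
    have t': "0 \<le> t" "ereal t < fps_conv_radius f"
      using t assms by (auto elim: order.strict_trans1[rotated])
    have d: "(eval_fps f has_real_derivative eval_fps (fps_deriv f) t) (at t within {0..u})"
      "(eval_fps ?P has_real_derivative eval_fps (fps_deriv ?P) t) (at t within {0..u})"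
      using t' fps_conv_radius_rpow[OF t'] by (intro has_field_derivative_eval_fps; simp)+
    have f1: "eval_fps f t \<ge> 1"
      using f0 f_nonneg t' by (rule eval_fps_ge_1)
    have d_powr: "((\<lambda>t. eval_fps f t powr (- c)) has_real_derivative
        (- c * eval_fps f t powr (- c - 1)) * eval_fps (fps_deriv f) t) (at t within {0..u})"
      using f1 by (intro DERIV_chain2[OF has_real_derivative_powr d(1)]) auto
    have "(E has_real_derivative (eval_fps (fps_deriv ?P) t * eval_fps f t powr (- c) +
       eval_fps ?P t * (eval_fps f t powr (- c) * (- c * eval_fps (fps_deriv f) t / eval_fps f t)))) (at t within {0..u})"
      unfolding E_def using DERIV_mult[OF d(2) d_powr] f1
      by (simp add: powr_diff algebra_simps)
    moreover have "eval_fps (fps_deriv ?P) t * eval_fps f t powr (- c) +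
       eval_fps ?P t * (eval_fps f t powr (- c) * (- c * eval_fps (fps_deriv f) t / eval_fps f t)) = 
       eval_fps f t powr (- c) / eval_fps f t *
         (eval_fps f t * eval_fps (fps_deriv ?P) t - c * eval_fps (fps_deriv f) t * eval_fps ?P t)"
      using f1 by (simp add: field_simps)
    ultimately show ?thesis
      using eval_fps_deriv_rpow[OF t'] by simp
  qed
  then obtain C where C: "\<And>t. t \<in> {0..u} \<Longrightarrow> E t = C"
    using has_field_derivative_zero_constant[of "{0..u}" E] by auto
  have "E u = E 0"
    using C[of u] C[of 0] assms by simp
  also have "E 0 = 1"
    by (simp add: E_def eval_fps_at_0 f0)
  finally show ?thesis
    using eval_fps_ge_1[OF f0 f_nonneg assms] by (simp add: E_def powr_minus field_simps)
qed

lemma nonneg_sums_rpow: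
  assumes "0 \<le> u" "ereal u < fps_conv_radius f"
  shows "nonneg_sums (fps_rpow f c) u (eval_fps f u powr c)"
  using rpow_nonneg sums_eval_fps[of u "fps_rpow f c"] fps_conv_radius_rpow[OF assms] assms
  by (auto simp: nonneg_sums_def eval_fps_rpow)

lemma nonneg_sums_theta_rpow:
  assumes "0 \<le> u" "ereal u < fps_conv_radius f"
  shows "nonneg_sums (fps_theta (fps_rpow f c)) u
    (eval_fps f u powr c * (c * (u * (eval_fps (fps_deriv f) u / eval_fps f u))))"
proof -
  let ?P = "fps_rpow f c"
  have u: "ereal (norm u) < fps_conv_radius (fps_deriv ?P)"
    using fps_conv_radius_rpow[OF assms] fps_conv_radius_deriv[of ?P] assms
    by (auto elim: less_le_trans)
  then have u': "ereal (norm u) < fps_conv_radius (fps_theta ?P)"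
    using fps_conv_radius_mult[of fps_X "fps_deriv ?P"] unfolding fps_theta_def
    by (auto elim!: less_le_trans[rotated])
  have "eval_fps (fps_theta ?P) u = u * eval_fps (fps_deriv ?P) u"
    unfolding fps_theta_def using u by (subst eval_fps_mult) auto
  also have "eval_fps (fps_deriv ?P) u = c * eval_fps (fps_deriv f) u * (eval_fps f u powr c) / eval_fps f u"
    using eval_fps_deriv_rpow[OF assms] eval_fps_rpow[OF assms] eval_fps_ge_1[OF f0 f_nonneg assms]
    by (simp add: field_simps)
  finally have "eval_fps (fps_theta ?P) u =
      eval_fps f u powr c * (c * (u * (eval_fps (fps_deriv f) u / eval_fps f u)))"
    by simp
  moreover have "(\<lambda>n. fps_nth (fps_theta ?P) n * u ^ n) sums eval_fps (fps_theta ?P) u"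
    using u' by (intro sums_eval_fps)
  ultimately show ?thesis
    using rpow_nonneg by (simp add: nonneg_sums_def fps_nth_theta)
qed

end

section \<open>The grand and small canonical measures\<close>

declare of_nat_sum_mset [simp del]

lemma nonneg_sums_le:
  assumes "nonneg_sums A x s" "nonneg_sums B x t" "\<And>n. fps_nth A n \<le> fps_nth B n" "x \<ge> 0"
  shows "s \<le> t"
  using assms unfolding nonneg_sums_def
  by (intro sums_le[of "\<lambda>n. fps_nth A n * x ^ n" "\<lambda>n. fps_nth B n * x ^ n" s t])
    (auto intro: mult_right_mono)

text \<open>The value s K is squeezed between the partial sum of B up to K, on which A K agrees with
  B, and the full sum t.\<close>

lemma nonneg_sums_tendsto:
  assumes A: "\<And>K. nonneg_sums (A K) x (s K)" and B: "nonneg_sums B x t"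
    and le: "\<And>K n. fps_nth (A K) n \<le> fps_nth B n"
    and eq: "\<And>K n. n \<le> K \<Longrightarrow> fps_nth (A K) n = fps_nth B n" and x: "x \<ge> 0"
  shows "s \<longlonglongrightarrow> t"
proof (rule tendsto_sandwich)
  show "(\<lambda>K. \<Sum>n\<le>K. fps_nth B n * x ^ n) \<longlonglongrightarrow> t"
    using B by (simp add: nonneg_sums_def sums_def_le)
  show "\<forall>\<^sub>F K in sequentially. (\<Sum>n\<le>K. fps_nth B n * x ^ n) \<le> s K"
  proof (intro always_eventually allI)
    fix K
    have "(\<Sum>n\<le>K. fps_nth B n * x ^ n) = (\<Sum>n\<le>K. fps_nth (A K) n * x ^ n)"
      by (simp add: eq)
    also have "\<dots> \<le> (\<Sum>n. fps_nth (A K) n * x ^ n)"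
      using A[of K] x by (intro sum_le_suminf) (auto simp: nonneg_sums_def sums_iff)
    finally show "(\<Sum>n\<le>K. fps_nth B n * x ^ n) \<le> s K"
      using A[of K] by (simp add: nonneg_sums_def sums_iff)
  qed
  show "\<forall>\<^sub>F K in sequentially. s K \<le> t"
    using nonneg_sums_le[OF A B le x] by simp
qed auto

section \<open>The partition model: normalisation and mean size\<close>

locale partition_model =
  fixes f :: "real fps" and b :: "nat \<Rightarrow> real"
  assumes f0: "fps_nth f 0 = 1" and b1: "b 1 = 1" and b_nonneg: "\<And>k. k \<ge> 1 \<Longrightarrow> b k \<ge> 0"
    and rpow_nonneg: "\<And>k j. k \<ge> 1 \<Longrightarrow> fps_nth (fps_rpow f (b k)) j \<ge> 0"
    and gen_fun_pos: "\<And>n. fps_nth (gen_fun f b) n > 0"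
    and radius: "fps_conv_radius f \<ge> 1"
begin

lemma f_nonneg: "fps_nth f n \<ge> 0"
  using rpow_nonneg[of 1 n] unfolding b1 fps_rpow_1[OF f0] by simp

text \<open>As b_1 = 1, the coefficient of X in the Euler product is that of f, and a_1 > 0 is
  assumed.\<close>

lemma f1_pos: "fps_nth f 1 > 0"
proof -
  have "fps_nth (gen_fun f b) 1 = fps_nth f 1"
    using fps_nth_gen_fun[OF f0, of 1 1 b] b1 fps_rpow_1[OF f0] by (simp add: gen_partial_def)
  with gen_fun_pos[of 1] show ?thesis by simp
qed

lemma less_radius: "u < 1 \<Longrightarrow> ereal u < fps_conv_radius f"
  by (rule less_le_trans[OF _ radius]) (simp add: one_ereal_def)

text \<open>The mean of the law with weights f_n u^n / f(u); it is called \<open>H\<close> once the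
  singularity enters.\<close>

definition tilt_mean :: "real \<Rightarrow> real" where
  "tilt_mean u = u * (eval_fps (fps_deriv f) u / eval_fps f u)"

abbreviation P where "P k \<equiv> fps_rpow f (b k)"

abbreviation E where "E \<equiv> eval_fps f"

lemma E_ge_1: "0 \<le> u \<Longrightarrow> u < 1 \<Longrightarrow> E u \<ge> 1"
  by (intro eval_fps_ge_1 f0 f_nonneg less_radius)

lemma power_less_1: "0 \<le> x \<Longrightarrow> x < 1 \<Longrightarrow> k \<ge> 1 \<Longrightarrow> x ^ k < (1::real)"
  by (simp add: power_less_one_iff)

lemma nonneg_sums_P:
  assumes "0 \<le> u" "u < 1" "k \<ge> 1"
  shows "nonneg_sums (P k) u (E u powr b k)"
  using assms by (intro nonneg_sums_rpow f0 f_nonneg b_nonneg rpow_nonneg less_radius)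

lemma nonneg_sums_theta_P:
  assumes "0 \<le> u" "u < 1" "k \<ge> 1"
  shows "nonneg_sums (fps_theta (P k)) u (E u powr b k * (b k * tilt_mean u))"
  unfolding tilt_mean_def using assms
  by (intro nonneg_sums_theta_rpow f0 f_nonneg b_nonneg rpow_nonneg less_radius)

lemma nonneg_sums_partial:
  assumes "0 \<le> x" "x < 1"
  shows "nonneg_sums (gen_partial P K) x (\<Prod>k=1..K. E (x ^ k) powr b k)"
  using assms by (intro nonneg_sums_gen_partial nonneg_sums_P) (auto simp: power_less_1)

lemma nonneg_sums_theta_partial:
  assumes "0 \<le> x" "x < 1"
  shows "nonneg_sums (fps_theta (gen_partial P K)) x
    ((\<Prod>k=1..K. E (x ^ k) powr b k) * (\<Sum>k=1..K. real k * (b k * tilt_mean (x ^ k))))"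
  using assms by (intro nonneg_sums_theta_gen_partial nonneg_sums_P nonneg_sums_theta_P)
    (auto simp: power_less_1)

lemma weight_nonneg: "p \<in> partitions \<Longrightarrow> weight f b p \<ge> 0"
  unfolding weight_def partitions_def by (intro prod_nonneg rpow_nonneg) (auto intro!: Nat.gr0I simp: Suc_le_eq)

lemma partitions_of_subset: "partitions_of n \<subseteq> partitions"
  by (auto simp: partitions_of_def)

lemma gen_partial_le: "fps_nth (gen_partial P K) n \<le> fps_nth (gen_fun f b) n"
proof -
  have *: "partitions_upto K n \<subseteq> partitions_of n"
    by (auto simp: partitions_upto_def partitions_of_def partitions_def)
  then show ?thesis
    using finite_partitions_of partitions_of_subset
    by (auto simp: fps_nth_gen_partial fps_nth_gen_fun_eq_sum_weight[OF f0] weight_eq_weight_of[symmetric]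
        intro!: sum_mono2 weight_nonneg)
qed

text \<open>The contribution of the partition with the single part n.\<close>

lemma gen_fun_ge: "n \<ge> 1 \<Longrightarrow> b n * fps_nth f 1 \<le> fps_nth (gen_fun f b) n"
proof -
  assume n: "n \<ge> 1"
  have "b n * fps_nth f 1 = (\<Sum>p\<in>{{#n#}}. weight f b p)"
    using fps_rpow_nth_1[OF f0, of "b n"] by (simp add: weight_def)
  also have "\<dots> \<le> (\<Sum>p\<in>partitions_of n. weight f b p)"
    using n partitions_of_subset
    by (intro sum_mono2 finite_partitions_of weight_nonneg) (auto simp: partitions_of_def partitions_def)
  finally show ?thesis by (simp add: fps_nth_gen_fun_eq_sum_weight[OF f0])
qed

text \<open>For x \<ge> 1 the terms of the series would dominate those of the divergent series of
  the b_k, by \<open>gen_fun_ge\<close>. This is how x_n < 1 is derived from convergence at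
  x_n.\<close>

lemma summable_imp_less_1:
  assumes "summable (\<lambda>m. fps_nth (gen_fun f b) m * x ^ m)" "\<not> summable b"
  shows "x < 1"
proof (rule ccontr)
  assume "\<not> x < 1"
  then have "norm (b m) \<le> fps_nth (gen_fun f b) m * x ^ m / fps_nth f 1" if "m \<ge> 1" for m
  proof -
    have "b m * fps_nth f 1 \<le> fps_nth (gen_fun f b) m * 1"
      using gen_fun_ge[OF that] by simp
    also have "\<dots> \<le> fps_nth (gen_fun f b) m * x ^ m"
      using \<open>\<not> x < 1\<close> gen_fun_pos[of m] by (intro mult_left_mono one_le_power) auto
    finally show ?thesis using f1_pos b_nonneg[OF that] by (simp add: field_simps)
  qed
  then have "summable b"
    by (intro summable_comparison_test'[OF summable_divide[OF assms(1), of "fps_nth f 1"], of 1])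
  with assms show False by simp
qed

context
  fixes x :: real
  assumes x: "0 < x" "x < 1" and summable_gen_fun: "summable (\<lambda>m. fps_nth (gen_fun f b) m * x ^ m)"
begin

definition F where "F = eval_fps (gen_fun f b) x"

lemma nonneg_sums_F: "nonneg_sums (gen_fun f b) x F"
  using summable_gen_fun gen_fun_pos by (simp add: nonneg_sums_def F_def eval_fps_def less_imp_le summable_sums)

lemma partial_le_F: "(\<Prod>k=1..K. E (x ^ k) powr b k) \<le> F"
  using nonneg_sums_le[OF nonneg_sums_partial nonneg_sums_F gen_partial_le] x by simp

lemma F_pos: "F > 0"
  using partial_le_F[of 0] by simp

lemma partial_tendsto_F: "(\<lambda>K. \<Prod>k=1..K. E (x ^ k) powr b k) \<longlonglongrightarrow> F"
  using x by (intro nonneg_sums_tendsto[OF nonneg_sums_partial nonneg_sums_F gen_partial_le])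
    (auto simp: fps_nth_gen_fun[OF f0])

lemma grand_weight_nonneg: "p \<in> partitions \<Longrightarrow> 0 \<le> x ^ sum_mset p / F * weight f b p"
  using x F_pos weight_nonneg by (simp add: less_imp_le)

lemma measure_grand_canonical:
  "measure (grand_canonical f b x) (partitions_of n) = fps_nth (gen_fun f b) n * x ^ n / F"
proof -
  have "emeasure (grand_canonical f b x) (partitions_of n) =
      (\<Sum>p\<in>partitions_of n. ennreal (x ^ sum_mset p / F * weight f b p))"
    unfolding grand_canonical_def F_def
    by (intro emeasure_point_measure_finite2 partitions_of_subset finite_partitions_of)
  also have "\<dots> = ennreal (\<Sum>p\<in>partitions_of n. x ^ sum_mset p / F * weight f b p)"
    using grand_weight_nonneg partitions_of_subset by (intro sum_ennreal) auto
  also have "(\<Sum>p\<in>partitions_of n. x ^ sum_mset p / F * weight f b p) =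
      (\<Sum>p\<in>partitions_of n. x ^ n / F * weight f b p)"
    by (intro sum.cong) (auto simp: partitions_of_def)
  also have "\<dots> = fps_nth (gen_fun f b) n * x ^ n / F"
    by (simp add: fps_nth_gen_fun_eq_sum_weight[OF f0] sum_distrib_left sum_divide_distrib mult_ac)
  finally show ?thesis
    using gen_fun_pos[of n] x F_pos by (simp add: measure_def less_imp_le)
qed

lemma nn_integral_grand_canonical:
  "(\<integral>\<^sup>+p. ennreal (real (sum_mset p)) \<partial>grand_canonical f b x) =
    (\<Sum>m. ennreal (real m * (fps_nth (gen_fun f b) m * x ^ m / F)))"
proof -
  let ?w = "\<lambda>p. ennreal (x ^ sum_mset p / F * weight f b p)"
  let ?g = "\<lambda>p. ?w p * ennreal (real (sum_mset p))"
  have "(\<integral>\<^sup>+p. ennreal (real (sum_mset p)) \<partial>grand_canonical f b x) = (\<integral>\<^sup>+p. ?g p \<partial>count_space partitions)"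
    unfolding grand_canonical_def point_measure_def F_def by (subst nn_integral_density) auto
  \<comment> \<open>Slicing by size: p lies in \<open>partitions_of m\<close> for m = N(p)
    only.\<close>
  also have "\<dots> = (\<integral>\<^sup>+p. (\<Sum>m. ?g p * indicator (partitions_of m) p) \<partial>count_space partitions)"
  proof (rule nn_integral_cong)
    fix p assume "p \<in> space (count_space partitions)"
    then have "(\<lambda>m. ?g p * indicator (partitions_of m) p) = (\<lambda>m. if m = sum_mset p then ?g p else 0)"
      by (auto simp: partitions_of_def indicator_def)
    then have "(\<lambda>m. ?g p * indicator (partitions_of m) p) sums ?g p"
      using sums_single[of "sum_mset p" "\<lambda>_. ?g p"] by simp
    then show "?g p = (\<Sum>m. ?g p * indicator (partitions_of m) p)"
      by (simp add: sums_iff)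
  qed
  also have "\<dots> = (\<Sum>m. \<integral>\<^sup>+p. ?g p * indicator (partitions_of m) p \<partial>count_space partitions)"
    by (intro nn_integral_suminf) auto
  also have "(\<lambda>m. \<integral>\<^sup>+p. ?g p * indicator (partitions_of m) p \<partial>count_space partitions) =
      (\<lambda>m. ennreal (real m * (fps_nth (gen_fun f b) m * x ^ m / F)))"
  proof
    fix m
    have "(\<integral>\<^sup>+p. ?g p * indicator (partitions_of m) p \<partial>count_space partitions) =
        (\<Sum>p\<in>partitions_of m. ?g p * indicator (partitions_of m) p)"
      by (intro nn_integral_count_space' finite_partitions_of partitions_of_subset) auto
    also have "\<dots> = (\<Sum>p\<in>partitions_of m. ennreal (real m * (x ^ m / F * weight f b p)))"
    proof (intro sum.cong refl)
      fix p assume p: "p \<in> partitions_of m"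
      with grand_weight_nonneg[of p] partitions_of_subset[of m]
      show "?g p * indicator (partitions_of m) p = ennreal (real m * (x ^ m / F * weight f b p))"
        by (subst mult.commute[of "real m"]) (auto simp: partitions_of_def simp flip: ennreal_mult'')
    qed
    also have "\<dots> = ennreal (\<Sum>p\<in>partitions_of m. real m * (x ^ m / F * weight f b p))"
      using partitions_of_subset[of m] x F_pos
      by (intro sum_ennreal mult_nonneg_nonneg weight_nonneg) (auto simp: less_imp_le)
    also have "(\<Sum>p\<in>partitions_of m. real m * (x ^ m / F * weight f b p)) =
        real m * (fps_nth (gen_fun f b) m * x ^ m / F)"
      by (simp add: fps_nth_gen_fun_eq_sum_weight[OF f0] sum_distrib_left sum_divide_distrib mult_ac)
    finally show "(\<integral>\<^sup>+p. ?g p * indicator (partitions_of m) p \<partial>count_space partitions) =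
        ennreal (real m * (fps_nth (gen_fun f b) m * x ^ m / F))" .
  qed
  finally show ?thesis .
qed

text \<open>Two evaluations of \<open>fps_theta\<close> of the Euler product at x: summation by size
  gives F n, and the product rule for the partial products gives, in the limit, F times the series
  over k.\<close>

lemma mean_parts_sums:
  assumes "(\<integral>p. real (sum_mset p) \<partial>grand_canonical f b x) = n" "n \<noteq> 0"
  shows "(\<lambda>k. real k * (b k * tilt_mean (x ^ k))) sums n"
proof -
  let ?a = "\<lambda>m. real m * (fps_nth (gen_fun f b) m * x ^ m / F)"
  \<comment> \<open>A non-integrable function has Bochner integral 0 by convention, so a nonzero
    mean yields integrability.\<close>
  have int: "integrable (grand_canonical f b x) (\<lambda>p. real (sum_mset p))"
    using assms not_integrable_integral_eq by metis
  have pos: "n \<ge> 0"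
    unfolding assms(1)[symmetric] by (intro Bochner_Integration.integral_nonneg of_nat_0_le_iff)
  have nonneg: "?a m \<ge> 0" for m
    using gen_fun_pos[of m] x F_pos by (simp add: less_imp_le)
  have *: "(\<Sum>m. ennreal (?a m)) = ennreal n"
    using nn_integral_eq_integral[OF int] assms(1) nn_integral_grand_canonical by simp
  then have "summable ?a"
    using nonneg by (intro summable_suminf_not_top) auto
  then have "(\<Sum>m. ?a m) = n"
    using * nonneg pos by (subst (asm) suminf_ennreal2) (auto simp: suminf_nonneg)
  with \<open>summable ?a\<close> have "(\<lambda>m. F * ?a m) sums (F * n)"
    by (intro sums_mult) (simp add: sums_iff)
  then have theta: "nonneg_sums (fps_theta (gen_fun f b)) x (F * n)"
    using gen_fun_pos F_pos by (auto simp: nonneg_sums_def fps_nth_theta less_imp_le mult.assoc)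
  have "(\<lambda>K. (\<Prod>k=1..K. E (x ^ k) powr b k) * (\<Sum>k=1..K. real k * (b k * tilt_mean (x ^ k)))) \<longlonglongrightarrow> F * n"
    using x by (intro nonneg_sums_tendsto[OF nonneg_sums_theta_partial theta])
      (auto simp: fps_nth_theta fps_nth_gen_fun[OF f0] intro!: mult_left_mono gen_partial_le)
  from tendsto_divide[OF this partial_tendsto_F] F_pos
  have "(\<lambda>K. (\<Prod>k=1..K. E (x ^ k) powr b k) * (\<Sum>k=1..K. real k * (b k * tilt_mean (x ^ k))) /
       (\<Prod>k=1..K. E (x ^ k) powr b k)) \<longlonglongrightarrow> n"
    by simp
  moreover have cancel: "(\<Prod>k=1..K. E (x ^ k) powr b k) * S /
      (\<Prod>k=1..K. E (x ^ k) powr b k) = S" for K S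
  proof -
    have "E (x ^ k) powr b k > 0" if "k \<in> {1..K}" for k
      using that x E_ge_1[of "x ^ k"] power_less_1[of x k] by auto
    then have "(\<Prod>k=1..K. E (x ^ k) powr b k) > 0"
      by (rule prod_pos)
    then show ?thesis by (intro nonzero_mult_div_cancel_left less_imp_neq[THEN not_sym])
  qed
  ultimately have "(\<lambda>K. \<Sum>k=1..K. real k * (b k * tilt_mean (x ^ k))) \<longlonglongrightarrow> n"
    by (simp only: cancel)
  moreover have "(\<Sum>k=1..K. real k * (b k * tilt_mean (x ^ k))) = (\<Sum>k\<le>K. real k * (b k * tilt_mean (x ^ k)))" for K
    by (intro sum.mono_neutral_left) auto
  ultimately show ?thesis
    by (simp add: sums_def_le)
qed

end

lemma measure_small_canonical:
  assumes "X \<subseteq> partitions_of n"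
  shows "measure (small_canonical f b n) X = (\<Sum>p\<in>X. weight f b p) / fps_nth (gen_fun f b) n"
proof -
  have "emeasure (small_canonical f b n) X =
      (\<Sum>p\<in>X. ennreal (1 / fps_nth (gen_fun f b) n * weight f b p))"
    unfolding small_canonical_def
    using finite_subset[OF assms finite_partitions_of] assms by (intro emeasure_point_measure_finite2)
  also have "\<dots> = ennreal (\<Sum>p\<in>X. 1 / fps_nth (gen_fun f b) n * weight f b p)"
    using assms gen_fun_pos[of n] partitions_of_subset[of n]
    by (intro sum_ennreal mult_nonneg_nonneg weight_nonneg) auto
  also have "(\<Sum>p\<in>X. 1 / fps_nth (gen_fun f b) n * weight f b p) =
      (\<Sum>p\<in>X. weight f b p) / fps_nth (gen_fun f b) n"
    by (simp add: sum_divide_distrib)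
  finally show ?thesis
    using assms gen_fun_pos[of n] partitions_of_subset[of n]
    by (auto simp: measure_def intro!: enn2real_ennreal divide_nonneg_pos sum_nonneg weight_nonneg)
qed

lemma space_small_canonical: "space (small_canonical f b n) = partitions_of n"
  by (simp add: small_canonical_def space_point_measure)

lemma measure_small_canonical_Compl:
  "measure (small_canonical f b n) {p \<in> partitions_of n. \<not> Q p} =
    1 - measure (small_canonical f b n) {p \<in> partitions_of n. Q p}"
proof -
  have "(\<Sum>p\<in>partitions_of n. weight f b p) =
      (\<Sum>p\<in>{p \<in> partitions_of n. Q p}. weight f b p) + (\<Sum>p\<in>{p \<in> partitions_of n. \<not> Q p}. weight f b p)"
    using finite_partitions_of[of n] by (subst sum.union_disjoint [symmetric]) (auto intro!: sum.cong)
  then show ?thesis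
    using gen_fun_pos[of n]
    by (simp add: measure_small_canonical fps_nth_gen_fun_eq_sum_weight[OF f0, symmetric] field_simps)
qed

end

section \<open>Regularly varying partial sums\<close>

definition partial_sum :: "(nat \<Rightarrow> real) \<Rightarrow> real \<Rightarrow> real" where
  "partial_sum b y = (\<Sum>j=1..nat \<lfloor>y\<rfloor>. b j)"

text \<open>The partial sums equal k^\<beta> l(k) at integers k only, so regular variation is first
  recorded along the integers p i and q i; \<open>B_regular\<close> extends it to real
  arguments.\<close>

locale regular_weights =
  fixes b :: "nat \<Rightarrow> real" and \<beta> :: real
  assumes b_1: "b 1 = 1" and b_ge_0: "\<And>k. k \<ge> 1 \<Longrightarrow> b k \<ge> 0" and \<beta>_pos: "\<beta> > 0"
    and ratio_nat: "\<And>p q. p \<ge> 1 \<Longrightarrow> q \<ge> 1 \<Longrightarrow>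
      (\<lambda>i. partial_sum b (real (p * i)) / partial_sum b (real (q * i))) \<longlonglongrightarrow> (real p / real q) powr \<beta>"

lemma regular_weightsI:
  assumes "b 1 = 1" "\<And>k. k \<ge> 1 \<Longrightarrow> b k \<ge> 0" "\<beta> > 0" and l: "slowly_varying l"
    and sum: "\<And>k. k \<ge> 1 \<Longrightarrow> (\<Sum>j=1..k. b j) = real k powr \<beta> * l (real k)"
  shows "regular_weights b \<beta>"
proof
  fix p q :: nat assume pq: "p \<ge> 1" "q \<ge> 1"
  have "filterlim (\<lambda>i. real (q * i)) at_top sequentially"
    by (intro filterlim_compose[OF filterlim_real_sequentially] filterlim_subseq)
      (use pq in \<open>auto intro!: strict_monoI\<close>)
  moreover have "((\<lambda>y. l (y * (real p / real q)) / l y) \<longlongrightarrow> 1) at_top"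
    using l pq unfolding slowly_varying_def by (auto simp del: times_divide_eq_right)
  ultimately have "(\<lambda>i. (real p / real q) powr \<beta> * (l (real (q * i) * (real p / real q)) / l (real (q * i))))
      \<longlonglongrightarrow> (real p / real q) powr \<beta> * 1"
    by (intro tendsto_mult tendsto_const) (rule filterlim_compose)
  moreover have "\<forall>\<^sub>F i in sequentially.
      (real p / real q) powr \<beta> * (l (real (q * i) * (real p / real q)) / l (real (q * i))) =
      partial_sum b (real (p * i)) / partial_sum b (real (q * i))"
    using eventually_ge_at_top[of 1]
  proof eventually_elim
    case (elim i)
    have "real (q * i) * (real p / real q) = real (p * i)"
      using pq by simp
    moreover have "partial_sum b (real (p * i)) = real (p * i) powr \<beta> * l (real (p * i))"
      "partial_sum b (real (q * i)) = real (q * i) powr \<beta> * l (real (q * i))"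
      unfolding partial_sum_def using pq elim sum[of "p * i"] sum[of "q * i"]
      by (auto simp: floor_of_nat nat_int simp del: of_nat_mult)
    ultimately show ?case
      using pq elim by (simp add: powr_divide powr_mult mult.commute)
  qed
  ultimately show "(\<lambda>i. partial_sum b (real (p * i)) / partial_sum b (real (q * i))) \<longlonglongrightarrow> (real p / real q) powr \<beta>"
    by (simp add: tendsto_cong)
qed (use assms in auto)

context regular_weights
begin

abbreviation "B \<equiv> partial_sum b"

lemma B_mono: "y \<le> z \<Longrightarrow> B y \<le> B z"
  unfolding partial_sum_def by (intro sum_mono2) (use b_ge_0 in \<open>auto intro: nat_mono floor_mono order.trans\<close>)

lemma B_eq_0: "y < 1 \<Longrightarrow> B y = 0"
  by (simp add: partial_sum_def)

lemma B_1: "B 1 = 1"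
  using b_1 by (simp add: partial_sum_def)

lemma B_ge_1: "y \<ge> 1 \<Longrightarrow> B y \<ge> 1"
  using B_mono[of 1 y] by (simp add: B_1)

lemma B_nonneg: "B y \<ge> 0"
  unfolding partial_sum_def by (intro sum_nonneg b_ge_0) auto

text \<open>Comparing \<open>y\<close> and \<open>v y\<close> with multiples of \<open>\<lfloor>y / N\<rfloor> + 1\<close> for large \<open>N\<close>, so that
  monotonicity of the partial sums replaces the uniform convergence theorem.\<close>

lemma B_regular:
  assumes v: "v > 0"
  shows "((\<lambda>y. B (v * y) / B y) \<longlongrightarrow> v powr \<beta>) at_top"
proof (rule order_tendstoI)
  fix a assume a: "a > v powr \<beta>"
  \<comment> \<open>With p = \<lceil>v N\<rceil> and y close to N i one gets v y \<le> p i and (N -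
    1) i \<le> y. The resulting limit is (p / (N - 1))^\<beta> with p \<le> v N + 1; N is chosen to
    make this smaller than a.\<close>
  have "((\<lambda>N. ((v * real N + 1) / (real N - 1)) powr \<beta>) \<longlongrightarrow> v powr \<beta>) sequentially"
  proof (intro tendsto_powr)
    show "((\<lambda>N. (v * real N + 1) / (real N - 1)) \<longlongrightarrow> v) sequentially"
      by real_asymp
  qed (use v in auto)
  then have "\<forall>\<^sub>F N in sequentially. ((v * real N + 1) / (real N - 1)) powr \<beta> < a"
    using a by (rule order_tendstoD)
  then have "\<forall>\<^sub>F N in sequentially. ((v * real N + 1) / (real N - 1)) powr \<beta> < a \<and> N \<ge> 2"
    by (intro eventually_conj eventually_ge_at_top)
  then obtain N where N: "((v * real N + 1) / (real N - 1)) powr \<beta> < a" "N \<ge> 2"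
    by (auto dest: eventually_happens)
  define p where "p = nat \<lceil>v * real N\<rceil>"
  have "v * real N > 0" using v N by simp
  then have "real p = of_int \<lceil>v * real N\<rceil>" "p > 0"
    unfolding p_def by (auto simp: zero_less_ceiling)
  then have p: "p \<ge> 1" "v * real N \<le> real p" "real p \<le> v * real N + 1"
    by linarith+
  have "(real p / real (N - 1)) powr \<beta> \<le> ((v * real N + 1) / (real N - 1)) powr \<beta>"
    using p N \<beta>_pos by (intro powr_mono2 frac_le) auto
  with N have "(real p / real (N - 1)) powr \<beta> < a" by simp
  then have "\<forall>\<^sub>F i in sequentially. B (real (p * i)) / B (real ((N - 1) * i)) < a"
    using p N by (intro order_tendstoD(2)[OF ratio_nat]) auto
  then obtain i0 where i0: "\<And>i. i \<ge> i0 \<Longrightarrow> B (real (p * i)) / B (real ((N - 1) * i)) < a"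
    by (auto simp: eventually_sequentially)
  show "\<forall>\<^sub>F y in at_top. B (v * y) / B y < a"
    using eventually_ge_at_top[of "real N * real (i0 + N)"] eventually_ge_at_top[of 1]
  proof eventually_elim
    case (elim y)
    define i where "i = nat \<lfloor>y / real N\<rfloor> + 1"
    have yN: "y / real N \<ge> real (i0 + N)"
      using elim N by (simp add: field_simps)
    have "real i = of_int \<lfloor>y / real N\<rfloor> + 1"
      using yN by (simp add: i_def)
    then have i1: "real i > y / real N" "real i \<le> y / real N + 1"
      by linarith+
    then have "real i > real (i0 + N)"
      using yN by linarith
    then have i2: "i \<ge> i0" "i \<ge> N"
      by (simp_all only: of_nat_less_iff)
    from i1 i2 have i: "y < real N * real i" "real N * real i \<le> y + real N" "i \<ge> i0" "i \<ge> N"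
      using N by (auto simp: field_simps)
    have "B (v * y) \<le> B (real (p * i))"
    proof (rule B_mono)
      have "v * y \<le> v * (real N * real i)" using i v by (intro mult_left_mono) auto
      also have "\<dots> \<le> real p * real i" using p i by (simp add: mult.assoc [symmetric] mult_right_mono)
      finally show "v * y \<le> real (p * i)" by simp
    qed
    moreover have "B (real ((N - 1) * i)) \<le> B y"
    proof (rule B_mono)
      have "real ((N - 1) * i) = real N * real i - real i" using N by (simp add: algebra_simps of_nat_diff)
      \<comment> \<open>Because N i \<le> y + N and i \<ge> N.\<close>
      also have "\<dots> \<le> y" using i by linarith
      finally show "real ((N - 1) * i) \<le> y" .
    qed
    moreover have "B (real ((N - 1) * i)) \<ge> 1"
      using N i yN elim by (intro B_ge_1) (auto simp: Suc_le_eq simp flip: of_nat_mult)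
    ultimately have "B (v * y) / B y \<le> B (real (p * i)) / B (real ((N - 1) * i))"
      using B_nonneg by (intro frac_le) auto
    also have "\<dots> < a" using i by (intro i0)
    finally show ?case .
  qed
next
  fix a assume a: "a < v powr \<beta>"
  \<comment> \<open>The mirror image: rounding v N down costs 1, and passing from y to the larger
    multiple N i costs another 1.\<close>
  have "((\<lambda>N. ((v * real N - 2) / real N) powr \<beta>) \<longlongrightarrow> v powr \<beta>) sequentially"
  proof (intro tendsto_powr)
    show "((\<lambda>N. (v * real N - 2) / real N) \<longlongrightarrow> v) sequentially"
      by real_asymp
  qed (use v in auto)
  then have 1: "\<forall>\<^sub>F N in sequentially. ((v * real N - 2) / real N) powr \<beta> > a"
    using a by (rule order_tendstoD)
  have 2: "\<forall>\<^sub>F N in sequentially. v * real N > 3"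
    using v by real_asymp
  have "\<forall>\<^sub>F N in sequentially. ((v * real N - 2) / real N) powr \<beta> > a \<and> v * real N > 3"
    using 1 2 by eventually_elim auto
  then obtain N where N: "((v * real N - 2) / real N) powr \<beta> > a" "v * real N > 3"
    by (auto dest: eventually_happens)
  have N1: "N \<ge> 1" using N(2) by (cases N) auto
  define p where "p = nat \<lfloor>v * real N\<rfloor>"
  have p: "p \<ge> 2" "real p \<le> v * real N" "v * real N - 1 \<le> real p"
    using v N unfolding p_def by linarith+
  have "((v * real N - 2) / real N) powr \<beta> \<le> (real (p - 1) / real N) powr \<beta>"
    using p N N1 \<beta>_pos by (intro powr_mono2 divide_right_mono) (auto simp: of_nat_diff)
  with N have "(real (p - 1) / real N) powr \<beta> > a" by simp
  then have "\<forall>\<^sub>F i in sequentially. B (real ((p - 1) * i)) / B (real (N * i)) > a"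
    using p N1 by (intro order_tendstoD(1)[OF ratio_nat]) auto
  then obtain i0 where i0: "\<And>i. i \<ge> i0 \<Longrightarrow> B (real ((p - 1) * i)) / B (real (N * i)) > a"
    by (auto simp: eventually_sequentially)
  show "\<forall>\<^sub>F y in at_top. B (v * y) / B y > a"
    using eventually_ge_at_top[of "real N * real (i0 + p)"] eventually_ge_at_top[of 1]
  proof eventually_elim
    case (elim y)
    define i where "i = nat \<lfloor>y / real N\<rfloor> + 1"
    have yN: "y / real N \<ge> real (i0 + p)"
      using elim N1 by (simp add: field_simps)
    have "real i = of_int \<lfloor>y / real N\<rfloor> + 1"
      using yN by (simp add: i_def)
    then have i1: "real i > y / real N" "real i \<le> y / real N + 1"
      by linarith+
    then have "real i > real (i0 + p)"
      using yN by linarith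
    then have i2: "i \<ge> i0" "i \<ge> p"
      by (simp_all only: of_nat_less_iff)
    from i1 i2 have i: "y < real N * real i" "real N * (real i - 1) \<le> y" "i \<ge> i0" "i \<ge> p"
      using N1 by (auto simp: field_simps)
    have "B (real ((p - 1) * i)) \<le> B (v * y)"
    proof (rule B_mono)
      have "real ((p - 1) * i) = real p * real i - real i" using p by (simp add: algebra_simps of_nat_diff)
      \<comment> \<open>Here i \<ge> p allows one copy of i to be traded for one copy of p.\<close>
      also have "\<dots> \<le> real p * (real i - 1)" using i by (simp add: algebra_simps)
      also have "\<dots> \<le> v * real N * (real i - 1)" using p i by (intro mult_right_mono) auto
      also have "\<dots> \<le> v * y" using i v by (simp add: mult.assoc)
      finally show "real ((p - 1) * i) \<le> v * y" .
    qed
    moreover have "B y \<le> B (real (N * i))"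
      using i by (intro B_mono) auto
    moreover have "B y \<ge> 1" using elim by (intro B_ge_1)
    ultimately have "B (real ((p - 1) * i)) / B (real (N * i)) \<le> B (v * y) / B y"
      using B_nonneg by (intro frac_le) auto
    moreover have "a < B (real ((p - 1) * i)) / B (real (N * i))" using i by (intro i0)
    ultimately show ?case by simp
  qed
qed

text \<open>Beyond some y0 one doubling of the argument multiplies B by a factor between 2^(\<beta>
  - \<delta>) and 2^(\<beta> + \<delta>). Iteration gives the bound for dyadic ratios, and
  monotonicity fills the gaps. To serve as a majorant the bound has to hold for every v > 0, also
  where v y falls below y0.\<close>

lemma B_potter:
  assumes \<delta>: "0 < \<delta>" "\<delta> < \<beta>"
  obtains A y0 where "A > 0" "y0 \<ge> 1"
    "\<And>v y. v > 0 \<Longrightarrow> y \<ge> y0 \<Longrightarrow> B (v * y) \<le> A * (v powr (\<beta> - \<delta>) + v powr (\<beta> + \<delta>)) * B y"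
proof -
  have "\<forall>\<^sub>F y in at_top. B (2 * y) / B y > 2 powr (\<beta> - \<delta>)"
    "\<forall>\<^sub>F y in at_top. B (2 * y) / B y < 2 powr (\<beta> + \<delta>)"
    using \<delta> by (auto intro!: order_tendstoD[OF B_regular[of 2]])
  then have "\<forall>\<^sub>F y in at_top. B (2 * y) / B y > 2 powr (\<beta> - \<delta>) \<and> B (2 * y) / B y < 2 powr (\<beta> + \<delta>)"
    by eventually_elim auto
  then obtain y1 where y1: "\<And>y. y \<ge> y1 \<Longrightarrow> B (2 * y) / B y > 2 powr (\<beta> - \<delta>) \<and> B (2 * y) / B y < 2 powr (\<beta> + \<delta>)"
    by (auto simp: eventually_at_top_linorder)
  define y0 where "y0 = max 1 y1"
  have y0: "y0 \<ge> 1" by (simp add: y0_def)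
  have dbl: "B (2 * y) \<ge> 2 powr (\<beta> - \<delta>) * B y" "B (2 * y) \<le> 2 powr (\<beta> + \<delta>) * B y" if "y \<ge> y0" for y
    using y1[of y] B_ge_1[of y] that by (auto simp: y0_def field_simps)
  have iter: "B (2 ^ j * y) \<ge> (2 ^ j) powr (\<beta> - \<delta>) * B y" "B (2 ^ j * y) \<le> (2 ^ j) powr (\<beta> + \<delta>) * B y"
    if y: "y \<ge> y0" for y j
  proof -
    have "B (2 ^ j * y) \<ge> (2 ^ j) powr (\<beta> - \<delta>) * B y \<and> B (2 ^ j * y) \<le> (2 ^ j) powr (\<beta> + \<delta>) * B y"
    proof (induction j)
      case (Suc j)
      have "2 ^ j * y \<ge> 1 * y0" using y y0 by (intro mult_mono) auto
      then have ge: "2 ^ j * y \<ge> y0" by simp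
      have "(2 ^ Suc j) powr (\<beta> - \<delta>) * B y = 2 powr (\<beta> - \<delta>) * ((2 ^ j) powr (\<beta> - \<delta>) * B y)"
        by (simp add: powr_mult)
      also have "\<dots> \<le> 2 powr (\<beta> - \<delta>) * B (2 ^ j * y)" using Suc by (intro mult_left_mono) auto
      also have "\<dots> \<le> B (2 * (2 ^ j * y))" using dbl(1)[OF ge] .
      finally have 1: "(2 ^ Suc j) powr (\<beta> - \<delta>) * B y \<le> B (2 ^ Suc j * y)" by (simp add: mult.assoc)
      have "B (2 * (2 ^ j * y)) \<le> 2 powr (\<beta> + \<delta>) * B (2 ^ j * y)" using dbl(2)[OF ge] .
      also have "\<dots> \<le> 2 powr (\<beta> + \<delta>) * ((2 ^ j) powr (\<beta> + \<delta>) * B y)" using Suc by (intro mult_left_mono) auto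
      also have "\<dots> = (2 ^ Suc j) powr (\<beta> + \<delta>) * B y" by (simp add: powr_mult)
      finally show ?case using 1 by (simp add: mult.assoc)
    qed auto
    then show "B (2 ^ j * y) \<ge> (2 ^ j) powr (\<beta> - \<delta>) * B y" "B (2 ^ j * y) \<le> (2 ^ j) powr (\<beta> + \<delta>) * B y"
      by auto
  qed
  have dyadic: "\<exists>j. w \<le> 2 ^ j \<and> 2 ^ j \<le> 2 * w" if "w \<ge> 1" for w :: real
  proof -
    obtain j where j: "w < 2 ^ j" using real_arch_pow[of 2 w] by auto
    define J where "J = (LEAST j. w \<le> 2 ^ j)"
    have J: "w \<le> 2 ^ J" unfolding J_def by (rule LeastI_ex) (use j in \<open>auto intro: less_imp_le\<close>)
    show ?thesis
    proof (cases J)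
      case 0
      with J that show ?thesis by (intro exI[of _ J]) auto
    next
      case (Suc i)
      then have "\<not> w \<le> 2 ^ i" using not_less_Least[of i "\<lambda>j. w \<le> 2 ^ j"] by (auto simp: J_def)
      with J Suc show ?thesis by (intro exI[of _ J]) auto
    qed
  qed
  have ge1: "B (v * y) \<le> (2 * v) powr (\<beta> + \<delta>) * B y" if v: "v \<ge> 1" and y: "y \<ge> y0" for v y
  proof -
    obtain j where j: "v \<le> 2 ^ j" "2 ^ j \<le> 2 * v" using dyadic[OF v] by auto
    have "B (v * y) \<le> B (2 ^ j * y)" using j y y0 by (intro B_mono mult_right_mono) auto
    also have "\<dots> \<le> (2 ^ j) powr (\<beta> + \<delta>) * B y" by (rule iter(2)[OF y])
    also have "\<dots> \<le> (2 * v) powr (\<beta> + \<delta>) * B y"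
      using j \<delta> B_nonneg by (intro mult_right_mono powr_mono2) auto
    finally show ?thesis .
  qed
  have le1: "B (v * y) \<le> (2 * v) powr (\<beta> - \<delta>) * B y" if v: "v > 0" "v \<le> 1" and y: "v * y \<ge> y0" for v y
  proof -
    have "1 / v \<ge> 1" using v by simp
    then obtain j where j: "1 / v \<le> 2 ^ j" "2 ^ j \<le> 2 * (1 / v)" using dyadic[of "1 / v"] by blast
    show ?thesis
    proof (cases j)
      case 0
      with j v have "v = 1" by (auto simp: field_simps)
      moreover have "1 * B y \<le> 2 powr (\<beta> - \<delta>) * B y"
        using \<delta> B_nonneg[of y] by (intro mult_right_mono ge_one_powr_ge_zero) auto
      ultimately show ?thesis by simp
    next
      case (Suc i)
      \<comment> \<open>Doubling upwards from v y: i steps stay below y, while 2^i is at least 1 /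
        (2 v).\<close>
      have i: "2 ^ i * v \<le> 1" "1 \<le> 2 ^ i * (2 * v)"
        using j v Suc by (auto simp: field_simps)
      have "1 * B (v * y) \<le> (2 ^ i * (2 * v)) powr (\<beta> - \<delta>) * B (v * y)"
        using i \<delta> B_nonneg by (intro mult_right_mono ge_one_powr_ge_zero) auto
      also have "\<dots> = (2 * v) powr (\<beta> - \<delta>) * ((2 ^ i) powr (\<beta> - \<delta>) * B (v * y))"
        using v by (simp add: powr_mult)
      also have "\<dots> \<le> (2 * v) powr (\<beta> - \<delta>) * B (2 ^ i * (v * y))"
        by (intro mult_left_mono iter(1)[OF y]) auto
      also have "\<dots> \<le> (2 * v) powr (\<beta> - \<delta>) * B y"
      proof (intro mult_left_mono B_mono)
        have "y > 0" using y y0 v by (intro zero_less_mult_pos[of v y]) auto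
        with i show "2 ^ i * (v * y) \<le> y" by (simp add: mult.assoc [symmetric] mult_left_le_one_le)
      qed auto
      finally show ?thesis by simp
    qed
  qed
  \<comment> \<open>The second summand serves v \<ge> 1. The first serves 1 \<le> v y < y0 and,
    since y0 \<ge> 1, also exceeds the constant 2^(\<beta> - \<delta>) for v < 1 and v y \<ge>
    y0.\<close>
  define A where "A = (2 * y0) powr (\<beta> - \<delta>) + 2 powr (\<beta> + \<delta>)"
  have "B (v * y) \<le> A * (v powr (\<beta> - \<delta>) + v powr (\<beta> + \<delta>)) * B y" if v: "v > 0" and y: "y \<ge> y0" for v y
  proof -
    have up: "c * d * B y \<le> A * (v powr (\<beta> - \<delta>) + v powr (\<beta> + \<delta>)) * B y"
      if "0 \<le> c" "c \<le> A" "0 \<le> d" "d \<le> v powr (\<beta> - \<delta>) + v powr (\<beta> + \<delta>)" for c d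
      using that B_nonneg[of y] by (intro mult_right_mono mult_mono) auto
    have "2 powr (\<beta> - \<delta>) \<le> (2 * y0) powr (\<beta> - \<delta>)" using y0 \<delta> by (intro powr_mono2) auto
    then have A_ge: "2 powr (\<beta> - \<delta>) \<le> A" "2 powr (\<beta> + \<delta>) \<le> A" "(2 * y0) powr (\<beta> - \<delta>) \<le> A"
      using powr_ge_zero[of 2 "\<beta> + \<delta>"] powr_ge_zero[of "2 * y0" "\<beta> - \<delta>"] unfolding A_def by linarith+
    have A_nonneg: "0 \<le> A" by (simp add: A_def)
    consider "v \<ge> 1" | "v < 1" "v * y \<ge> y0" | "v < 1" "v * y < 1" | "v < 1" "1 \<le> v * y" "v * y < y0" by linarith
    then show ?thesis
    proof cases
      case 1
      have "B (v * y) \<le> 2 powr (\<beta> + \<delta>) * v powr (\<beta> + \<delta>) * B y"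
        using ge1[OF 1 y] v by (simp add: powr_mult)
      also have "\<dots> \<le> A * (v powr (\<beta> - \<delta>) + v powr (\<beta> + \<delta>)) * B y"
        by (intro up A_ge) auto
      finally show ?thesis .
    next
      case 2
      have "B (v * y) \<le> 2 powr (\<beta> - \<delta>) * v powr (\<beta> - \<delta>) * B y"
        using le1[of v y] 2 v by (simp add: powr_mult)
      also have "\<dots> \<le> A * (v powr (\<beta> - \<delta>) + v powr (\<beta> + \<delta>)) * B y"
        by (intro up A_ge) auto
      finally show ?thesis .
    next
      case 3
      then have "B (v * y) = 0" by (intro B_eq_0)
      then show ?thesis using up[of 0 0] A_nonneg by simp
    next
      case 4
      have y_pos: "y > 0" using y y0 by simp
      have "B (v * y) \<le> B (y0 / y * y)" using 4 y_pos by (intro B_mono) auto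
      also have "\<dots> \<le> (2 * (y0 / y)) powr (\<beta> - \<delta>) * B y"
        using y y0 by (intro le1) auto
      also have "\<dots> \<le> (2 * (y0 * v)) powr (\<beta> - \<delta>) * B y"
        using 4 y_pos y0 \<delta> B_nonneg[of y] by (intro mult_right_mono powr_mono2) (auto simp: field_simps)
      also have "\<dots> = (2 * y0) powr (\<beta> - \<delta>) * v powr (\<beta> - \<delta>) * B y"
        using v y0 by (simp add: powr_mult)
      also have "\<dots> \<le> A * (v powr (\<beta> - \<delta>) + v powr (\<beta> + \<delta>)) * B y"
        by (intro up A_ge) auto
      finally show ?thesis .
    qed
  qed
  moreover have "A > 0" using y0 by (simp add: A_def add_pos_pos)
  ultimately show ?thesis using that y0 by blast
qed

text \<open>Potter's bound read backwards: take v = 1 / y and use B(1) = 1.\<close>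

lemma B_lower:
  obtains c y0 where "c > 0" "y0 \<ge> 1" "\<And>y. y \<ge> y0 \<Longrightarrow> c * y powr (\<beta> / 2) \<le> B y"
proof -
  obtain A y0 where A: "A > 0" "y0 \<ge> 1"
    "\<And>v y. v > 0 \<Longrightarrow> y \<ge> y0 \<Longrightarrow> B (v * y) \<le> A * (v powr (\<beta> - \<beta> / 2) + v powr (\<beta> + \<beta> / 2)) * B y"
    using B_potter[of "\<beta> / 2"] \<beta>_pos by auto
  have "1 / (2 * A) * y powr (\<beta> / 2) \<le> B y" if y: "y \<ge> y0" for y
  proof -
    have "1 \<le> B (1 / y * y)" using y A by (intro B_ge_1) auto
    also have "\<dots> \<le> A * ((1 / y) powr (\<beta> - \<beta> / 2) + (1 / y) powr (\<beta> + \<beta> / 2)) * B y"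
      using y A by (intro A) auto
    also have "\<dots> \<le> A * ((1 / y) powr (\<beta> / 2) + (1 / y) powr (\<beta> / 2)) * B y"
      using y A \<beta>_pos B_nonneg[of y]
      by (intro mult_right_mono mult_left_mono add_mono powr_mono') (auto simp: field_simps)
    also have "\<dots> = 2 * A / y powr (\<beta> / 2) * B y"
      using y A by (simp add: powr_divide)
    finally show ?thesis using y A by (simp add: field_simps)
  qed
  with A(1,2) show ?thesis by (intro that[of "1 / (2 * A)" y0]) auto
qed

lemma B_at_top: "filterlim B at_top at_top"
proof -
  obtain c y0 where c: "c > 0" "\<And>y. y \<ge> y0 \<Longrightarrow> c * y powr (\<beta> / 2) \<le> B y"
    using B_lower by metis
  have "filterlim (\<lambda>y. c * y powr (\<beta> / 2)) at_top at_top"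
    using c \<beta>_pos by real_asymp
  then show ?thesis
    by (rule filterlim_at_top_mono) (use c in \<open>auto simp: eventually_at_top_linorder\<close>)
qed

lemma not_summable_b: "\<not> summable b"
proof
  assume "summable b"
  then have "(\<lambda>n. sum b {..<n}) \<longlonglongrightarrow> suminf b" by (rule summable_LIMSEQ)
  then have "(\<lambda>n. sum b {..<Suc n}) \<longlonglongrightarrow> suminf b" by (rule LIMSEQ_Suc)
  moreover have "sum b {..<Suc n} = b 0 + B (real n)" for n
    unfolding lessThan_Suc_atMost by (simp add: partial_sum_def sum.atMost_shift sum.atLeast1_atMost_eq atLeast0AtMost lessThan_Suc_atMost)
  ultimately have "(\<lambda>n. b 0 + B (real n)) \<longlonglongrightarrow> suminf b" by simp
  then have "(\<lambda>n. b 0 + B (real n) - b 0) \<longlonglongrightarrow> suminf b - b 0" by (intro tendsto_intros)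
  moreover have "filterlim (\<lambda>n. B (real n)) at_top sequentially"
    by (rule filterlim_compose[OF B_at_top filterlim_real_sequentially])
  then have "filterlim (\<lambda>n. B (real n)) at_infinity sequentially"
    by (rule filterlim_at_top_imp_at_infinity)
  ultimately show False
    using not_tendsto_and_filterlim_at_infinity[of sequentially "\<lambda>n. B (real n)"] by simp
qed

end

section \<open>The logarithmic derivative near the singularity\<close>

text \<open>Convexity: nonnegative coefficients make the derivative increasing, so its value at an
  intermediate point dominates the one at u.\<close>

lemma eval_fps_deriv_le_diff_quotient:
  fixes A :: "real fps"
  assumes nonneg: "\<And>n. fps_nth A n \<ge> 0" and R: "fps_conv_radius A \<ge> 1" and uv: "0 \<le> u" "u < v" "v < 1"
  shows "(v - u) * eval_fps (fps_deriv A) u \<le> eval_fps A v - eval_fps A u"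
proof -
  have r: "ereal (norm t) < fps_conv_radius A" if "0 \<le> t" "t \<le> v" for t
    by (rule less_le_trans[OF _ R]) (use that uv in \<open>simp add: one_ereal_def\<close>)
  have r': "ereal (norm t) < fps_conv_radius (fps_deriv A)" if "0 \<le> t" "t \<le> v" for t
    using r[OF that] fps_conv_radius_deriv by (rule less_le_trans)
  have "\<exists>\<xi>. u < \<xi> \<and> \<xi> < v \<and> eval_fps A v - eval_fps A u = (v - u) * eval_fps (fps_deriv A) \<xi>"
    using uv r by (intro MVT2 has_field_derivative_eval_fps) auto
  then obtain \<xi> where \<xi>: "u < \<xi>" "\<xi> < v" "eval_fps A v - eval_fps A u = (v - u) * eval_fps (fps_deriv A) \<xi>"
    by auto
  have "eval_fps (fps_deriv A) u \<le> eval_fps (fps_deriv A) \<xi>"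
  proof (rule sums_le)
    show "(\<lambda>n. fps_nth (fps_deriv A) n * u ^ n) sums eval_fps (fps_deriv A) u"
      "(\<lambda>n. fps_nth (fps_deriv A) n * \<xi> ^ n) sums eval_fps (fps_deriv A) \<xi>"
      using uv \<xi> by (intro sums_eval_fps r'; simp)+
    show "fps_nth (fps_deriv A) n * u ^ n \<le> fps_nth (fps_deriv A) n * \<xi> ^ n" for n
      using nonneg uv \<xi> by (intro mult_left_mono power_mono) auto
  qed
  then show ?thesis using \<xi>(3) uv by simp
qed

section \<open>The functions h and H under a power bound at 1\<close>

locale power_singularity =
  fixes f :: "real fps" and m :: nat and c C :: real
  assumes f0: "fps_nth f 0 = 1" and f_nonneg: "\<And>n. fps_nth f n \<ge> 0" and f1_pos: "fps_nth f 1 > 0"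
    and radius: "fps_conv_radius f \<ge> 1" and c_pos: "c > 0"
    and sandwich: "\<And>u. 0 \<le> u \<Longrightarrow> u < 1 \<Longrightarrow> c \<le> eval_fps f u * (1 - u) ^ m"
      "\<And>u. 0 \<le> u \<Longrightarrow> u < 1 \<Longrightarrow> eval_fps f u * (1 - u) ^ m \<le> C"
begin

abbreviation "f' \<equiv> fps_deriv f"
abbreviation "f'' \<equiv> fps_deriv (fps_deriv f)"
abbreviation "E0 \<equiv> eval_fps f"
abbreviation "E1 \<equiv> eval_fps f'"
abbreviation "E2 \<equiv> eval_fps f''"

definition h :: "real \<Rightarrow> real" where "h u = E1 u / E0 u"
definition H :: "real \<Rightarrow> real" where "H u = u * h u"
text \<open>The derivative of \<open>H\<close> on (0, 1), written with \<open>log_deriv\<close> in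
  the form that occurs in \<open>limit_shape\<close>.\<close>

definition dH :: "real \<Rightarrow> real" where "dH u = log_deriv f u + u * deriv (log_deriv f) u"

lemma radius': "fps_conv_radius f' \<ge> 1" "fps_conv_radius f'' \<ge> 1"
  using radius fps_conv_radius_deriv[of f] fps_conv_radius_deriv[of f'] by auto

lemma less_radius: "\<bar>u\<bar> < 1 \<Longrightarrow> fps_conv_radius A \<ge> 1 \<Longrightarrow> ereal (norm (u::real)) < fps_conv_radius A"
  by (rule less_le_trans[of _ 1]) (simp_all add: one_ereal_def)

lemma less_radius': "\<bar>u\<bar> < 1 \<Longrightarrow> fps_conv_radius A \<ge> 1 \<Longrightarrow> ereal \<bar>u\<bar> < fps_conv_radius (A::real fps)"
  using less_radius[of u A] by simp

lemma less_radius'': "u < 1 \<Longrightarrow> fps_conv_radius A \<ge> 1 \<Longrightarrow> ereal u < fps_conv_radius (A::real fps)"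
  by (rule less_le_trans[of _ 1]) (simp_all add: one_ereal_def)

lemma E0_ge_1: "0 \<le> u \<Longrightarrow> u < 1 \<Longrightarrow> E0 u \<ge> 1"
  using less_radius[OF _ radius, of u] by (intro eval_fps_ge_1 f0 f_nonneg) auto

lemma E1_nonneg: "0 \<le> u \<Longrightarrow> u < 1 \<Longrightarrow> E1 u \<ge> fps_nth f 1"
proof -
  assume u: "0 \<le> u" "u < 1"
  have "(\<lambda>n. fps_nth f' n * u ^ n) sums E1 u"
    using u radius' by (intro sums_eval_fps less_radius) auto
  then have "(\<Sum>n\<in>{0}. fps_nth f' n * u ^ n) \<le> E1 u"
    using sum_le_suminf[of "\<lambda>n. fps_nth f' n * u ^ n" "{0}"] f_nonneg u unfolding sums_iff by auto
  then show ?thesis by simp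
qed

lemma DERIV_E:
  assumes "\<bar>u\<bar> < 1"
  shows "(E0 has_real_derivative E1 u) (at u within S)" "(E1 has_real_derivative E2 u) (at u within S)"
  using assms radius radius' by (auto intro!: has_field_derivative_eval_fps less_radius)

lemma log_deriv_eq: "\<bar>u\<bar> < 1 \<Longrightarrow> log_deriv f u = h u"
  using less_radius[OF _ radius, of u] by (simp add: log_deriv_def h_def eval_fps_deriv)

lemma DERIV_h:
  assumes "0 \<le> u" "u < 1"
  shows "(h has_real_derivative (E2 u * E0 u - (E1 u)\<^sup>2) / (E0 u)\<^sup>2) (at u within S)"
  unfolding h_def power2_eq_square using E0_ge_1[OF assms] assms
  by (intro DERIV_divide DERIV_E) auto

lemma dH_eq:
  assumes "0 < u" "u < 1"
  shows "dH u = h u + u * ((E2 u * E0 u - (E1 u)\<^sup>2) / (E0 u)\<^sup>2)"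
proof -
  have "(log_deriv f has_real_derivative (E2 u * E0 u - (E1 u)\<^sup>2) / (E0 u)\<^sup>2) (at u)"
    by (rule has_field_derivative_transform_within_open[of h _ _ "{0<..<1}"])
      (use assms DERIV_h in \<open>auto simp: log_deriv_eq\<close>)
  then show ?thesis
    using assms by (simp add: dH_def log_deriv_eq DERIV_imp_deriv)
qed

lemma DERIV_H:
  assumes "0 < u" "u < 1"
  shows "(H has_real_derivative dH u) (at u within S)"
  unfolding H_def dH_eq[OF assms]
  using assms DERIV_h[of u S] by (auto intro!: derivative_eq_intros)

lemma continuous_on_E:
  "continuous_on {-1<..<1} E0" "continuous_on {-1<..<1} E1" "continuous_on {-1<..<1} E2"
  using radius radius'
  by (auto intro!: continuous_on_subset[OF continuous_on_eval_fps] less_radius')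

lemma continuous_on_h: "continuous_on {0..<1} h"
  unfolding h_def using E0_ge_1
  by (intro continuous_intros continuous_on_subset[OF continuous_on_E(1)] continuous_on_subset[OF continuous_on_E(2)])
    force+

lemma continuous_on_H: "continuous_on {0..<1} H"
  unfolding H_def by (intro continuous_intros continuous_on_h)

lemma continuous_on_dH: "continuous_on {0<..<1} dH"
proof -
  have "continuous_on {0<..<1} (\<lambda>u. h u + u * ((E2 u * E0 u - (E1 u)\<^sup>2) / (E0 u)\<^sup>2))"
  proof -
    have "(E0 u)\<^sup>2 \<noteq> 0" if "u \<in> {0<..<1}" for u
      using E0_ge_1[of u] that by auto
    then show ?thesis
      by (intro continuous_on_add continuous_on_mult continuous_on_divide continuous_on_diff
          continuous_on_power continuous_on_id continuous_on_subset[OF continuous_on_E(1)]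
          continuous_on_subset[OF continuous_on_h] continuous_on_subset[OF continuous_on_E(2)]
          continuous_on_subset[OF continuous_on_E(3)]) auto
  qed
  then show ?thesis by (rule continuous_on_eq) (auto simp: dH_eq)
qed

lemma h_pos: "0 \<le> u \<Longrightarrow> u < 1 \<Longrightarrow> h u > 0"
  using E0_ge_1[of u] E1_nonneg[of u] f1_pos by (auto simp: h_def)

lemma H_nonneg: "0 \<le> u \<Longrightarrow> u < 1 \<Longrightarrow> H u \<ge> 0"
  using h_pos[of u] by (simp add: H_def)

lemma H_0: "H 0 = 0"
  by (simp add: H_def)

text \<open>\<open>u H'(u)\<close> is the variance, and \<open>H u\<close> the mean, of the probability measure with weights
  \<open>f\<^sub>n u\<^sup>n / f(u)\<close>.\<close>

lemma dH_nonneg: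
  assumes u: "0 < u" "u < 1"
  shows "dH u \<ge> 0"
proof -
  have s0: "(\<lambda>n. fps_nth f n * u ^ n) sums E0 u"
    using u radius by (intro sums_eval_fps less_radius) auto
  have ev: "eval_fps (fps_X * A) u = u * eval_fps A u" if "fps_conv_radius A \<ge> 1" for A
    using that u by (subst eval_fps_mult) (auto intro!: less_radius'')
  have rad: "fps_conv_radius (fps_X * A) \<ge> 1" if "fps_conv_radius A \<ge> 1" for A :: "real fps"
    using that fps_conv_radius_mult[of fps_X A] by (auto elim: order.trans[rotated])
  have "(\<lambda>n. fps_nth (fps_theta f) n * u ^ n) sums eval_fps (fps_theta f) u"
    unfolding fps_theta_def using u radius' by (intro sums_eval_fps less_radius rad) auto
  then have s1: "(\<lambda>n. real n * fps_nth f n * u ^ n) sums (u * E1 u)"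
    using radius' by (simp only: fps_nth_theta) (simp add: fps_theta_def ev)
  have th: "fps_theta (fps_theta f) = fps_X * (f' + fps_X * f'')"
    by (simp add: fps_theta_def)
  have "fps_conv_radius (f' + fps_X * f'') \<ge> 1"
    using fps_conv_radius_add[of f' "fps_X * f''"] rad[OF radius'(2)] radius' by (auto elim: order.trans[rotated])
  then have "(\<lambda>n. fps_nth (fps_theta (fps_theta f)) n * u ^ n) sums eval_fps (fps_theta (fps_theta f)) u"
    "eval_fps (fps_theta (fps_theta f)) u = u * eval_fps (f' + fps_X * f'') u"
    unfolding th using u radius' by (intro sums_eval_fps less_radius rad ev; simp)+
  moreover have "eval_fps (f' + fps_X * f'') u = E1 u + u * E2 u"
    using u radius' rad[OF radius'(2)] less_radius[of u]
    by (subst eval_fps_add) (auto simp: ev)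
  ultimately have s2: "(\<lambda>n. real n * (real n * fps_nth f n) * u ^ n) sums (u * (E1 u + u * E2 u))"
    by (simp add: fps_nth_theta)
  define t where "t = H u"
  have "(\<lambda>n. real n * (real n * fps_nth f n) * u ^ n - 2 * t * (real n * fps_nth f n * u ^ n) + t\<^sup>2 * (fps_nth f n * u ^ n))
     sums (u * (E1 u + u * E2 u) - 2 * t * (u * E1 u) + t\<^sup>2 * E0 u)"
    by (intro sums_add sums_diff sums_mult s0 s1 s2)
  also have "(\<lambda>n. real n * (real n * fps_nth f n) * u ^ n - 2 * t * (real n * fps_nth f n * u ^ n) + t\<^sup>2 * (fps_nth f n * u ^ n))
    = (\<lambda>n. (real n - t)\<^sup>2 * fps_nth f n * u ^ n)"
    by (simp add: fun_eq_iff power2_eq_square algebra_simps)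
  finally have "0 \<le> u * (E1 u + u * E2 u) - 2 * t * (u * E1 u) + t\<^sup>2 * E0 u"
    by (rule sums_le[OF _ sums_zero, rotated]) (use f_nonneg u in auto)
  also have "\<dots> = u * E0 u * dH u"
    using E0_ge_1[of u] u by (simp add: t_def H_def h_def dH_eq field_simps power2_eq_square)
  finally have *: "0 \<le> u * E0 u * dH u" .
  have "u * E0 u > 0"
    using E0_ge_1[of u] u by (intro mult_pos_pos) auto
  with * show ?thesis
    using mult_pos_neg[of "u * E0 u" "dH u"] by linarith
qed

lemma H_mono:
  assumes "0 \<le> u" "u \<le> v" "v < 1"
  shows "H u \<le> H v"
proof (cases "u < v")
  case True
  have "\<exists>l z. u < z \<and> z < v \<and> (H has_real_derivative l) (at z) \<and> H v - H u = (v - u) * l"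
    using assms True
  proof (intro MVT continuous_on_subset[OF continuous_on_H])
    fix x assume "u < x" "x < v"
    then show "H differentiable (at x)"
      using assms DERIV_H[of x UNIV] real_differentiable_def by auto
  qed auto
  then obtain l z where z: "u < z" "z < v" "(H has_real_derivative l) (at z)" "H v - H u = (v - u) * l"
    by blast
  then have "l = dH z"
    using assms DERIV_H[of z UNIV] by (auto intro: DERIV_unique)
  with z dH_nonneg[of z] assms True have "0 \<le> H v - H u" by simp
  then show ?thesis by simp
qed (use assms in auto)

text \<open>Passing from u to the midpoint v of u and 1 only halves the distance to 1, so the
  two-sided power bound keeps f(v) / f(u) bounded. Convexity of f and of f' turns this into bounds
  for f' / f and f'' / f; the negative term -u h^2 of \<open>dH\<close> is dropped.\<close>

lemma growth_bounds:
  obtains D where "D > 0" "\<And>u. 0 \<le> u \<Longrightarrow> u < 1 \<Longrightarrow> h u \<le> D / (1 - u)"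
    "\<And>u. 0 < u \<Longrightarrow> u < 1 \<Longrightarrow> dH u \<le> D / (1 - u)\<^sup>2"
proof -
  \<comment> \<open>C 2^m / c bounds f(v) / f(u), and the factor 2 comes from v - u = (1 - u) /
    2.\<close>
  define D1 where "D1 = 2 * C * 2 ^ m / c"
  have C_pos: "C > 0"
  proof -
    have "c \<le> C" by (rule order.trans[OF sandwich(1)[of 0] sandwich(2)[of 0]]) auto
    with c_pos show ?thesis by linarith
  qed
  have D1_pos: "D1 > 0" using C_pos c_pos by (simp add: D1_def)
  have mid: "E0 ((1 + u) / 2) / E0 u \<le> C * 2 ^ m / c" if u: "0 \<le> u" "u < 1" for u
  proof -
    let ?v = "(1 + u) / 2"
    have v: "1 - ?v = (1 - u) / 2" by (simp add: field_simps)
    have "E0 ?v * ((1 - u) / 2) ^ m \<le> C"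
      using sandwich(2)[of ?v] u by (simp only: v) simp
    then have "E0 ?v * (1 - u) ^ m * c \<le> C * 2 ^ m * c"
      using c_pos by (simp add: power_divide field_simps)
    also have "\<dots> \<le> C * 2 ^ m * (E0 u * (1 - u) ^ m)"
      using sandwich(1)[of u] u C_pos by (intro mult_left_mono) auto
    finally have "(E0 ?v * c) * (1 - u) ^ m \<le> (C * 2 ^ m * E0 u) * (1 - u) ^ m"
      by (simp add: mult_ac)
    then have "E0 ?v * c \<le> C * 2 ^ m * E0 u"
      using u by (simp add: mult_le_cancel_right)
    then show ?thesis
      using E0_ge_1[OF u] c_pos by (simp add: field_simps)
  qed
  have h: "h u \<le> D1 / (1 - u)" if u: "0 \<le> u" "u < 1" for u
  proof -
    let ?v = "(1 + u) / 2"
    have "(?v - u) * E1 u \<le> E0 ?v - E0 u"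
      using u by (intro eval_fps_deriv_le_diff_quotient f_nonneg radius) auto
    then have "E1 u * (1 - u) \<le> 2 * E0 ?v"
      using E0_ge_1[OF u] by (simp add: field_simps)
    then have "E1 u * (1 - u) / E0 u \<le> 2 * E0 ?v / E0 u"
      using E0_ge_1[OF u] by (intro divide_right_mono) auto
    then have "h u * (1 - u) \<le> 2 * (E0 ?v / E0 u)"
      by (simp add: h_def)
    also have "\<dots> \<le> D1" using mid[OF u] by (simp add: D1_def)
    finally show ?thesis using u by (simp add: field_simps)
  qed
  have dH: "dH u \<le> (D1 + 2 * D1 * D1) / (1 - u)\<^sup>2" if u: "0 < u" "u < 1" for u
  proof -
    let ?v = "(1 + u) / 2"
    have E0: "E0 u \<ge> 1" "E0 ?v \<ge> 1" using u by (auto intro!: E0_ge_1)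
    have "(?v - u) * E2 u \<le> E1 ?v - E1 u"
      using u f_nonneg by (intro eval_fps_deriv_le_diff_quotient radius') auto
    then have "E2 u * (1 - u) \<le> 2 * E1 ?v"
      using E1_nonneg[of u] f1_pos u by (simp add: field_simps)
    also have "E1 ?v = h ?v * E0 ?v"
      using E0 by (simp add: h_def)
    also have "2 * (h ?v * E0 ?v) \<le> 2 * (2 * D1 / (1 - u) * E0 ?v)"
      using h[of ?v] u E0 by (intro mult_left_mono mult_right_mono) (auto simp: field_simps)
    finally have "E2 u * (1 - u) / E0 u \<le> 2 * (2 * D1 / (1 - u) * E0 ?v) / E0 u"
      using E0 by (intro divide_right_mono) auto
    then have "E2 u / E0 u * (1 - u) \<le> 4 * D1 / (1 - u) * (E0 ?v / E0 u)"
      by simp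
    also have "\<dots> \<le> 4 * D1 / (1 - u) * (C * 2 ^ m / c)"
      using u D1_pos mid[of u] by (intro mult_left_mono) auto
    also have "C * 2 ^ m / c = D1 / 2"
      by (simp add: D1_def)
    finally have "E2 u / E0 u \<le> 4 * D1 / (1 - u) * (D1 / 2) / (1 - u)"
      by (subst pos_le_divide_eq) (use u in auto)
    also have "4 * D1 / (1 - u) * (D1 / 2) / (1 - u) = 2 * D1 * D1 / (1 - u)\<^sup>2"
      using u by (simp add: power2_eq_square field_simps)
    finally have E2: "E2 u / E0 u \<le> 2 * D1 * D1 / (1 - u)\<^sup>2" .
    have "dH u = h u + u * (E2 u / E0 u) - u * (h u)\<^sup>2"
      using u E0 by (simp add: dH_eq h_def power2_eq_square field_simps)
    also have "\<dots> \<le> h u + u * (E2 u / E0 u)"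
      using u by simp
    also have "\<dots> \<le> h u + 1 * (2 * D1 * D1 / (1 - u)\<^sup>2)"
    proof -
      have "u * (E2 u / E0 u) \<le> u * (2 * D1 * D1 / (1 - u)\<^sup>2)"
        using u E2 by (intro mult_left_mono) auto
      also have "\<dots> \<le> 1 * (2 * D1 * D1 / (1 - u)\<^sup>2)"
        using u D1_pos by (intro mult_right_mono) auto
      finally show ?thesis by simp
    qed
    also have "h u \<le> D1 / (1 - u)" using h[of u] u by simp
    also have "D1 / (1 - u) \<le> D1 / (1 - u)\<^sup>2"
      using u D1_pos by (intro divide_left_mono) (auto simp: power2_eq_square mult_left_le_one_le)
    finally show ?thesis by (simp add: add_divide_distrib)
  qed
  show ?thesis
  proof (rule that[of "D1 + 2 * D1 * D1"])
    show "D1 + 2 * D1 * D1 > 0" using D1_pos by (intro add_pos_pos mult_pos_pos) auto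
    show "h u \<le> (D1 + 2 * D1 * D1) / (1 - u)" if "0 \<le> u" "u < 1" for u
    proof -
      have "D1 / (1 - u) \<le> (D1 + 2 * D1 * D1) / (1 - u)"
        using that D1_pos by (intro divide_right_mono) auto
      with h[OF that] show ?thesis by (rule order.trans)
    qed
      show "dH u \<le> (D1 + 2 * D1 * D1) / (1 - u)\<^sup>2" if "0 < u" "u < 1" for u
      using dH[OF that] .
  qed
qed

end

section \<open>The power bound at a pole and for radius greater than 1\<close>

lemma eval_fps_of_real:
  assumes "\<bar>u\<bar> < 1" "fps_conv_radius f \<ge> 1"
  shows "eval_fps (Abs_fps (\<lambda>j. complex_of_real (fps_nth f j))) (of_real u) = of_real (eval_fps f u)"
proof -
  have "ereal (norm u) < fps_conv_radius f"
    by (rule less_le_trans[OF _ assms(2)]) (use assms(1) in \<open>simp add: one_ereal_def\<close>)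
  then have "(\<lambda>n. complex_of_real (fps_nth f n * u ^ n)) sums of_real (eval_fps f u)"
    by (intro sums_of_real sums_eval_fps)
  then have "(\<Sum>n. complex_of_real (fps_nth f n * u ^ n)) = of_real (eval_fps f u)"
    by (rule sums_unique [symmetric])
  then show ?thesis
    by (simp add: eval_fps_def [of "Abs_fps _"])
qed

text \<open>Near 1, f(u) (1 - u)^m is |g(u)| with m the order of the pole and g holomorphic without
  zeros on a closed disc, so compactness bounds it from both sides. For u < 1 - d, monotonicity
  keeps f between 1 and f(1 - d).\<close>

lemma power_singularity_of_pole:
  assumes "isolated_pole_at_1 f" "fps_conv_radius f = 1"
    and f0: "fps_nth f 0 = 1" and nonneg: "\<And>n. fps_nth f n \<ge> 0"
  obtains m :: nat and c C :: real where "c > 0"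
    "\<And>u. 0 \<le> u \<Longrightarrow> u < 1 \<Longrightarrow> c \<le> eval_fps f u * (1 - u) ^ m \<and> eval_fps f u * (1 - u) ^ m \<le> C"
proof -
  obtain r G where r: "r > 0" and G: "G holomorphic_on ball 1 r - {1}" "is_pole G 1"
    and G_eq: "\<forall>z \<in> ball 1 r \<inter> ball 0 1. G z = eval_fps (Abs_fps (\<lambda>j. complex_of_real (fps_nth f j))) z"
    using assms(1) unfolding isolated_pole_at_1_def by blast
  define m where "m = nat (- zorder G 1)"
  define g where "g = zor_poly G 1"
  note pole = zorder_exist_pole[OF G(1) open_ball centre_in_ball[THEN iffD2, OF r] G(2), folded m_def g_def]
  note g1 = conjunct1[OF conjunct2[OF pole]]
  obtain r' where r': "r' > 0" "cball (1::complex) r' \<subseteq> ball 1 r" "g holomorphic_on cball 1 r'"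
    and g: "\<And>w. w \<in> cball 1 r' - {1} \<Longrightarrow> G w = g w / (w - 1) ^ m \<and> g w \<noteq> 0"
    using conjunct2[OF conjunct2[OF pole]] by blast
  have cont: "continuous_on (cball 1 r') (\<lambda>w. norm (g w))"
    using r'(3) by (intro continuous_intros holomorphic_on_imp_continuous_on)
  obtain w0 where w0: "w0 \<in> cball 1 r'" "\<And>w. w \<in> cball 1 r' \<Longrightarrow> norm (g w0) \<le> norm (g w)"
    using continuous_attains_inf[OF compact_cball _ cont] r' by auto
  obtain w1 where w1: "w1 \<in> cball 1 r'" "\<And>w. w \<in> cball 1 r' \<Longrightarrow> norm (g w) \<le> norm (g w1)"
    using continuous_attains_sup[OF compact_cball _ cont] r' by auto
  define d where "d = min r' 1 / 2"
  have d: "0 < d" "d < 1" "d \<le> r'" using r' by (auto simp: d_def min_def)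
  have near: "eval_fps f u * (1 - u) ^ m = norm (g (of_real u))" "complex_of_real u \<in> cball 1 r'"
    if u: "0 \<le> u" "u < 1" "1 - d \<le> u" for u
  proof -
    have dist: "dist 1 (complex_of_real u) = 1 - u"
      using dist_of_real[of 1 u, where 'a = complex] u by (simp add: dist_real_def)
    with u d show in_ball: "complex_of_real u \<in> cball 1 r'" by simp
    have "complex_of_real u \<in> ball 1 r \<inter> ball 0 1"
      using subsetD[OF r'(2) in_ball] u by simp
    then have "complex_of_real (eval_fps f u) = G (of_real u)"
      using bspec[OF G_eq] eval_fps_of_real[of u f] u assms(2) by simp
    also have "\<dots> = g (of_real u) / (of_real u - 1) ^ m"
      using g[of "of_real u", THEN conjunct1] in_ball u by simp
    finally have "norm (complex_of_real (eval_fps f u)) = norm (g (of_real u)) / norm (complex_of_real u - 1) ^ m"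
      by (simp add: norm_divide norm_power)
    also have "norm (complex_of_real u - 1) = 1 - u"
      using dist by (simp add: dist_norm norm_minus_commute)
    finally have "\<bar>eval_fps f u\<bar> * (1 - u) ^ m = norm (g (of_real u))"
      using u by simp
    moreover have "eval_fps f u \<ge> 1"
      using u assms by (intro eval_fps_ge_1) (auto simp: one_ereal_def)
    ultimately show "eval_fps f u * (1 - u) ^ m = norm (g (of_real u))" by simp
  qed
  define c where "c = min (norm (g w0)) (d ^ m)"
  define C where "C = max (norm (g w1)) (eval_fps f (1 - d))"
  have cC: "c \<le> norm (g w0)" "c \<le> d ^ m" "norm (g w1) \<le> C" "eval_fps f (1 - d) \<le> C"
    by (simp_all add: c_def C_def)
  have "g w0 \<noteq> 0"
  proof (cases "w0 = 1")
    case False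
    with w0(1) have "w0 \<in> cball 1 r' - {1}" by blast
    then show ?thesis by (rule g[THEN conjunct2])
  qed (use g1 in simp)
  then have "c > 0" using d by (simp add: c_def)
  moreover have "c \<le> eval_fps f u * (1 - u) ^ m \<and> eval_fps f u * (1 - u) ^ m \<le> C" if u: "0 \<le> u" "u < 1" for u
  proof (cases "1 - d \<le> u")
    case True
    have "norm (g w0) \<le> eval_fps f u * (1 - u) ^ m" "eval_fps f u * (1 - u) ^ m \<le> norm (g w1)"
      unfolding near(1)[OF u True] using near(2)[OF u True] by (auto intro: w0(2) w1(2))
    with cC show ?thesis by linarith
  next
    case False
    have ge: "eval_fps f u \<ge> 1"
      using u assms by (intro eval_fps_ge_1) (auto simp: one_ereal_def)
    have "d ^ m \<le> (1 - u) ^ m" using False d by (intro power_mono) auto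
    also have "1 * (1 - u) ^ m \<le> eval_fps f u * (1 - u) ^ m" using ge u by (intro mult_right_mono) auto
    finally have 1: "d ^ m \<le> eval_fps f u * (1 - u) ^ m" by simp
    have "eval_fps f u * (1 - u) ^ m \<le> eval_fps f u * 1"
      using ge u by (intro mult_left_mono power_le_one) auto
    also have "eval_fps f u \<le> eval_fps f (1 - d)"
    proof (rule sums_le)
      show "(\<lambda>n. fps_nth f n * u ^ n) sums eval_fps f u" "(\<lambda>n. fps_nth f n * (1 - d) ^ n) sums eval_fps f (1 - d)"
        using u d assms(2) by (auto intro!: sums_eval_fps simp: one_ereal_def)
    qed (use nonneg u d False in \<open>auto intro!: mult_left_mono power_mono\<close>)
    finally show ?thesis using 1 cC by linarith
  qed
  ultimately show ?thesis using that by blast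
qed

lemma power_singularity_of_radius:
  assumes "fps_conv_radius f > 1" and f0: "fps_nth f 0 = 1" and nonneg: "\<And>n. fps_nth f n \<ge> 0"
    and u: "0 \<le> u" "u < (1::real)"
  shows "1 \<le> eval_fps f u" "eval_fps f u \<le> eval_fps f 1"
proof -
  have R: "ereal v < fps_conv_radius f" if "v \<le> 1" for v
    by (rule le_less_trans[OF _ assms(1)]) (use that in \<open>simp add: one_ereal_def\<close>)
  show "1 \<le> eval_fps f u"
    using u R by (intro eval_fps_ge_1 f0 nonneg) auto
  show "eval_fps f u \<le> eval_fps f 1"
  proof (rule sums_le)
    show "(\<lambda>n. fps_nth f n * u ^ n) sums eval_fps f u" "(\<lambda>n. fps_nth f n * 1 ^ n) sums eval_fps f 1"
      using u R[of u] R[of 1] by (intro sums_eval_fps; simp)+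
    show "fps_nth f n * u ^ n \<le> fps_nth f n * 1 ^ n" for n
      using nonneg u by (intro mult_left_mono power_mono) auto
  qed
qed

section \<open>Weighted sums as integrals\<close>

text \<open>From -ln u \<le> (u^(-e) - 1) / e with e small enough that e p \<le> 1/2. The logarithm
  keeps its zero of first order at 1, and the price u^(-1/2) at 0 is integrable and leads to a Beta
  integral.\<close>

lemma ln_powr_le:
  assumes "p > 0"
  obtains K :: real where "K > 0"
    "\<And>u. 0 < u \<Longrightarrow> u < 1 \<Longrightarrow> \<bar>ln u\<bar> powr p \<le> K * ((1 - u) powr p * u powr (- 1 / 2))"
proof -
  define e where "e = min 1 (1 / (2 * p))"
  have e: "e > 0" "e \<le> 1" "e * p \<le> 1 / 2"
    using assms by (auto simp: e_def min_def field_simps)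
  have "\<bar>ln u\<bar> powr p \<le> (1 / e) powr p * ((1 - u) powr p * u powr (- 1 / 2))" if u: "0 < u" "u < 1" for u
  proof -
    have "ln (u powr (- e)) \<le> u powr (- e) - 1"
      using u by (intro ln_le_minus_one) auto
    then have "e * (- ln u) \<le> u powr (- e) * (1 - u powr e)"
      using u by (simp add: ln_powr algebra_simps flip: powr_add)
    also have "\<dots> \<le> u powr (- e) * (1 - u)"
      using u e powr_mono'[of e 1 u] by (intro mult_left_mono) auto
    finally have "\<bar>ln u\<bar> \<le> 1 / e * (u powr (- e) * (1 - u))"
      using u e by (simp add: field_simps)
    then have "\<bar>ln u\<bar> powr p \<le> (1 / e * (u powr (- e) * (1 - u))) powr p"
      using assms by (intro powr_mono2) auto
    also have "\<dots> = (1 / e) powr p * ((1 - u) powr p * u powr (- (e * p)))"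
      using u e by (simp add: powr_mult powr_powr powr_divide mult_ac)
    also have "\<dots> \<le> (1 / e) powr p * ((1 - u) powr p * u powr (- 1 / 2))"
      using u e by (intro mult_left_mono powr_mono') auto
    finally show ?thesis .
  qed
  with e show ?thesis by (intro that[of "(1 / e) powr p"]) auto
qed

lemma Beta_kernel_integrable:
  assumes "a > 0"
  shows "(\<lambda>u::real. u powr (- 1 / 2) * (1 - u) powr (a - 1)) integrable_on {0<..<1}"
  using has_integral_Beta_real[of "1 / 2" a] assms
  by (auto simp: has_integral_Icc_iff_Ioo integrable_on_def)

context regular_weights
begin

text \<open>An admissible kernel has an at most quadratic singularity at 1, compensated once
  by the zero of \<open>ln u\<close>; the bounds of Potter type make \<open>W\<close> a common majorant.\<close>

lemma kernel_majorant:
  fixes K :: "real \<Rightarrow> real"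
  assumes K: "\<And>u. 0 < u \<Longrightarrow> u < 1 \<Longrightarrow> \<bar>K u\<bar> \<le> D * (\<bar>ln u\<bar> / (1 - u)\<^sup>2 + 1 / (1 - u))"
  obtains W :: "real \<Rightarrow> real" and y0 where "W integrable_on {0<..<1}" "y0 \<ge> 1"
    "\<And>u y. 0 < u \<Longrightarrow> u < 1 \<Longrightarrow> y \<ge> y0 \<Longrightarrow> B (- ln u * y) / B y * \<bar>K u\<bar> \<le> W u"
proof -
  \<comment> \<open>The exponents \<beta> - \<delta> and \<beta> + \<delta> of
    \<open>B_potter\<close> for \<delta> = \<beta> / 2.\<close>
  let ?a1 = "\<beta> / 2" and ?a2 = "3 * \<beta> / 2"
  let ?g = "\<lambda>a u. u powr (- 1 / 2) * (1 - u) powr (a - 1)"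
  have D: "D \<ge> 0"
  proof (rule ccontr)
    assume "\<not> D \<ge> 0"
    then have "D * (\<bar>ln (1 / 2)\<bar> / (1 - 1 / 2)\<^sup>2 + 1 / (1 - 1 / 2)) < 0"
      by (intro mult_neg_pos add_nonneg_pos divide_nonneg_nonneg abs_ge_zero) auto
    moreover have "\<bar>K (1 / 2)\<bar> \<le> D * (\<bar>ln (1 / 2)\<bar> / (1 - 1 / 2)\<^sup>2 + 1 / (1 - 1 / 2))"
      by (intro K) auto
    ultimately show False by linarith
  qed
  have bound: "\<exists>M>0. \<forall>u. 0 < u \<longrightarrow> u < 1 \<longrightarrow> \<bar>K u\<bar> * \<bar>ln u\<bar> powr a \<le> M * ?g a u" if a: "a > 0" for a
  proof -
    obtain M1 where M1: "M1 > 0" "\<And>u. 0 < u \<Longrightarrow> u < 1 \<Longrightarrow> \<bar>ln u\<bar> powr (a + 1) \<le> M1 * ((1 - u) powr (a + 1) * u powr (- 1 / 2))"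
      using ln_powr_le[of "a + 1"] a by auto
    obtain M2 where M2: "M2 > 0" "\<And>u. 0 < u \<Longrightarrow> u < 1 \<Longrightarrow> \<bar>ln u\<bar> powr a \<le> M2 * ((1 - u) powr a * u powr (- 1 / 2))"
      using ln_powr_le[of a] a by auto
    have "\<bar>K u\<bar> * \<bar>ln u\<bar> powr a \<le> ((D + 1) * (M1 + M2)) * ?g a u" if u: "0 < u" "u < 1" for u
    proof -
      have "\<bar>K u\<bar> * \<bar>ln u\<bar> powr a \<le> D * (\<bar>ln u\<bar> / (1 - u)\<^sup>2 + 1 / (1 - u)) * \<bar>ln u\<bar> powr a"
        using K[OF u] by (intro mult_right_mono) auto
      also have "\<dots> = D * (\<bar>ln u\<bar> powr (a + 1) / (1 - u)\<^sup>2 + \<bar>ln u\<bar> powr a / (1 - u))"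
        using u by (simp add: powr_add algebra_simps)
      also have "\<dots> \<le> D * (M1 * ((1 - u) powr (a + 1) * u powr (- 1 / 2)) / (1 - u)\<^sup>2 + M2 * ((1 - u) powr a * u powr (- 1 / 2)) / (1 - u))"
        using u D by (intro mult_left_mono add_mono divide_right_mono M1 M2) auto
      \<comment> \<open>Both terms of the kernel bound leave the same power (1 - u)^(a - 1),
        integrable at 1 because a > 0.\<close>
      also have "(1 - u) powr (a + 1) = (1 - u) powr (a - 1) * (1 - u)\<^sup>2"
      proof -
        have "(1 - u) powr (a + 1) = (1 - u) powr ((a - 1) + 2)" by (simp add: algebra_simps)
        also have "\<dots> = (1 - u) powr (a - 1) * (1 - u)\<^sup>2" using u by (simp only: powr_add) simp
        finally show ?thesis .
      qed
      also have "(1 - u) powr a = (1 - u) powr (a - 1) * (1 - u)"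
        using u by (simp add: powr_diff)
      also have "D * (M1 * ((1 - u) powr (a - 1) * (1 - u)\<^sup>2 * u powr (- 1 / 2)) / (1 - u)\<^sup>2 +
            M2 * ((1 - u) powr (a - 1) * (1 - u) * u powr (- 1 / 2)) / (1 - u)) = (D * (M1 + M2)) * ?g a u"
      proof -
        have cancel: "M * (p * q * r) / q = M * (r * p)" if "q \<noteq> 0" for M p q r :: real
          using that by simp
        show ?thesis
          by (subst cancel, use u in simp, subst cancel, use u in simp) (simp add: ring_distribs mult_ac)
      qed
      also have "\<dots> \<le> ((D + 1) * (M1 + M2)) * ?g a u"
        using M1 M2 D by (intro mult_right_mono) auto
      finally show ?thesis .
    qed
    moreover have "(D + 1) * (M1 + M2) > 0" using M1 M2 D by simp
    ultimately show ?thesis by blast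
  qed
  obtain M1 where M1: "\<And>u. 0 < u \<Longrightarrow> u < 1 \<Longrightarrow> \<bar>K u\<bar> * \<bar>ln u\<bar> powr ?a1 \<le> M1 * ?g ?a1 u"
    using bound[of ?a1] \<beta>_pos by auto
  obtain M2 where M2: "\<And>u. 0 < u \<Longrightarrow> u < 1 \<Longrightarrow> \<bar>K u\<bar> * \<bar>ln u\<bar> powr ?a2 \<le> M2 * ?g ?a2 u"
    using bound[of ?a2] \<beta>_pos by auto
  obtain A y0 where A: "A > 0" "y0 \<ge> 1"
    "\<And>v y. v > 0 \<Longrightarrow> y \<ge> y0 \<Longrightarrow> B (v * y) \<le> A * (v powr (\<beta> - \<beta> / 2) + v powr (\<beta> + \<beta> / 2)) * B y"
    using B_potter[of "\<beta> / 2"] \<beta>_pos by auto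
  define W where "W u = A * (M1 * ?g ?a1 u + M2 * ?g ?a2 u)" for u
  have "W integrable_on {0<..<1}"
    unfolding W_def using \<beta>_pos
    by (intro integrable_on_mult_right integrable_add Beta_kernel_integrable) auto
  moreover have "B (- ln u * y) / B y * \<bar>K u\<bar> \<le> W u" if u: "0 < u" "u < 1" and y: "y \<ge> y0" for u y
  proof -
    have By: "B y \<ge> 1" using y A by (intro B_ge_1) auto
    have "B (- ln u * y) / B y \<le> A * ((- ln u) powr (\<beta> - \<beta> / 2) + (- ln u) powr (\<beta> + \<beta> / 2))"
      using A(3)[of "- ln u" y] u y By by (simp add: field_simps)
    then have "B (- ln u * y) / B y * \<bar>K u\<bar> \<le> A * ((- ln u) powr (\<beta> - \<beta> / 2) + (- ln u) powr (\<beta> + \<beta> / 2)) * \<bar>K u\<bar>"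
      by (intro mult_right_mono) auto
    also have "\<dots> = A * (\<bar>K u\<bar> * \<bar>ln u\<bar> powr ?a1 + \<bar>K u\<bar> * \<bar>ln u\<bar> powr ?a2)"
      using u by (simp add: algebra_simps)
    also have "\<dots> \<le> W u"
      unfolding W_def using u A by (intro mult_left_mono add_mono M1 M2) auto
    finally show ?thesis .
  qed
  ultimately show ?thesis using that A(2) by blast
qed

lemma B_indicator_sum:
  "(\<Sum>k=1..N. b k * (if real k \<le> y then 1 else 0)) = B (min y (real N))"
proof -
  have "(\<Sum>k=1..N. b k * (if real k \<le> y then 1 else 0)) = (\<Sum>k\<in>{k\<in>{1..N}. real k \<le> y}. b k)"
    by (subst sum.inter_filter) (auto intro!: sum.cong)
  also have "{k\<in>{1..N}. real k \<le> y} = {1..nat \<lfloor>min y (real N)\<rfloor>}"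
    by (auto simp: le_nat_floor le_nat_iff min_def) linarith+
  finally show ?thesis by (simp add: partial_sum_def)
qed

context
  fixes K q :: "real \<Rightarrow> real" and D :: real
  assumes K: "\<And>u. 0 < u \<Longrightarrow> u < 1 \<Longrightarrow> \<bar>K u\<bar> \<le> D * (\<bar>ln u\<bar> / (1 - u)\<^sup>2 + 1 / (1 - u))"
    and q: "\<And>u. 0 < u \<Longrightarrow> u < 1 \<Longrightarrow> (K has_integral q u) {0..u}"
begin

text \<open>The number q(exp(-k s)) is the integral of K over u \<le> exp(-k s), that is over k
  \<le> -ln u / s; for fixed u these k collect the weight B(-ln u / s). Dividing by B(1 / s) makes
  the majorant independent of s, as the passage s \<rightarrow> 0 requires.\<close>

lemma weighted_kernel_sums:
  "\<exists>y0\<ge>1. \<forall>s>0. 1 / s \<ge> y0 \<longrightarrow>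
    (\<lambda>u. B (- ln u / s) / B (1 / s) * K u) integrable_on {0<..<1} \<and>
    (\<lambda>k. b (Suc k) * q (exp (- real (Suc k) * s))) sums
      (B (1 / s) * integral {0<..<1} (\<lambda>u. B (- ln u / s) / B (1 / s) * K u))"
proof -
  obtain W y0 where W: "W integrable_on {0<..<1}" and y0: "y0 \<ge> 1"
    and W_ge: "\<And>u y. 0 < u \<Longrightarrow> u < 1 \<Longrightarrow> y \<ge> y0 \<Longrightarrow> B (- ln u * y) / B y * \<bar>K u\<bar> \<le> W u"
    using kernel_majorant[OF K] by metis
  have main: "(\<lambda>u. B (- ln u / s) / B (1 / s) * K u) integrable_on {0<..<1} \<and>
    (\<lambda>k. b (Suc k) * q (exp (- real (Suc k) * s))) sums
      (B (1 / s) * integral {0<..<1} (\<lambda>u. B (- ln u / s) / B (1 / s) * K u))"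
    if s: "s > 0" "1 / s \<ge> y0" for s
  proof -
    have Bs: "B (1 / s) \<ge> 1" using s y0 by (intro B_ge_1) linarith
    have le_iff: "real k \<le> - ln u / s \<longleftrightarrow> u \<le> exp (- real k * s)" if "0 < u" for u k
    proof -
      have "real k \<le> - ln u / s \<longleftrightarrow> real k * s \<le> - ln u" by (rule pos_le_divide_eq[OF s(1)])
      also have "\<dots> \<longleftrightarrow> ln u \<le> - real k * s" by auto
      also have "\<dots> \<longleftrightarrow> u \<le> exp (- real k * s)" using that by (metis exp_ln exp_le_cancel_iff)
      finally show ?thesis .
    qed
    define F where "F N u = (\<Sum>k=1..N. b k * (if u \<in> {0<..exp (- real k * s)} then K u else 0))" for N u
    have F_int: "(F N has_integral (\<Sum>k=1..N. b k * q (exp (- real k * s)))) {0<..<1}" for N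
      unfolding F_def
    proof (intro has_integral_sum has_integral_mult_right)
      fix k assume k: "k \<in> {1..N}"
      have lt: "exp (- real k * s) < 1" using k s by simp
      then have "(K has_integral q (exp (- real k * s))) {0..exp (- real k * s)}"
        by (intro q) auto
      then have "(K has_integral q (exp (- real k * s))) {0<..exp (- real k * s)}"
        by (subst (asm) has_integral_spike_set_eq[of _ "{0<..exp (- real k * s)}"])
          (auto intro: negligible_subset[of "{0}"])
      moreover have "{0<..exp (- real k * s)} \<subseteq> {0<..<1}"
        using lt by (intro subsetI; simp only: greaterThanAtMost_iff greaterThanLessThan_iff) linarith
      ultimately show "((\<lambda>u. if u \<in> {0<..exp (- real k * s)} then K u else 0) has_integral q (exp (- real k * s))) {0<..<1}"
        by (simp only: has_integral_restrict)
    qed simp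
    have F_eq: "F N u = B (min (- ln u / s) (real N)) * K u" if "0 < u" for N u
    proof -
      have mem: "u \<in> {0<..exp (- real k * s)} \<longleftrightarrow> real k \<le> - ln u / s" for k
        using that by (simp only: le_iff[OF that] greaterThanAtMost_iff) simp
      show ?thesis
        unfolding F_def B_indicator_sum[symmetric] sum_distrib_right mem
        by (intro sum.cong refl) simp
    qed
    let ?G = "\<lambda>u. B (- ln u / s) * K u"
    have dom: "norm (F N u) \<le> B (1 / s) * W u" if u: "u \<in> {0<..<1}" for N u
    proof -
      have "norm (F N u) = B (min (- ln u / s) (real N)) * \<bar>K u\<bar>"
        using F_eq u B_nonneg by (simp add: abs_mult)
      also have "\<dots> \<le> B (- ln u / s) * \<bar>K u\<bar>"
        by (intro mult_right_mono B_mono) auto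
      also have "\<dots> = B (1 / s) * (B (- ln u * (1 / s)) / B (1 / s) * \<bar>K u\<bar>)"
        using Bs by simp
      also have "\<dots> \<le> B (1 / s) * W u"
        using u s Bs by (intro mult_left_mono W_ge) auto
      finally show ?thesis .
    qed
    have lim: "(\<lambda>N. F N u) \<longlonglongrightarrow> ?G u" if u: "u \<in> {0<..<1}" for u
    proof (rule tendsto_eventually)
      show "\<forall>\<^sub>F N in sequentially. F N u = ?G u"
        using eventually_ge_at_top[of "nat \<lceil>- ln u / s\<rceil>"]
      proof eventually_elim
        case (elim N)
        then have "- ln u / s \<le> real N" by linarith
        then show ?case using F_eq u by (simp add: min_def)
      qed
    qed
    have "(\<lambda>u. B (1 / s) * W u) integrable_on {0<..<1}"
      using W by (rule integrable_on_mult_right)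
    note DC = dominated_convergence[of F, OF has_integral_integrable[OF F_int] this dom lim]
    have G_eq: "(\<lambda>u. B (- ln u / s) / B (1 / s) * K u) = (\<lambda>u. 1 / B (1 / s) * ?G u)"
      by auto
    have "(\<lambda>N. \<Sum>k=1..N. b k * q (exp (- real k * s))) \<longlonglongrightarrow> integral {0<..<1} ?G"
      using DC(2) by (simp add: integral_unique[OF F_int])
    then have "(\<lambda>k. b (Suc k) * q (exp (- real (Suc k) * s))) sums integral {0<..<1} ?G"
      by (simp only: sums_def One_nat_def sum.atLeast1_atMost_eq)
    moreover have "integral {0<..<1} ?G = B (1 / s) * integral {0<..<1} (\<lambda>u. B (- ln u / s) / B (1 / s) * K u)"
      unfolding G_eq using Bs by (subst integral_mult_right) auto
    moreover have "(\<lambda>u. B (- ln u / s) / B (1 / s) * K u) integrable_on {0<..<1}"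
      unfolding G_eq using DC(1) by (rule integrable_on_mult_right)
    ultimately show ?thesis
      by (simp only: simp_thms)
  qed
  with y0 show ?thesis by blast
qed

lemma weighted_kernel_summable:
  "\<exists>y0\<ge>1. \<forall>s>0. 1 / s \<ge> y0 \<longrightarrow> summable (\<lambda>k. b (Suc k) * q (exp (- real (Suc k) * s)))"
proof -
  obtain y0 where "y0 \<ge> 1" and y0: "\<And>s. s > 0 \<Longrightarrow> 1 / s \<ge> y0 \<Longrightarrow>
    (\<lambda>k. b (Suc k) * q (exp (- real (Suc k) * s))) sums
      (B (1 / s) * integral {0<..<1} (\<lambda>u. B (- ln u / s) / B (1 / s) * K u))"
    using weighted_kernel_sums by blast
  then show ?thesis
    by (intro exI[of _ y0] conjI allI impI sums_summable[OF y0])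
qed

lemma weighted_kernel_limit:
  fixes s :: "nat \<Rightarrow> real"
  assumes s: "\<And>n. s n > 0" "s \<longlonglongrightarrow> 0"
  shows "(\<lambda>u. K u * \<bar>ln u\<bar> powr \<beta>) integrable_on {0<..<1}"
    "(\<lambda>n. (\<Sum>k. b (Suc k) * q (exp (- real (Suc k) * s n))) / B (1 / s n)) \<longlonglongrightarrow>
      integral {0<..<1} (\<lambda>u. K u * \<bar>ln u\<bar> powr \<beta>)"
proof -
  obtain W y1 where W: "W integrable_on {0<..<1}" and y1: "y1 \<ge> 1"
    and W_ge: "\<And>u y. 0 < u \<Longrightarrow> u < 1 \<Longrightarrow> y \<ge> y1 \<Longrightarrow> B (- ln u * y) / B y * \<bar>K u\<bar> \<le> W u"
    using kernel_majorant[OF K] by metis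
  obtain y2 where y2: "y2 \<ge> 1"
    "\<And>s. s > 0 \<Longrightarrow> 1 / s \<ge> y2 \<Longrightarrow> (\<lambda>u. B (- ln u / s) / B (1 / s) * K u) integrable_on {0<..<1}"
    "\<And>s. s > 0 \<Longrightarrow> 1 / s \<ge> y2 \<Longrightarrow> (\<lambda>k. b (Suc k) * q (exp (- real (Suc k) * s))) sums
      (B (1 / s) * integral {0<..<1} (\<lambda>u. B (- ln u / s) / B (1 / s) * K u))"
    using weighted_kernel_sums by blast
  have s_top: "filterlim (\<lambda>n. 1 / s n) at_top sequentially"
    using filterlim_inverse_at_top[OF s(2)] s(1) by (simp add: inverse_eq_divide)
  obtain n0 where n0: "\<And>n. n \<ge> n0 \<Longrightarrow> 1 / s n \<ge> max y1 y2"
    using s_top unfolding filterlim_at_top eventually_sequentially by blast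
  \<comment> \<open>An index shift: the bounds hold for large 1 / s only, while dominated
    convergence asks for them at every n.\<close>
  define r where "r n = s (n + n0)" for n
  have r: "r n > 0" "1 / r n \<ge> y1" "1 / r n \<ge> y2" for n
    using s n0[of "n + n0"] by (auto simp: r_def)
  have r_top: "filterlim (\<lambda>n. 1 / r n) at_top sequentially"
    unfolding r_def using s_top by (rule filterlim_compose) (auto intro!: filterlim_add_const_nat_at_top)
  let ?f = "\<lambda>n u. B (- ln u / r n) / B (1 / r n) * K u"
  have dom: "norm (?f n u) \<le> W u" if "u \<in> {0<..<1}" for n u
    using W_ge[of u "1 / r n"] that r(2)[of n] B_nonneg by (simp add: abs_mult)
  have lim: "(\<lambda>n. ?f n u) \<longlonglongrightarrow> K u * \<bar>ln u\<bar> powr \<beta>" if u: "u \<in> {0<..<1}" for u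
  proof -
    have "((\<lambda>y. B (- ln u * y) / B y) \<longlongrightarrow> (- ln u) powr \<beta>) at_top"
      using u by (intro B_regular) auto
    from filterlim_compose[OF this r_top]
    have "(\<lambda>n. B (- ln u / r n) / B (1 / r n) * K u) \<longlonglongrightarrow> (- ln u) powr \<beta> * K u"
      by (intro tendsto_mult tendsto_const) simp
    then show ?thesis using u by (simp add: mult.commute)
  qed
  note DC = dominated_convergence[of ?f, OF y2(2)[OF r(1,3)] W dom lim]
  show "(\<lambda>u. K u * \<bar>ln u\<bar> powr \<beta>) integrable_on {0<..<1}" by (rule DC(1))
  have "(\<lambda>n. (\<Sum>k. b (Suc k) * q (exp (- real (Suc k) * r n))) / B (1 / r n)) \<longlonglongrightarrow>
      integral {0<..<1} (\<lambda>u. K u * \<bar>ln u\<bar> powr \<beta>)"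
  proof -
    have *: "(\<Sum>k. b (Suc k) * q (exp (- real (Suc k) * r n))) / B (1 / r n) = integral {0<..<1} (?f n)" for n
    proof -
      have "B (1 / r n) \<ge> 1" using r[of n] y1 by (intro B_ge_1) linarith
      then show ?thesis using sums_unique[OF y2(3)[OF r(1,3)[of n]]] by simp
    qed
    show ?thesis unfolding * by (rule DC(2))
  qed
  then show "(\<lambda>n. (\<Sum>k. b (Suc k) * q (exp (- real (Suc k) * s n))) / B (1 / s n)) \<longlonglongrightarrow>
      integral {0<..<1} (\<lambda>u. K u * \<bar>ln u\<bar> powr \<beta>)"
    unfolding r_def by (rule LIMSEQ_offset)
qed

end

end

section \<open>Asymptotics of the tail sums and of the mean size\<close>

locale shape_model = regular_weights b \<beta> + power_singularity f m c C
  for b :: "nat \<Rightarrow> real" and \<beta> :: real and f :: "real fps" and m :: nat and c C :: real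
begin

text \<open>The expression in front of |ln u|^\<beta> is the derivative of -ln u * H(u).\<close>

definition \<Omega> :: real where
  "\<Omega> = integral {0<..<1} (\<lambda>u. (- ln u * dH u - h u) * \<bar>ln u\<bar> powr \<beta>)"

text \<open>The limit shape before normalisation. The subtracted term removes the indices k with k s
  \<le> t, for which the kernel cut at exp(-t) produces H(exp(-t)) instead of 0.\<close>

definition \<Phi> :: "real \<Rightarrow> real" where
  "\<Phi> t = integral {0<..<1} (\<lambda>u. (if u \<le> exp (- t) then dH u else 0) * \<bar>ln u\<bar> powr \<beta>) - t powr \<beta> * H (exp (- t))"

definition tail_term :: "real \<Rightarrow> real \<Rightarrow> nat \<Rightarrow> real" where
  "tail_term s t k = (if real k * s > t then b k * H (exp (- real k * s)) else 0)"

text \<open>The grand canonical mean, at x = exp(-s), of the number of parts larger than t /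
  s.\<close>

definition tail :: "real \<Rightarrow> real \<Rightarrow> real" where
  "tail s t = (\<Sum>k. tail_term s t (Suc k))"

definition M :: "real \<Rightarrow> real" where
  "M s = (\<Sum>k. real (Suc k) * (b (Suc k) * H (exp (- real (Suc k) * s))))"

lemma H_has_integral:
  assumes "0 \<le> v" "v < 1"
  shows "(dH has_integral H v) {0..v}"
proof -
  have "(dH has_integral (H v - H 0)) {0..v}"
    using assms DERIV_H
    by (intro fundamental_theorem_of_calculus_interior continuous_on_subset[OF continuous_on_H])
      (auto simp: has_real_derivative_iff_has_vector_derivative[symmetric])
  then show ?thesis by (simp add: H_0)
qed

lemma growth:
  "\<exists>D>0. \<forall>u. 0 < u \<longrightarrow> u < 1 \<longrightarrow> \<bar>h u\<bar> \<le> D / (1 - u) \<and> \<bar>dH u\<bar> \<le> D / (1 - u)\<^sup>2"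
proof -
  obtain D where D: "D > 0" "\<And>u. 0 \<le> u \<Longrightarrow> u < 1 \<Longrightarrow> h u \<le> D / (1 - u)"
    "\<And>u. 0 < u \<Longrightarrow> u < 1 \<Longrightarrow> dH u \<le> D / (1 - u)\<^sup>2"
    using growth_bounds by blast
  have "\<bar>h u\<bar> \<le> D / (1 - u)" if "0 < u" "u < 1" for u
    using D(2)[of u] h_pos[of u] that by simp
  moreover have "\<bar>dH u\<bar> \<le> D / (1 - u)\<^sup>2" if "0 < u" "u < 1" for u
    using D(3)[of u] dH_nonneg[of u] that by simp
  ultimately show ?thesis using D(1) by blast
qed

text \<open>On u \<le> exp(-t) the factor |ln u| / t is at least 1 and may be inserted, which
  supplies the logarithm demanded of an admissible kernel.\<close>

lemma tail_kernel_bound: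
  assumes "t > 0"
  obtains D where "\<And>u. 0 < u \<Longrightarrow> u < 1 \<Longrightarrow>
    \<bar>if u \<le> exp (- t) then dH u else 0\<bar> \<le> D * (\<bar>ln u\<bar> / (1 - u)\<^sup>2 + 1 / (1 - u))"
proof -
  obtain D where D: "D > 0" "\<And>u. 0 < u \<Longrightarrow> u < 1 \<Longrightarrow> \<bar>dH u\<bar> \<le> D / (1 - u)\<^sup>2"
    using growth by blast
  have "\<bar>if u \<le> exp (- t) then dH u else 0\<bar> \<le> D / t * (\<bar>ln u\<bar> / (1 - u)\<^sup>2 + 1 / (1 - u))" if u: "0 < u" "u < 1" for u
  proof (cases "u \<le> exp (- t)")
    case True
    then have "ln u \<le> - t" using u by (metis exp_ln exp_le_cancel_iff)
    then have t: "1 \<le> \<bar>ln u\<bar> / t" using assms by (simp add: field_simps)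
    have "\<bar>dH u\<bar> \<le> D / (1 - u)\<^sup>2 * 1" using D(2) u by simp
    also have "\<dots> \<le> D / (1 - u)\<^sup>2 * (\<bar>ln u\<bar> / t)"
      using t D(1) by (intro mult_left_mono) auto
    also have "\<dots> = D / t * (\<bar>ln u\<bar> / (1 - u)\<^sup>2 + 0)" by simp
    also have "\<dots> \<le> D / t * (\<bar>ln u\<bar> / (1 - u)\<^sup>2 + 1 / (1 - u))"
      using u D(1) assms by (intro mult_left_mono add_left_mono) auto
    finally show ?thesis using True by simp
  next
    case False
    have "0 \<le> D / t * (\<bar>ln u\<bar> / (1 - u)\<^sup>2 + 1 / (1 - u))"
      using u D(1) assms by (intro mult_nonneg_nonneg add_nonneg_nonneg divide_nonneg_nonneg abs_ge_zero zero_le_power2) auto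
    with False show ?thesis by simp
  qed
  then show ?thesis using that by blast
qed

lemma tail_kernel_has_integral:
  assumes t: "t > 0" and u: "0 < u" "u < 1"
  shows "((\<lambda>u. if u \<le> exp (- t) then dH u else 0) has_integral H (min u (exp (- t)))) {0..u}"
proof -
  let ?v = "min u (exp (- t))"
  have "(dH has_integral H ?v) {0..?v}"
    using u by (intro H_has_integral) auto
  then have "((\<lambda>x. if x \<in> {0..?v} then dH x else 0) has_integral H ?v) {0..u}"
    by (subst has_integral_restrict) auto
  then show ?thesis
    by (rule has_integral_eq[rotated]) auto
qed

text \<open>Integrating the cut kernel up to exp(-k s) gives H at the smaller of exp(-k s) and
  exp(-t). The indices with k s \<le> t contribute H(exp(-t)) each, with total weight B(t /
  s).\<close>

lemma tail_sums:
  assumes t: "t > 0"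
  shows "\<exists>y0\<ge>1. \<forall>s>0. 1 / s \<ge> y0 \<longrightarrow> summable (\<lambda>k. tail_term s t (Suc k)) \<and>
    (\<Sum>k. b (Suc k) * H (min (exp (- real (Suc k) * s)) (exp (- t)))) = tail s t + B (t / s) * H (exp (- t))"
proof -
  obtain D where D: "\<And>u. 0 < u \<Longrightarrow> u < 1 \<Longrightarrow>
      \<bar>if u \<le> exp (- t) then dH u else 0\<bar> \<le> D * (\<bar>ln u\<bar> / (1 - u)\<^sup>2 + 1 / (1 - u))"
    using tail_kernel_bound[OF t] by blast
  obtain y0 where y0: "y0 \<ge> 1" "\<And>s. s > 0 \<Longrightarrow> 1 / s \<ge> y0 \<Longrightarrow>
      summable (\<lambda>k. b (Suc k) * H (min (exp (- real (Suc k) * s)) (exp (- t))))"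
    using weighted_kernel_summable[OF D tail_kernel_has_integral[OF t]] by blast
  have "summable (\<lambda>k. tail_term s t (Suc k)) \<and>
    (\<Sum>k. b (Suc k) * H (min (exp (- real (Suc k) * s)) (exp (- t)))) = tail s t + B (t / s) * H (exp (- t))"
    if s: "s > 0" "1 / s \<ge> y0" for s
  proof -
    let ?q = "\<lambda>k. b (Suc k) * H (min (exp (- real (Suc k) * s)) (exp (- t)))"
    let ?c = "\<lambda>k. if real (Suc k) * s \<le> t then b (Suc k) * H (exp (- t)) else 0"
    have eq: "tail_term s t (Suc k) = ?q k - ?c k" for k
    proof (cases "real (Suc k) * s \<le> t")
      case True
      then have "exp (- t) \<le> exp (- real (Suc k) * s)" by (simp del: of_nat_Suc)
      with True show ?thesis by (simp add: tail_term_def min_absorb2 del: of_nat_Suc)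
    next
      case False
      then have "exp (- real (Suc k) * s) \<le> exp (- t)" by (simp del: of_nat_Suc)
      with False show ?thesis by (simp add: tail_term_def min_absorb1 del: of_nat_Suc)
    qed
    have "?c sums (\<Sum>k<nat \<lfloor>t / s\<rfloor>. ?c k)"
    proof (rule sums_finite)
      fix k assume "k \<notin> {..<nat \<lfloor>t / s\<rfloor>}"
      then have "real (Suc k) > t / s" by (auto simp: not_less) linarith
      then show "?c k = 0" using s by (simp add: field_simps)
    qed simp
    also have "(\<Sum>k<nat \<lfloor>t / s\<rfloor>. ?c k) = (\<Sum>k<nat \<lfloor>t / s\<rfloor>. b (Suc k) * H (exp (- t)))"
    proof (rule sum.cong)
      fix k assume "k \<in> {..<nat \<lfloor>t / s\<rfloor>}"
      then have "real (Suc k) \<le> real (nat \<lfloor>t / s\<rfloor>)"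
        by (simp only: lessThan_iff of_nat_le_iff Suc_le_eq)
      also have "\<dots> \<le> t / s"
        using t s by (intro of_nat_floor) auto
      finally have "real (Suc k) \<le> t / s" .
      then show "?c k = b (Suc k) * H (exp (- t))" using s by (simp add: field_simps)
    qed simp
    also have "\<dots> = B (t / s) * H (exp (- t))"
      by (simp add: partial_sum_def sum_distrib_right sum.atLeast1_atMost_eq)
    finally have c: "?c sums (B (t / s) * H (exp (- t)))" .
    have "(\<lambda>k. ?q k - ?c k) sums (suminf ?q - B (t / s) * H (exp (- t)))"
      using y0(2)[OF s] c by (intro sums_diff summable_sums)
    then have "(\<lambda>k. tail_term s t (Suc k)) sums (suminf ?q - B (t / s) * H (exp (- t)))"
      by (simp only: eq)
    then show ?thesis
      unfolding tail_def sums_iff by simp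
  qed
  with y0(1) show ?thesis by blast
qed

lemma scale_at_top: "s \<longlonglongrightarrow> 0 \<Longrightarrow> (\<And>n. s n > 0) \<Longrightarrow> filterlim (\<lambda>n. 1 / s n :: real) at_top sequentially"
  using filterlim_inverse_at_top[of s sequentially] by (simp add: inverse_eq_divide)

lemma tail_limit:
  assumes t: "t > 0" and s: "\<And>n. s n > 0" "s \<longlonglongrightarrow> 0"
  shows "(\<lambda>n. tail (s n) t / B (1 / s n)) \<longlonglongrightarrow> \<Phi> t"
proof -
  obtain D where D: "\<And>u. 0 < u \<Longrightarrow> u < 1 \<Longrightarrow>
      \<bar>if u \<le> exp (- t) then dH u else 0\<bar> \<le> D * (\<bar>ln u\<bar> / (1 - u)\<^sup>2 + 1 / (1 - u))"
    using tail_kernel_bound[OF t] by blast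
  obtain y0 where y0: "\<And>s. s > 0 \<Longrightarrow> 1 / s \<ge> y0 \<Longrightarrow>
    (\<Sum>k. b (Suc k) * H (min (exp (- real (Suc k) * s)) (exp (- t)))) = tail s t + B (t / s) * H (exp (- t))"
    using tail_sums[OF t] by blast
  have top: "filterlim (\<lambda>n. 1 / s n) at_top sequentially"
    using s by (intro scale_at_top)
  have "(\<lambda>n. B (t / s n) / B (1 / s n)) \<longlonglongrightarrow> t powr \<beta>"
    using filterlim_compose[OF B_regular[OF t] top] by simp
  then have "(\<lambda>n. (\<Sum>k. b (Suc k) * H (min (exp (- real (Suc k) * s n)) (exp (- t)))) / B (1 / s n) -
      B (t / s n) / B (1 / s n) * H (exp (- t))) \<longlonglongrightarrow> \<Phi> t"
    unfolding \<Phi>_def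
    by (intro tendsto_diff tendsto_mult tendsto_const
        weighted_kernel_limit(2)[OF D tail_kernel_has_integral[OF t]] s)
  moreover have "\<forall>\<^sub>F n in sequentially. (\<Sum>k. b (Suc k) * H (min (exp (- real (Suc k) * s n)) (exp (- t)))) / B (1 / s n) -
      B (t / s n) / B (1 / s n) * H (exp (- t)) = tail (s n) t / B (1 / s n)"
    using top[unfolded filterlim_at_top, rule_format, of y0]
    by eventually_elim (simp only: y0[OF s(1)] add_divide_distrib, simp)
  ultimately show ?thesis by (simp add: tendsto_cong)
qed

lemma mean_kernel_bound:
  "\<exists>D. \<forall>u. 0 < u \<longrightarrow> u < 1 \<longrightarrow>
    \<bar>- ln u * dH u - h u\<bar> \<le> D * (\<bar>ln u\<bar> / (1 - u)\<^sup>2 + 1 / (1 - u)) \<and>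
    \<bar>h u\<bar> \<le> D * (\<bar>ln u\<bar> / (1 - u)\<^sup>2 + 1 / (1 - u))"
proof -
  obtain D where D: "D > 0" "\<And>u. 0 < u \<Longrightarrow> u < 1 \<Longrightarrow> \<bar>h u\<bar> \<le> D / (1 - u)"
    "\<And>u. 0 < u \<Longrightarrow> u < 1 \<Longrightarrow> \<bar>dH u\<bar> \<le> D / (1 - u)\<^sup>2"
    using growth by blast
  have "\<bar>- ln u * dH u - h u\<bar> \<le> D * (\<bar>ln u\<bar> / (1 - u)\<^sup>2 + 1 / (1 - u))" if u: "0 < u" "u < 1" for u
  proof -
    have "\<bar>- ln u * dH u - h u\<bar> \<le> \<bar>ln u\<bar> * \<bar>dH u\<bar> + \<bar>h u\<bar>"
      by (rule order.trans[OF abs_triangle_ineq4]) (simp add: abs_mult)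
    also have "\<dots> \<le> \<bar>ln u\<bar> * (D / (1 - u)\<^sup>2) + D / (1 - u)"
      using D(2,3)[OF u] by (intro add_mono mult_left_mono) auto
    finally show ?thesis by (simp add: algebra_simps)
  qed
  moreover have "\<bar>h u\<bar> \<le> D * (\<bar>ln u\<bar> / (1 - u)\<^sup>2 + 1 / (1 - u))" if u: "0 < u" "u < 1" for u
  proof -
    have "\<bar>h u\<bar> \<le> D * (0 + 1 / (1 - u))" using D(2)[OF u] by simp
    also have "\<dots> \<le> D * (\<bar>ln u\<bar> / (1 - u)\<^sup>2 + 1 / (1 - u))"
      using D(1) by (intro mult_left_mono add_right_mono divide_nonneg_nonneg abs_ge_zero zero_le_power2) auto
    finally show ?thesis .
  qed
  ultimately show ?thesis by (intro exI[of _ D]) blast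
qed

text \<open>For the end point 0 of the primitive -ln u * H(u): the fundamental theorem needs
  continuity on the closed interval, and H(u) = u h(u) supplies the factor u.\<close>

lemma ln_mult_self_continuous: "continuous_on {0..} (\<lambda>u::real. u * ln u)"
  unfolding continuous_on_def
proof
  fix u :: real assume u: "u \<in> {0..}"
  show "((\<lambda>u. u * ln u) \<longlongrightarrow> u * ln u) (at u within {0..})"
  proof (cases "u = 0")
    case True
    have "((\<lambda>u::real. u * ln u) \<longlongrightarrow> 0) (at_right 0)" by real_asymp
    moreover have "at 0 within {0..} = at_right (0::real)"
      by (rule at_within_nhd[of _ UNIV]) auto
    ultimately show ?thesis using True by simp
  next
    case False
    with u have "isCont (\<lambda>u. u * ln u) u" by (intro continuous_intros) auto
    then show ?thesis by (simp add: isCont_def tendsto_within_subset[of _ _ _ UNIV])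
  qed
qed

lemma mean_kernel_has_integral:
  assumes u: "0 < u" "u < 1"
  shows "((\<lambda>u. - ln u * dH u - h u) has_integral (- ln u * H u)) {0..u}"
proof -
  have "continuous_on {0..u} (\<lambda>u. - (u * ln u) * h u)"
    using u by (intro continuous_intros continuous_on_subset[OF ln_mult_self_continuous]
      continuous_on_subset[OF continuous_on_h]) auto
  then have cont: "continuous_on {0..u} (\<lambda>u. - ln u * H u)"
    by (rule continuous_on_eq) (simp add: H_def)
  have "((\<lambda>u. - ln u * dH u - h u) has_integral ((- ln u * H u) - (- ln 0 * H 0))) {0..u}"
    using u(1)
  proof (intro fundamental_theorem_of_calculus_interior cont)
    fix v assume v: "v \<in> {0<..<u}"
    have "((\<lambda>u. - ln u * H u) has_real_derivative - ln v * dH v - h v) (at v)"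
      by (rule DERIV_cong[OF DERIV_mult[OF DERIV_minus[OF DERIV_ln_divide] DERIV_H]]) (use v u in \<open>auto simp: H_def\<close>)
    then show "((\<lambda>u. - ln u * H u) has_vector_derivative - ln v * dH v - h v) (at v)"
      by (simp add: has_real_derivative_iff_has_vector_derivative)
  qed simp
  then show ?thesis by (simp add: H_0)
qed

lemma h_has_integral:
  assumes u: "0 < u" "u < 1"
  shows "(h has_integral ln (E0 u)) {0..u}"
proof -
  have "((\<lambda>u. ln (E0 u)) has_real_derivative h v) (at v within {0..u})" if "v \<in> {0..u}" for v
  proof -
    have "E0 v \<ge> 1" "\<bar>v\<bar> < 1" using that u by (auto intro!: E0_ge_1)
    then show ?thesis
      using DERIV_E(1)[of v "{0..u}"] unfolding h_def
      by (intro DERIV_cong[OF DERIV_chain2[OF DERIV_ln_divide, of E0]]) (auto intro: has_field_derivative_subset)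
  qed
  then have "(h has_integral (ln (E0 u) - ln (E0 0))) {0..u}"
    using u by (intro fundamental_theorem_of_calculus) (auto simp: has_real_derivative_iff_has_vector_derivative)
  then show ?thesis by (simp add: eval_fps_at_0 f0)
qed

text \<open>At u = exp(-k s) the primitive -ln u * H(u) equals s k H(exp(-k s)): the logarithm
  supplies the factor k.\<close>

lemma M_sums:
  "\<exists>y0\<ge>1. \<forall>s>0. 1 / s \<ge> y0 \<longrightarrow> summable (\<lambda>k. real (Suc k) * (b (Suc k) * H (exp (- real (Suc k) * s))))"
proof -
  obtain D where D: "\<And>u. 0 < u \<Longrightarrow> u < 1 \<Longrightarrow> \<bar>- ln u * dH u - h u\<bar> \<le> D * (\<bar>ln u\<bar> / (1 - u)\<^sup>2 + 1 / (1 - u))"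
    using mean_kernel_bound by blast
  obtain y0 where y0: "y0 \<ge> 1" "\<And>s. s > 0 \<Longrightarrow> 1 / s \<ge> y0 \<Longrightarrow>
      summable (\<lambda>k. b (Suc k) * (- ln (exp (- real (Suc k) * s)) * H (exp (- real (Suc k) * s))))"
    using weighted_kernel_summable[OF D mean_kernel_has_integral] by blast
  have "summable (\<lambda>k. real (Suc k) * (b (Suc k) * H (exp (- real (Suc k) * s))))"
    if s: "s > 0" "1 / s \<ge> y0" for s
  proof -
    have "summable (\<lambda>k. b (Suc k) * (- ln (exp (- real (Suc k) * s)) * H (exp (- real (Suc k) * s))) * (1 / s))"
      using y0(2)[OF s] by (rule summable_mult2)
    also have "(\<lambda>k. b (Suc k) * (- ln (exp (- real (Suc k) * s)) * H (exp (- real (Suc k) * s))) * (1 / s)) =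
        (\<lambda>k. real (Suc k) * (b (Suc k) * H (exp (- real (Suc k) * s))))"
      using s by (simp add: fun_eq_iff del: of_nat_Suc)
    finally show ?thesis .
  qed
  with y0(1) show ?thesis by blast
qed

lemma M_limit:
  assumes s: "\<And>n. s n > 0" "s \<longlonglongrightarrow> 0"
  shows "(\<lambda>n. s n * M (s n) / B (1 / s n)) \<longlonglongrightarrow> \<Omega>"
proof -
  obtain D where D: "\<And>u. 0 < u \<Longrightarrow> u < 1 \<Longrightarrow> \<bar>- ln u * dH u - h u\<bar> \<le> D * (\<bar>ln u\<bar> / (1 - u)\<^sup>2 + 1 / (1 - u))"
    using mean_kernel_bound by blast
  have lim: "(\<lambda>n. (\<Sum>k. b (Suc k) * (- ln (exp (- real (Suc k) * s n)) * H (exp (- real (Suc k) * s n)))) / B (1 / s n)) \<longlonglongrightarrow> \<Omega>"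
    unfolding \<Omega>_def by (rule weighted_kernel_limit(2)[OF D mean_kernel_has_integral s])
  obtain y0 where y0: "\<And>s. s > 0 \<Longrightarrow> 1 / s \<ge> y0 \<Longrightarrow> summable (\<lambda>k. real (Suc k) * (b (Suc k) * H (exp (- real (Suc k) * s))))"
    using M_sums by blast
  have "\<forall>\<^sub>F n in sequentially. (\<Sum>k. b (Suc k) * (- ln (exp (- real (Suc k) * s n)) * H (exp (- real (Suc k) * s n)))) / B (1 / s n)
      = s n * M (s n) / B (1 / s n)"
    using scale_at_top[OF s(2,1), unfolded filterlim_at_top, rule_format, of y0]
  proof eventually_elim
    case (elim n)
    have "(\<lambda>k. b (Suc k) * (- ln (exp (- real (Suc k) * s n)) * H (exp (- real (Suc k) * s n)))) =
        (\<lambda>k. s n * (real (Suc k) * (b (Suc k) * H (exp (- real (Suc k) * s n)))))"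
      by (simp add: fun_eq_iff del: of_nat_Suc)
    then show ?case
      using suminf_mult[OF y0[OF s(1) elim], of "s n"] by (simp add: M_def)
  qed
  with lim show ?thesis by (rule Lim_transform_eventually)
qed

text \<open>A by-product of the limit theorem, applied along s = 1 / (n + 1).\<close>

lemma integrable_kernels:
  "(\<lambda>u. h u * \<bar>ln u\<bar> powr \<beta>) integrable_on {0<..<1}"
  "(\<lambda>u. - ln u * dH u * \<bar>ln u\<bar> powr \<beta>) integrable_on {0<..<1}"
  "t > 0 \<Longrightarrow> (\<lambda>u. (if u \<le> exp (- t) then dH u else 0) * \<bar>ln u\<bar> powr \<beta>) integrable_on {0<..<1}"
proof -
  obtain D where D: "\<And>u. 0 < u \<Longrightarrow> u < 1 \<Longrightarrow> \<bar>- ln u * dH u - h u\<bar> \<le> D * (\<bar>ln u\<bar> / (1 - u)\<^sup>2 + 1 / (1 - u))"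
    "\<And>u. 0 < u \<Longrightarrow> u < 1 \<Longrightarrow> \<bar>h u\<bar> \<le> D * (\<bar>ln u\<bar> / (1 - u)\<^sup>2 + 1 / (1 - u))"
    using mean_kernel_bound by blast
  have s: "1 / real (Suc n) > 0" for n by simp
  have s0: "(\<lambda>n. 1 / real (Suc n)) \<longlonglongrightarrow> 0" by (rule LIMSEQ_Suc[OF lim_1_over_n])
  show *: "(\<lambda>u. h u * \<bar>ln u\<bar> powr \<beta>) integrable_on {0<..<1}"
    by (rule weighted_kernel_limit(1)[OF D(2) h_has_integral s s0])
  have "(\<lambda>u. (- ln u * dH u - h u) * \<bar>ln u\<bar> powr \<beta>) integrable_on {0<..<1}"
    by (rule weighted_kernel_limit(1)[OF D(1) mean_kernel_has_integral s s0])
  from integrable_add[OF this *] show "(\<lambda>u. - ln u * dH u * \<bar>ln u\<bar> powr \<beta>) integrable_on {0<..<1}"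
    by (simp add: algebra_simps)
  assume t: "t > 0"
  obtain D' where D': "\<And>u. 0 < u \<Longrightarrow> u < 1 \<Longrightarrow>
      \<bar>if u \<le> exp (- t) then dH u else 0\<bar> \<le> D' * (\<bar>ln u\<bar> / (1 - u)\<^sup>2 + 1 / (1 - u))"
    using tail_kernel_bound[OF t] by blast
  show "(\<lambda>u. (if u \<le> exp (- t) then dH u else 0) * \<bar>ln u\<bar> powr \<beta>) integrable_on {0<..<1}"
    by (rule weighted_kernel_limit(1)[OF D' tail_kernel_has_integral[OF t] s s0])
qed

end

section \<open>The limit shape\<close>

context shape_model
begin

abbreviation "g \<equiv> \<lambda>u. dH u * \<bar>ln u\<bar> powr \<beta>"

text \<open>Both \<Omega> and the total mass of \<Phi> turn out to be \<beta> J(1).\<close>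

definition J :: "real \<Rightarrow> real" where
  "J v = integral {0..v} (\<lambda>u. h u * \<bar>ln u\<bar> powr \<beta>)"

lemma \<Phi>_alt:
  assumes t: "t > 0"
  shows "g integrable_on {0..exp (- t)}"
    and "\<Phi> t = integral {0..exp (- t)} g - t powr \<beta> * H (exp (- t))"
proof -
  let ?v = "exp (- t)"
  let ?k = "\<lambda>u. (if u \<le> ?v then dH u else 0) * \<bar>ln u\<bar> powr \<beta>"
  have v: "0 < ?v" "?v < 1" using t by auto
  have "(?k has_integral integral {0<..<1} ?k) {0<..<1}"
    using integrable_kernels(3)[OF t] by (rule integrable_integral)
  then have "((\<lambda>u. if u \<in> {0<..?v} then g u else 0) has_integral integral {0<..<1} ?k) {0<..<1}"
    by (rule has_integral_eq[rotated]) auto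
  then have "(g has_integral integral {0<..<1} ?k) {0<..?v}"
  proof (subst (asm) has_integral_restrict)
    show "{0<..?v} \<subseteq> {0<..<1}"
      using v by (intro subsetI; simp only: greaterThanAtMost_iff greaterThanLessThan_iff) linarith
  qed
  then have *: "(g has_integral integral {0<..<1} ?k) {0..?v}"
    by (subst has_integral_spike_set_eq[of _ "{0<..?v}"]) (auto intro: negligible_subset[of "{0}"])
  then show "g integrable_on {0..?v}" by (rule has_integral_integrable)
  from * show "\<Phi> t = integral {0..?v} g - t powr \<beta> * H ?v"
    unfolding \<Phi>_def by (simp add: integral_unique)
qed

lemma tail_summable:
  assumes t: "t > 0"
  shows "\<exists>y0. \<forall>s>0. 1 / s \<ge> y0 \<longrightarrow> summable (\<lambda>k. tail_term s t (Suc k))"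
  by (rule ex_forward[OF tail_sums[OF t]]) simp

text \<open>The formula is a difference and hides the sign; as a limit of scaled tail means it is
  visible.\<close>

lemma \<Phi>_nonneg:
  assumes "t > 0"
  shows "\<Phi> t \<ge> 0"
proof (rule LIMSEQ_le_const)
  show "(\<lambda>n. tail (1 / real (Suc n)) t / B (1 / (1 / real (Suc n)))) \<longlonglongrightarrow> \<Phi> t"
    using assms by (intro tail_limit LIMSEQ_Suc[OF lim_1_over_n]) auto
  obtain y0 where y0: "\<And>s. s > 0 \<Longrightarrow> 1 / s \<ge> y0 \<Longrightarrow> summable (\<lambda>k. tail_term s t (Suc k))"
    using tail_summable[OF assms] by blast
  have "0 \<le> tail (1 / real (Suc n)) t / B (1 / (1 / real (Suc n)))" if "n \<ge> nat \<lceil>y0\<rceil>" for n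
  proof (intro divide_nonneg_nonneg B_nonneg)
    show "0 \<le> tail (1 / real (Suc n)) t"
      unfolding tail_def
    proof (rule suminf_nonneg)
      show "summable (\<lambda>k. tail_term (1 / real (Suc n)) t (Suc k))"
        by (rule y0) (use that in \<open>auto simp: nat_ceiling_le_eq\<close>)
      show "0 \<le> tail_term (1 / real (Suc n)) t (Suc k)" for k
        by (simp add: tail_term_def H_nonneg b_ge_0 del: of_nat_Suc)
    qed
  qed
  then show "\<exists>N. \<forall>n\<ge>N. 0 \<le> tail (1 / real (Suc n)) t / B (1 / (1 / real (Suc n)))" by blast
qed

text \<open>The kernel may be singular at 0, so the integral is split at a point a > 0, from which
  on the integrand is continuous.\<close>

lemma DERIV_integral_from_0:
  fixes k :: "real \<Rightarrow> real"
  assumes int: "\<And>v. 0 < v \<Longrightarrow> v < 1 \<Longrightarrow> k integrable_on {0..v}"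
    and cont: "continuous_on {0<..<1} k" and v: "0 < v" "v < 1"
  shows "((\<lambda>v. integral {0..v} k) has_real_derivative k v) (at v)"
proof -
  define a where "a = v / 2"
  define e where "e = (1 + v) / 2"
  have ae: "0 < a" "a < v" "v < e" "e < 1" using v by (auto simp: a_def e_def)
  have "((\<lambda>x. integral {a..x} k) has_real_derivative k v) (at v within {a..e})"
    using ae by (intro integral_has_real_derivative continuous_on_subset[OF cont]) auto
  then have "((\<lambda>x. integral {a..x} k) has_real_derivative k v) (at v)"
    using ae by (simp add: at_within_Icc_at)
  then have "((\<lambda>x. integral {0..a} k + integral {a..x} k) has_real_derivative k v) (at v)"
    by (intro DERIV_cong[OF DERIV_add[OF DERIV_const]]) auto
  then show ?thesis
  proof (rule has_field_derivative_transform_within_open[of _ _ _ "{a<..<e}"])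
    fix x assume "x \<in> {a<..<e}"
    then show "integral {0..a} k + integral {a..x} k = integral {0..x} k"
      using ae int[of x] by (intro Henstock_Kurzweil_Integration.integral_combine) auto
  qed (use ae in auto)
qed

lemma continuous_on_kernel:
  "continuous_on {0<..<1} k \<Longrightarrow> continuous_on {0<..<1} (\<lambda>u. k u * \<bar>ln u\<bar> powr \<beta>)"
  by (intro continuous_on_mult continuous_on_powr continuous_on_rabs continuous_on_ln
      continuous_on_const continuous_on_id) auto

text \<open>The boundary value of the integral and the derivative of \<open>H\<close> in the product
  produce the same term t^\<beta> dH(exp(-t)) exp(-t) and cancel.\<close>

lemma DERIV_\<Phi>:
  assumes t: "t > 0"
  shows "(\<Phi> has_real_derivative - (\<beta> * t powr (\<beta> - 1) * H (exp (- t)))) (at t)"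
proof -
  have v: "0 < exp (- t)" "exp (- t) < 1" using t by auto
  have int: "g integrable_on {0..v}" if "0 < v" "v < 1" for v
    using \<Phi>_alt(1)[of "- ln v"] that by simp
  have "((\<lambda>v. integral {0..v} g) has_real_derivative g (exp (- t))) (at (exp (- t)))"
    using v by (intro DERIV_integral_from_0 int continuous_on_kernel continuous_on_dH)
  moreover have d_exp: "((\<lambda>t. exp (- t)) has_real_derivative - exp (- t)) (at t)"
    by (auto intro!: derivative_eq_intros)
  ultimately have 1: "((\<lambda>t. integral {0..exp (- t)} g) has_real_derivative g (exp (- t)) * - exp (- t)) (at t)"
    by (rule DERIV_chain2)
  have 2: "((\<lambda>t. H (exp (- t))) has_real_derivative dH (exp (- t)) * - exp (- t)) (at t)"
    using v by (intro DERIV_chain2[OF DERIV_H d_exp])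
  have 3: "((\<lambda>t. t powr \<beta>) has_real_derivative \<beta> * t powr (\<beta> - 1)) (at t)"
    using t by (intro has_real_derivative_powr)
  have "((\<lambda>t. integral {0..exp (- t)} g - t powr \<beta> * H (exp (- t))) has_real_derivative
      - (\<beta> * t powr (\<beta> - 1) * H (exp (- t)))) (at t)"
    by (rule DERIV_cong[OF DERIV_diff[OF 1 DERIV_mult[OF 3 2]]]) (use t in \<open>simp add: mult_ac\<close>)
  then show ?thesis
    by (rule has_field_derivative_transform_within_open[of _ _ _ "{0<..}"]) (use t \<Phi>_alt(2) in auto)
qed

lemma isCont_\<Phi>: "t > 0 \<Longrightarrow> isCont \<Phi> t"
  using DERIV_\<Phi> by (rule DERIV_isCont)

lemma J_integrable: "(\<lambda>u. h u * \<bar>ln u\<bar> powr \<beta>) integrable_on {0..1}"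
  using integrable_kernels(1) by (simp add: integrable_on_Icc_iff_Ioo)

lemma continuous_on_J: "continuous_on {0..1} J"
  unfolding J_def using J_integrable by (rule indefinite_integral_continuous_1)

lemma DERIV_J:
  assumes "t > 0"
  shows "((\<lambda>t. J (exp (- t))) has_real_derivative - (t powr \<beta> * H (exp (- t)))) (at t)"
proof -
  have v: "0 < exp (- t)" "exp (- t) < 1" using assms by auto
  have "(J has_real_derivative h (exp (- t)) * \<bar>ln (exp (- t))\<bar> powr \<beta>) (at (exp (- t)))"
    unfolding J_def using v
    by (intro DERIV_integral_from_0 integrable_on_subinterval[OF J_integrable]
        continuous_on_kernel continuous_on_subset[OF continuous_on_h]) auto
  moreover have "((\<lambda>t. exp (- t)) has_real_derivative - exp (- t)) (at t)"
    by (auto intro!: derivative_eq_intros)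
  ultimately show ?thesis
    by (rule DERIV_cong[OF DERIV_chain2]) (use assms in \<open>simp add: H_def\<close>)
qed

text \<open>The end points matter: at 1 the zero of the logarithm, of order \<beta> + 1, beats the
  singularity of h of order at most 1, and at 0 the factor u of H beats the logarithm. An explicit
  majorant vanishing at both ends shows this.\<close>

lemma ln_powr_mult_H_continuous: "continuous_on {0..1} (\<lambda>u. \<bar>ln u\<bar> powr (\<beta> + 1) * H u)"
proof -
  obtain K where K: "K > 0"
    "\<And>u. 0 < u \<Longrightarrow> u < 1 \<Longrightarrow> \<bar>ln u\<bar> powr (\<beta> + 1) \<le> K * ((1 - u) powr (\<beta> + 1) * u powr (- 1 / 2))"
    using ln_powr_le[of "\<beta> + 1"] \<beta>_pos by auto
  obtain D where D: "D > 0" "\<And>u. 0 < u \<Longrightarrow> u < 1 \<Longrightarrow> \<bar>h u\<bar> \<le> D / (1 - u)"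
    using growth by blast
  let ?Q = "\<lambda>u. \<bar>ln u\<bar> powr (\<beta> + 1) * H u"
  let ?R = "\<lambda>u::real. K * D * ((1 - u) powr \<beta> * sqrt u)"
  have bound: "norm (?Q u) \<le> ?R u" if u: "u \<in> {0..1}" for u
  proof (cases "u = 0 \<or> u = 1")
    case True
    then show ?thesis by (auto simp: H_0)
  next
    case False
    with u have u: "0 < u" "u < 1" by auto
    have "norm (?Q u) = \<bar>ln u\<bar> powr (\<beta> + 1) * (u * \<bar>h u\<bar>)"
      using u by (simp add: H_def abs_mult)
    also have "\<dots> \<le> K * ((1 - u) powr (\<beta> + 1) * u powr (- 1 / 2)) * (u * (D / (1 - u)))"
      using u K D by (intro mult_mono) auto
    also have "\<dots> = ?R u"
    proof -
      have "u powr (- 1 / 2) = inverse (sqrt u)"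
        using u powr_minus[of u "1 / 2"] powr_half_sqrt[of u] by simp
      moreover have "(1 - u) powr (\<beta> + 1) = (1 - u) powr \<beta> * (1 - u)"
        using u by (simp add: powr_add)
      moreover have "inverse (sqrt u) * u = sqrt u"
        using u real_div_sqrt[of u] by (simp add: divide_inverse mult.commute)
      ultimately show ?thesis
        using u by (simp add: mult_ac)
    qed
    finally show ?thesis .
  qed
  have R: "(?R \<longlongrightarrow> ?R u) (at u within {0..1})" if u: "u \<in> {0..1}" for u
    by (intro tendsto_mult tendsto_const tendsto_powr' tendsto_diff tendsto_ident_at tendsto_real_sqrt)
      (use u \<beta>_pos in \<open>auto simp: eventually_at_filter\<close>)
  show ?thesis
    unfolding continuous_on_def
  proof
    fix u :: real assume u: "u \<in> {0..1}"
    show "(?Q \<longlongrightarrow> ?Q u) (at u within {0..1})"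
    proof (cases "u = 0 \<or> u = 1")
      case True
      then have 0: "?R u = 0" "?Q u = 0" by (auto simp: H_0)
      have "(?Q \<longlongrightarrow> 0) (at u within {0..1})"
      proof (rule Lim_null_comparison)
        show "\<forall>\<^sub>F x in at u within {0..1}. norm (?Q x) \<le> ?R x"
          using bound by (auto simp: eventually_at_filter)
        show "(?R \<longlongrightarrow> 0) (at u within {0..1})"
          using R[OF u] unfolding 0 .
      qed
      then show ?thesis unfolding 0 .
    next
      case False
      with u have u: "0 < u" "u < 1" by auto
      have "isCont H u" using DERIV_H[of u UNIV] u by (intro DERIV_isCont) auto
      then have "isCont ?Q u"
        using u by (intro continuous_intros) auto
      then show ?thesis by (simp add: isCont_def tendsto_within_subset[of _ _ _ UNIV])
    qed
  qed
qed

text \<open>Integration by parts: |ln u|^(\<beta> + 1) H(u) vanishes at 0 and 1, so the part of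
  \<Omega> with \<open>dH\<close> equals (\<beta> + 1) J(1), and the part with h takes one J(1)
  away.\<close>

lemma \<Omega>_eq: "\<Omega> = \<beta> * J 1"
proof -
  let ?a = "\<lambda>u. - ln u * dH u * \<bar>ln u\<bar> powr \<beta>" and ?c = "\<lambda>u. h u * \<bar>ln u\<bar> powr \<beta>"
  let ?Q = "\<lambda>u. \<bar>ln u\<bar> powr (\<beta> + 1) * H u"
  have J: "J 1 = integral {0<..<1} ?c"
    by (simp add: J_def integral_open_interval_real)
  have "((\<lambda>u. ?a u - (\<beta> + 1) * ?c u) has_integral (?Q 1 - ?Q 0)) {0..1}"
  proof (rule fundamental_theorem_of_calculus_interior)
    fix u :: real assume "u \<in> {0<..<1}"
    then have u: "0 < u" "u < 1" by auto
    have d: "((\<lambda>u. (- ln u) powr (\<beta> + 1)) has_real_derivative (\<beta> + 1) * (- ln u) powr (\<beta> + 1 - 1) * (- (1 / u))) (at u)"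
      by (rule DERIV_chain2[OF has_real_derivative_powr DERIV_minus[OF DERIV_ln_divide]]) (use u in auto)
    have "((\<lambda>u. (- ln u) powr (\<beta> + 1) * H u) has_real_derivative ?a u - (\<beta> + 1) * ?c u) (at u)"
      by (rule DERIV_cong[OF DERIV_mult[OF d DERIV_H]]) (use u in \<open>auto simp: H_def powr_add field_simps\<close>)
    then have "(?Q has_real_derivative ?a u - (\<beta> + 1) * ?c u) (at u)"
      by (rule has_field_derivative_transform_within_open[of _ _ _ "{0<..<1}"]) (use u in auto)
    then show "(?Q has_vector_derivative ?a u - (\<beta> + 1) * ?c u) (at u)"
      by (simp add: has_real_derivative_iff_has_vector_derivative)
  qed (auto intro: ln_powr_mult_H_continuous)
  then have I1: "((\<lambda>u. ?a u - (\<beta> + 1) * ?c u) has_integral 0) {0<..<1}"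
    by (simp add: H_0 has_integral_Icc_iff_Ioo)
  have I2: "((\<lambda>u. ?a u - (\<beta> + 1) * ?c u) has_integral (integral {0<..<1} ?a - (\<beta> + 1) * integral {0<..<1} ?c)) {0<..<1}"
    by (intro has_integral_diff has_integral_mult_right integrable_integral integrable_kernels)
  have "integral {0<..<1} ?a = (\<beta> + 1) * J 1"
    unfolding J using has_integral_unique[OF I1 I2] by simp
  moreover have "\<Omega> = integral {0<..<1} ?a - integral {0<..<1} ?c"
    unfolding \<Omega>_def left_diff_distrib by (intro integral_diff integrable_kernels)
  ultimately show ?thesis unfolding J by (simp add: algebra_simps)
qed

lemma \<Omega>_pos: "\<Omega> > 0"
proof -
  let ?c = "\<lambda>u. h u * \<bar>ln u\<bar> powr \<beta>"
  have nonneg: "?c u \<ge> 0" if "0 \<le> u" "u \<le> 1" for u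
    using that h_pos[of u] by (cases "u = 1") auto
  \<comment> \<open>Any compact interval inside (0, 1) would do: the integrand is continuous and
    positive there.\<close>
  have cont: "continuous_on {1/4..1/2} ?c"
    by (intro continuous_on_subset[OF continuous_on_kernel[OF continuous_on_subset[OF continuous_on_h]]]) auto
  have int: "?c integrable_on {1/4..1/2}"
    by (intro integrable_on_subinterval[OF J_integrable]) auto
  have "integral {1/4..1/2} ?c \<noteq> 0"
  proof
    assume "integral {1/4..1/2} ?c = 0"
    with int have "(?c has_integral 0) (cbox (1/4) (1/2))"
      by (metis integrable_integral interval_cbox)
    then have "?c (1/2) = 0"
    proof (rule has_integral_0_cbox_imp_0[rotated 2])
      show "0 \<le> ?c x" if "x \<in> box (1/4) (1/2)" for x
        using that by (intro nonneg) auto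
    qed (use cont in auto)
    then show False using h_pos[of "1/2"] by simp
  qed
  moreover have "integral {1/4..1/2} ?c \<ge> 0"
    by (intro Henstock_Kurzweil_Integration.integral_nonneg int nonneg) auto
  moreover have "integral {1/4..1/2} ?c \<le> J 1"
    unfolding J_def by (intro integral_subset_le int J_integrable ballI nonneg) auto
  ultimately have "J 1 > 0" by linarith
  then show ?thesis using \<beta>_pos by (simp add: \<Omega>_eq)
qed

text \<open>On the support u \<le> exp(-t) of the kernel one has t \<le> -ln u, so t times the
  kernel has the integrable majorant -ln u dH(u) |ln u|^\<beta>, independent of t. Dominated
  convergence then serves both ends of the half line.\<close>

lemma t_\<Phi>_tendsto_0:
  assumes T: "\<And>n. T n > 0" and lim: "T \<longlonglongrightarrow> 0 \<or> filterlim T at_top sequentially"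
  shows "(\<lambda>n. T n * \<Phi> (T n)) \<longlonglongrightarrow> (0::real)"
proof -
  let ?k = "\<lambda>n u. T n * ((if u \<le> exp (- T n) then dH u else 0) * \<bar>ln u\<bar> powr \<beta>)"
  have int: "?k n integrable_on {0<..<1}" for n
    by (intro integrable_on_mult_right integrable_kernels T)
  have bound: "norm (?k n u) \<le> - ln u * dH u * \<bar>ln u\<bar> powr \<beta>" if u: "u \<in> {0<..<1}" for n u
  proof (cases "u \<le> exp (- T n)")
    case True
    then have "T n \<le> - ln u" using u by (metis exp_ln exp_le_cancel_iff greaterThanLessThan_iff le_minus_iff)
    then have "T n * (dH u * \<bar>ln u\<bar> powr \<beta>) \<le> - ln u * (dH u * \<bar>ln u\<bar> powr \<beta>)"
      using u dH_nonneg[of u] by (intro mult_right_mono) auto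
    then show ?thesis using True u dH_nonneg[of u] T[of n] by (simp add: abs_mult)
  next
    case False
    have "0 \<le> - ln u * dH u * \<bar>ln u\<bar> powr \<beta>"
      using u dH_nonneg[of u] by (intro mult_nonneg_nonneg) auto
    with False show ?thesis by simp
  qed
  have pw: "(\<lambda>n. ?k n u) \<longlonglongrightarrow> 0" if u: "u \<in> {0<..<1}" for u
    using lim
  proof
    assume T0: "T \<longlonglongrightarrow> 0"
    show ?thesis
    proof (rule Lim_null_comparison)
      show "\<forall>\<^sub>F n in sequentially. norm (?k n u) \<le> T n * (\<bar>dH u\<bar> * \<bar>ln u\<bar> powr \<beta>)"
      proof (intro always_eventually allI)
        fix n
        have "norm (?k n u) = T n * (\<bar>if u \<le> exp (- T n) then dH u else 0\<bar> * \<bar>ln u\<bar> powr \<beta>)"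
          using T[of n] by (simp add: abs_mult)
        also have "\<dots> \<le> T n * (\<bar>dH u\<bar> * \<bar>ln u\<bar> powr \<beta>)"
          using T[of n] by (intro mult_left_mono mult_right_mono) auto
        finally show "norm (?k n u) \<le> T n * (\<bar>dH u\<bar> * \<bar>ln u\<bar> powr \<beta>)" .
      qed
      show "(\<lambda>n. T n * (\<bar>dH u\<bar> * \<bar>ln u\<bar> powr \<beta>)) \<longlonglongrightarrow> 0"
        using tendsto_mult[OF T0 tendsto_const] by simp
    qed
  next
    assume "filterlim T at_top sequentially"
    then have "\<forall>\<^sub>F n in sequentially. T n > - ln u"
      by (simp add: filterlim_at_top_dense)
    then have "\<forall>\<^sub>F n in sequentially. ?k n u = 0"
    proof eventually_elim
      case (elim n)
      then have "ln u > - T n" by simp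
      then have "u > exp (- T n)" using u by (metis exp_less_cancel_iff exp_ln greaterThanLessThan_iff)
      then show ?case by simp
    qed
    then show ?thesis by (rule tendsto_eventually)
  qed
  have lim0: "(\<lambda>n. integral {0<..<1} (?k n)) \<longlonglongrightarrow> integral {0<..<1} (\<lambda>u::real. 0)"
    by (rule dominated_convergence(2)[OF int integrable_kernels(2) bound pw])
  show ?thesis
  proof (rule tendsto_sandwich)
    show "\<forall>\<^sub>F n in sequentially. 0 \<le> T n * \<Phi> (T n)"
      using T \<Phi>_nonneg by (auto intro!: always_eventually mult_nonneg_nonneg simp: less_imp_le)
    show "\<forall>\<^sub>F n in sequentially. T n * \<Phi> (T n) \<le> integral {0<..<1} (?k n)"
    proof (intro always_eventually allI)
      fix n
      have "\<Phi> (T n) \<le> integral {0<..<1} (\<lambda>u. (if u \<le> exp (- T n) then dH u else 0) * \<bar>ln u\<bar> powr \<beta>)"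
        unfolding \<Phi>_def using T[of n] by (simp add: H_nonneg)
      then have "T n * \<Phi> (T n) \<le> T n * integral {0<..<1} (\<lambda>u. (if u \<le> exp (- T n) then dH u else 0) * \<bar>ln u\<bar> powr \<beta>)"
        using T[of n] by (intro mult_left_mono) auto
      then show "T n * \<Phi> (T n) \<le> integral {0<..<1} (?k n)"
        by simp
    qed
    show "(\<lambda>n. integral {0<..<1} (?k n)) \<longlonglongrightarrow> 0" using lim0 by simp
  qed simp
qed

text \<open>By \<open>DERIV_\<Phi>\<close> and \<open>DERIV_J\<close>, t \<Phi>(t) - \<beta>
  J(exp(-t)) is a primitive; t \<Phi>(t) vanishes at both ends, and \<beta> J(1) = \<Omega>
  remains.\<close>

lemma \<Phi>_has_integral: "(\<Phi> has_integral \<Omega>) {0<..}"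
proof -
  let ?F = "\<lambda>t. t * \<Phi> t - \<beta> * J (exp (- t))"
  have d: "(?F has_real_derivative \<Phi> t) (at t)" if t: "t > 0" for t
  proof -
    have p: "t * t powr (\<beta> - 1) = t powr \<beta>"
      using t by (simp add: powr_diff)
    have "t * - (\<beta> * t powr (\<beta> - 1) * H (exp (- t))) = - (\<beta> * (t * t powr (\<beta> - 1)) * H (exp (- t)))"
      by simp
    with p have "1 * \<Phi> t + - (\<beta> * t powr (\<beta> - 1) * H (exp (- t))) * t - \<beta> * - (t powr \<beta> * H (exp (- t))) = \<Phi> t"
      by (simp add: mult_ac)
    then show ?thesis
      using t by (intro DERIV_cong[OF DERIV_diff[OF DERIV_mult[OF DERIV_ident DERIV_\<Phi>] DERIV_cmult[OF DERIV_J]]])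
  qed
  have J_lim: "((\<lambda>v. J v) \<longlongrightarrow> J v) (at v within {0..1})" if "v \<in> {0..1}" for v
    using continuous_on_J that by (simp add: continuous_on_def)
  have lim0: "(?F \<longlongrightarrow> 0 - \<beta> * J 1) (at_right 0)"
  proof (intro tendsto_diff tendsto_mult tendsto_const)
    show "((\<lambda>t. t * \<Phi> t) \<longlongrightarrow> 0) (at_right 0)"
      by (rule tendsto_at_right_sequentially[of _ 1]) (auto intro: t_\<Phi>_tendsto_0)
    show "((\<lambda>t. J (exp (- t))) \<longlongrightarrow> J 1) (at_right 0)"
    proof (rule filterlim_compose[OF J_lim])
      have "((\<lambda>t. exp (- t)) \<longlongrightarrow> (1::real)) (at_right 0)" by real_asymp
      then show "filterlim (\<lambda>t. exp (- t)) (at 1 within {0..1}) (at_right (0::real))"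
        by (auto simp: filterlim_at eventually_at_filter)
    qed auto
  qed
  have lim1: "(?F \<longlongrightarrow> 0 - \<beta> * J 0) at_top"
  proof (intro tendsto_diff tendsto_mult tendsto_const)
    show "((\<lambda>t. t * \<Phi> t) \<longlongrightarrow> 0) at_top"
    proof (rule tendsto_at_topI_sequentially)
      fix X :: "nat \<Rightarrow> real" assume X: "filterlim X at_top sequentially"
      \<comment> \<open>\<open>t_\<Phi>_tendsto_0\<close> wants every member of the sequence
        positive, not only almost all.\<close>
      define Y where "Y n = max (X n) 1" for n
      have ev: "\<forall>\<^sub>F n in sequentially. X n = Y n"
        using X[unfolded filterlim_at_top, rule_format, of 1] by eventually_elim (simp add: Y_def)
      have "filterlim Y at_top sequentially"
        by (rule filterlim_cong[THEN iffD1, OF refl refl ev X])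
      then have "(\<lambda>n. Y n * \<Phi> (Y n)) \<longlonglongrightarrow> 0"
      proof (intro t_\<Phi>_tendsto_0 disjI2)
        show "Y n > 0" for n by (simp add: Y_def less_max_iff_disj)
      qed
      then show "(\<lambda>n. X n * \<Phi> (X n)) \<longlonglongrightarrow> 0"
        by (rule Lim_transform_eventually) (use ev in \<open>auto elim: eventually_mono\<close>)
    qed
    show "((\<lambda>t. J (exp (- t))) \<longlongrightarrow> J 0) at_top"
    proof (rule filterlim_compose[OF J_lim])
      have "((\<lambda>t. exp (- t)) \<longlongrightarrow> (0::real)) at_top" by real_asymp
      then show "filterlim (\<lambda>t. exp (- t)) (at 0 within {0..1}) (at_top :: real filter)"
        using eventually_ge_at_top[of 0] by (auto simp: filterlim_at elim: eventually_mono)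
    qed auto
  qed
  have J0: "J 0 = 0" by (simp add: J_def)
  have A: "((?F \<circ> real_of_ereal) \<longlongrightarrow> - \<Omega>) (at_right (0::ereal))"
    using lim0 by (simp add: \<Omega>_eq zero_ereal_def ereal_tendsto_simps1)
  have Bt: "((?F \<circ> real_of_ereal) \<longlongrightarrow> 0) (at_left (\<infinity>::ereal))"
    using lim1 by (simp add: J0 ereal_tendsto_simps1)
  note FTC = interval_integral_FTC_nonneg[of 0 \<infinity> ?F \<Phi>, OF _ _ _ _ A Bt]
  have E: "einterval 0 \<infinity> = {0<..}" by (auto simp: einterval_def)
  have 1: "set_integrable lborel (einterval 0 \<infinity>) \<Phi>"
    by (rule FTC) (auto intro!: d isCont_\<Phi> \<Phi>_nonneg)
  have "(LBINT t=0..\<infinity>. \<Phi> t) = 0 - (- \<Omega>)"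
    by (rule FTC) (auto intro!: d isCont_\<Phi> \<Phi>_nonneg)
  then have 2: "(LINT t:{0<..}|lborel. \<Phi> t) = \<Omega>"
    by (simp add: interval_lebesgue_integral_def E)
  from set_borel_integral_eq_integral[OF 1[unfolded E]] 2 show ?thesis
    by (metis integrable_integral)
qed

section \<open>Agreement with the closed formulas and admissibility as a limit shape\<close>

lemma shape_const_eq: "shape_const f \<beta> = \<Omega>"
proof -
  have "shape_const f \<beta> = integral {0<..<1} (\<lambda>u. \<bar>ln u\<bar> powr (\<beta> + 1) * (log_deriv f u + u * deriv (log_deriv f) u) -
      \<bar>ln u\<bar> powr \<beta> * log_deriv f u)"
    unfolding shape_const_def Let_def by (rule integral_open_interval_real)
  also have "\<dots> = \<Omega>"
    unfolding \<Omega>_def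
    by (intro Henstock_Kurzweil_Integration.integral_cong) (auto simp: dH_def log_deriv_eq powr_add algebra_simps)
  finally show ?thesis .
qed

lemma limit_shape_eq: "t > 0 \<Longrightarrow> limit_shape f \<beta> t = \<Phi> t / \<Omega>"
  unfolding limit_shape_def Let_def shape_const_eq
  by (simp add: \<Phi>_alt(2) dH_def[symmetric] log_deriv_eq H_def mult_ac)

lemma limit_shape_nonneg:
  assumes "t \<ge> 0"
  shows "limit_shape f \<beta> t \<ge> 0"
proof (cases "t = 0")
  case True
  have nonneg: "(log_deriv f u + u * deriv (log_deriv f) u) * \<bar>ln u\<bar> powr \<beta> \<ge> 0" if "u \<in> {0..1}" for u
  proof (cases "u = 0 \<or> u = 1")
    case False
    then show ?thesis
      using that dH_nonneg[of u] by (simp add: dH_def[symmetric])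
  qed auto
  have "integral {0..1} (\<lambda>u. (log_deriv f u + u * deriv (log_deriv f) u) * \<bar>ln u\<bar> powr \<beta>) \<ge> 0"
  \<comment> \<open>With a pole and \<beta> \<le> 1 the integral up to 1 diverges;
    \<open>integral\<close> is then 0 by convention, and the value at t = 0 is still
    nonnegative.\<close>
  proof (cases "(\<lambda>u. (log_deriv f u + u * deriv (log_deriv f) u) * \<bar>ln u\<bar> powr \<beta>) integrable_on {0..1}")
    case True
    then show ?thesis
      by (rule Henstock_Kurzweil_Integration.integral_nonneg) (rule nonneg)
  qed (simp add: not_integrable_integral)
  then show ?thesis
    using True \<Omega>_pos by (simp add: limit_shape_def Let_def shape_const_eq)
next
  case False
  with assms show ?thesis
    using \<Phi>_nonneg[of t] \<Omega>_pos by (simp add: limit_shape_eq)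
qed

lemma isCont_limit_shape:
  assumes "t > 0"
  shows "isCont (limit_shape f \<beta>) t"
proof -
  have "isCont (\<lambda>t. \<Phi> t / \<Omega>) t"
    using isCont_\<Phi>[OF assms] \<Omega>_pos by (intro continuous_intros) auto
  moreover have "\<forall>\<^sub>F s in nhds t. limit_shape f \<beta> s = \<Phi> s / \<Omega>"
    using eventually_nhds_in_open[of "{0<..}" t] assms
    by (auto elim!: eventually_mono simp: limit_shape_eq)
  ultimately show ?thesis by (simp add: isCont_cong)
qed

lemma piecewise_continuous_limit_shape: "piecewise_continuous_half_line (limit_shape f \<beta>)"
proof -
  have "{t \<in> {0<..c}. \<not> isCont (limit_shape f \<beta>) t} = {}" for c
    using isCont_limit_shape by auto
  moreover have "(limit_shape f \<beta> \<longlongrightarrow> limit_shape f \<beta> t) (at t within S)" if "t > 0" for t S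
    using isCont_limit_shape[OF that] by (auto simp: isCont_def intro: tendsto_within_subset)
  ultimately show ?thesis
    unfolding piecewise_continuous_half_line_def by (metis finite.emptyI)
qed

lemma limit_shape_has_integral: "(limit_shape f \<beta> has_integral 1) {0..}"
proof -
  have "((\<lambda>t. \<Phi> t * (1 / \<Omega>)) has_integral \<Omega> * (1 / \<Omega>)) {0<..}"
    by (intro has_integral_mult_left \<Phi>_has_integral)
  then have "(limit_shape f \<beta> has_integral \<Omega> * (1 / \<Omega>)) {0<..}"
    by (rule has_integral_eq[rotated]) (auto simp: limit_shape_eq)
  then have "(limit_shape f \<beta> has_integral 1) {0<..}"
    using \<Omega>_pos by simp
  then show ?thesis
    by (subst has_integral_spike_set_eq[of _ "{0<..}"]) (auto intro: negligible_subset[of "{0}"])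
qed

end

section \<open>Exponential moments\<close>

locale ergodic_model = pm: partition_model f b + shape_model b \<beta> f m c C
  for f :: "real fps" and b :: "nat \<Rightarrow> real" and \<beta> :: real and m :: nat and c C :: real
begin

lemma tilt_mean_eq: "pm.tilt_mean = H"
  by (simp add: pm.tilt_mean_def H_def h_def fun_eq_iff)

text \<open>Convexity of \<open>\<theta> \<mapsto> ln f(y e\<^sup>\<theta>)\<close>, whose derivative is \<open>H(y e\<^sup>\<theta>)\<close>.\<close>

lemma ln_E0_diff_le:
  assumes y: "0 < y" "y < 1" "y * exp \<theta> < 1"
  shows "ln (E0 (y * exp \<theta>)) - ln (E0 y) \<le> \<theta> * H (y * exp \<theta>)"
proof -
  let ?w = "\<lambda>\<tau>. ln (E0 (y * exp \<tau>))"
  have d: "(?w has_real_derivative H (y * exp \<tau>)) (at \<tau>)" if "y * exp \<tau> < 1" for \<tau>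
  proof -
    have pos: "0 < y * exp \<tau>" using y by simp
    have "((\<lambda>\<tau>. E0 (y * exp \<tau>)) has_real_derivative E1 (y * exp \<tau>) * (y * exp \<tau>)) (at \<tau>)"
      using pos that by (intro DERIV_chain2[OF DERIV_E(1)]) (auto intro!: derivative_eq_intros)
    moreover have "E0 (y * exp \<tau>) > 0"
      using E0_ge_1[of "y * exp \<tau>"] pos that by simp
    ultimately have "(?w has_real_derivative 1 / E0 (y * exp \<tau>) * (E1 (y * exp \<tau>) * (y * exp \<tau>))) (at \<tau>)"
      by (intro DERIV_chain2[OF DERIV_ln_divide])
    then show ?thesis by (simp add: H_def h_def mult_ac)
  qed
  consider "\<theta> = 0" | "\<theta> > 0" | "\<theta> < 0" by linarith
  then show ?thesis
  proof cases
    case 2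
    have lt: "y * exp \<tau> < 1" if "\<tau> \<le> \<theta>" for \<tau>
    proof -
      have "y * exp \<tau> \<le> y * exp \<theta>" using that y by (intro mult_left_mono) auto
      with y show ?thesis by linarith
    qed
    obtain z where z: "0 < z" "z < \<theta>" "?w \<theta> - ?w 0 = (\<theta> - 0) * H (y * exp z)"
      using MVT2[of 0 \<theta> ?w "\<lambda>\<tau>. H (y * exp \<tau>)"] 2 d lt by auto
    have "H (y * exp z) \<le> H (y * exp \<theta>)"
      using z y by (intro H_mono mult_left_mono) auto
    then show ?thesis using z 2 by (simp add: mult_left_mono)
  next
    case 3
    have lt: "y * exp \<tau> < 1" if "\<tau> \<le> 0" for \<tau>
    proof -
      have "y * exp \<tau> \<le> y * 1" using that y by (intro mult_left_mono) auto
      with y show ?thesis by linarith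
    qed
    obtain z where z: "\<theta> < z" "z < 0" "?w 0 - ?w \<theta> = (0 - \<theta>) * H (y * exp z)"
      using MVT2[of \<theta> 0 ?w "\<lambda>\<tau>. H (y * exp \<tau>)"] 3 d lt by auto
    have "H (y * exp \<theta>) \<le> H (y * exp z)"
      using z y lt[of z] by (intro H_mono mult_left_mono) auto
    then have "(0 - \<theta>) * H (y * exp \<theta>) \<le> (0 - \<theta>) * H (y * exp z)"
      using 3 by (intro mult_left_mono) auto
    with z(3) show ?thesis by simp
  qed simp
qed

text \<open>Multiplying coefficient j of factor k by exp(\<theta> j) for k > T gives p the extra
  weight exp(\<theta> \<open>parts_above p T\<close>). The tilted factors again form an Euler
  product with nonnegative coefficients, and its single term at n is at most its value at x.\<close>

lemma exp_moment_le:
  assumes x: "0 < x" "x < 1" and \<theta>: "\<And>k. k \<ge> 1 \<Longrightarrow> real k > T \<Longrightarrow> x ^ k * exp \<theta> < 1" and nK: "n \<le> K"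
  shows "(\<Sum>p\<in>partitions_of n. weight f b p * exp (\<theta> * parts_above p T)) * x ^ n \<le>
    (\<Prod>k=1..K. E0 (x ^ k * (if real k > T then exp \<theta> else 1)) powr b k)"
proof -
  define e where "e k = (if real k > T then exp \<theta> else 1)" for k :: nat
  define Q where "Q k = Abs_fps (\<lambda>j. fps_nth (pm.P k) j * e k ^ j)" for k
  have Q: "nonneg_sums (Q k) (x ^ k) (E0 (x ^ k * e k) powr b k)" if k: "k \<ge> 1" for k
  proof -
    have "x ^ k < 1" using x k by (intro pm.power_less_1) auto
    then have "nonneg_sums (pm.P k) (x ^ k * e k) (E0 (x ^ k * e k) powr b k)"
      using x k \<theta>[OF k] by (intro pm.nonneg_sums_P) (auto simp: e_def)
    then show ?thesis
      by (simp add: nonneg_sums_def Q_def e_def power_mult_distrib mult_ac)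
  qed
  have Q0: "fps_nth (Q k) 0 = 1" for k by (simp add: Q_def)
  have gp: "nonneg_sums (gen_partial Q K) x (\<Prod>k=1..K. E0 (x ^ k * e k) powr b k)"
    using x by (intro nonneg_sums_gen_partial Q) auto
  have weight: "weight_of Q p = weight f b p * exp (\<theta> * parts_above p T)" for p
  proof -
    have "weight_of Q p = weight f b p * (\<Prod>k\<in>set_mset p. e k ^ count p k)"
      by (simp add: weight_of_def weight_def Q_def prod.distrib)
    also have "(\<Prod>k\<in>set_mset p. e k ^ count p k) = (\<Prod>k\<in>{k\<in>set_mset p. real k > T}. exp (\<theta> * real (count p k)))"
      by (subst prod.inter_filter) (auto simp: e_def exp_of_nat2_mult intro!: prod.cong)
    also have "\<dots> = exp (\<theta> * parts_above p T)"
      by (simp add: parts_above_def sum_distrib_left exp_sum)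
    finally show ?thesis .
  qed
  have "(\<Sum>p\<in>partitions_of n. weight f b p * exp (\<theta> * parts_above p T)) * x ^ n = fps_nth (gen_partial Q K) n * x ^ n"
    using nK by (simp add: fps_nth_gen_partial Q0 weight partitions_upto_self)
  also have "\<dots> = (\<Sum>j\<in>{n}. fps_nth (gen_partial Q K) j * x ^ j)" by simp
  also have "\<dots> \<le> (\<Prod>k=1..K. E0 (x ^ k * e k) powr b k)"
    using gp x sum_le_suminf[of "\<lambda>j. fps_nth (gen_partial Q K) j * x ^ j" "{n}"]
    unfolding nonneg_sums_def sums_iff by auto
  finally show ?thesis by (simp add: e_def)
qed

text \<open>\<open>\<theta>\<close> may have either sign: \<open>\<theta> d\<^sub>k\<close> bounds the growth of the logarithmic moment
  generating function of \<open>R\<^sub>k\<close> between 0 and \<open>\<theta>\<close>.\<close>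

lemma chernoff:
  assumes x: "0 < x" "x < 1" and summable_gen_fun: "summable (\<lambda>j. fps_nth (gen_fun f b) j * x ^ j)"
    and \<theta>: "\<And>k. k \<ge> 1 \<Longrightarrow> real k > T \<Longrightarrow> x ^ k * exp \<theta> < 1"
    and d: "\<And>k. k \<ge> 1 \<Longrightarrow> (if real k > T then \<theta> * (b k * H (x ^ k * exp \<theta>)) else 0) \<le> \<theta> * d k"
    and d_sums: "(\<lambda>k. d (Suc k)) sums D"
    and X: "X \<subseteq> partitions_of n" "\<And>p. p \<in> X \<Longrightarrow> a \<le> \<theta> * parts_above p T"
  shows "measure (small_canonical f b n) X * measure (grand_canonical f b x) (partitions_of n) \<le> exp (\<theta> * D - a)"
proof (rule LIMSEQ_le_const)
  have "(\<lambda>K. \<Sum>k=1..K. d k) \<longlonglongrightarrow> D"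
    using d_sums by (simp only: sums_def One_nat_def sum.atLeast1_atMost_eq)
  then show "(\<lambda>K. exp (\<theta> * (\<Sum>k=1..K. d k) - a)) \<longlonglongrightarrow> exp (\<theta> * D - a)"
    by (intro tendsto_intros)
  let ?F = "pm.F x" and ?a = "fps_nth (gen_fun f b) n"
  have F_pos: "?F > 0" using pm.F_pos x summable_gen_fun by blast
  have "measure (small_canonical f b n) X * measure (grand_canonical f b x) (partitions_of n) \<le>
      exp (\<theta> * (\<Sum>k=1..K. d k) - a)" if K: "K \<ge> n" for K
  proof -
    let ?u = "\<lambda>k. E0 (x ^ k) powr b k" and ?v = "\<lambda>k. E0 (x ^ k * (if real k > T then exp \<theta> else 1)) powr b k"
    \<comment> \<open>Convexity of ln f(y exp(\<theta>)) bounds the effect of the tilt by the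
      derivative at the tilted end, which d controls for either sign of \<theta>.\<close>
    have ratio: "?v k \<le> ?u k * exp (\<theta> * d k)" if k: "k \<in> {1..K}" for k
    proof -
      have xk: "0 < x ^ k" "x ^ k < 1" using x k pm.power_less_1[of x k] by auto
      show ?thesis
      proof (cases "real k > T")
        case True
        let ?y = "x ^ k * exp \<theta>"
        have y: "0 < ?y" "?y < 1" using xk \<theta>[of k] True k by auto
        have E: "E0 ?y \<ge> 1" "E0 (x ^ k) \<ge> 1" using xk y by (auto intro!: E0_ge_1)
        have "b k * (ln (E0 ?y) - ln (E0 (x ^ k))) \<le> b k * (\<theta> * H ?y)"
          using k xk y by (intro mult_left_mono ln_E0_diff_le b_ge_0) auto
        also have "\<dots> \<le> \<theta> * d k" using d[of k] True k by (simp add: mult_ac)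
        finally have "exp (b k * ln (E0 ?y)) \<le> exp (b k * ln (E0 (x ^ k)) + \<theta> * d k)"
          by (simp add: algebra_simps)
        then show ?thesis using E True by (simp add: powr_def exp_add)
      next
        case False
        then have "0 \<le> \<theta> * d k" using d[of k] k by auto
        then have "?u k * 1 \<le> ?u k * exp (\<theta> * d k)" by (intro mult_left_mono) auto
        with False show ?thesis by simp
      qed
    qed
    have sum_nonneg: "0 \<le> (\<Sum>p\<in>X. weight f b p)"
      using X(1) pm.partitions_of_subset by (intro sum_nonneg pm.weight_nonneg) auto
    have fin: "finite X" using X(1) finite_partitions_of finite_subset by blast
    have "exp a * (\<Sum>p\<in>X. weight f b p) * x ^ n \<le> (\<Sum>p\<in>X. weight f b p * exp (\<theta> * parts_above p T)) * x ^ n"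
      unfolding sum_distrib_left using x X pm.partitions_of_subset
      by (subst mult.commute[of "exp a"]) (intro mult_right_mono sum_mono mult_left_mono pm.weight_nonneg, auto)
    also have "\<dots> \<le> (\<Sum>p\<in>partitions_of n. weight f b p * exp (\<theta> * parts_above p T)) * x ^ n"
      using x X(1) pm.partitions_of_subset finite_partitions_of
      by (intro mult_right_mono sum_mono2 mult_nonneg_nonneg pm.weight_nonneg) auto
    also have "\<dots> \<le> (\<Prod>k=1..K. ?v k)"
      by (rule exp_moment_le[OF x \<theta> K])
    also have "\<dots> \<le> (\<Prod>k=1..K. ?u k * exp (\<theta> * d k))"
      by (intro prod_mono conjI ratio) auto
    also have "\<dots> = (\<Prod>k=1..K. ?u k) * exp (\<theta> * (\<Sum>k=1..K. d k))"
      by (simp add: prod.distrib sum_distrib_left exp_sum)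
    also have "\<dots> \<le> ?F * exp (\<theta> * (\<Sum>k=1..K. d k))"
      using pm.partial_le_F[OF x summable_gen_fun] by (intro mult_right_mono) auto
    finally have "exp a * ((\<Sum>p\<in>X. weight f b p) * x ^ n / ?F) \<le> exp (\<theta> * (\<Sum>k=1..K. d k))"
      using F_pos by (simp add: field_simps)
    moreover have "measure (small_canonical f b n) X * measure (grand_canonical f b x) (partitions_of n) =
        (\<Sum>p\<in>X. weight f b p) * x ^ n / ?F"
      using pm.measure_small_canonical[OF X(1)] pm.measure_grand_canonical[OF x summable_gen_fun] pm.gen_fun_pos[of n]
      by simp
    ultimately show ?thesis by (simp add: exp_diff field_simps)
  qed
  then show "\<exists>N. \<forall>K\<ge>N. measure (small_canonical f b n) X * measure (grand_canonical f b x) (partitions_of n) \<le>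
      exp (\<theta> * (\<Sum>k=1..K. d k) - a)" by blast
qed

text \<open>Monotonicity makes the equation M(\<sigma>_n) = n usable for comparisons: an order
  between values of M decides the order of the arguments.\<close>

lemma summable_M_mono:
  assumes "summable (\<lambda>k. real (Suc k) * (b (Suc k) * H (exp (- real (Suc k) * s))))" "0 < s" "s \<le> r"
  shows "summable (\<lambda>k. real (Suc k) * (b (Suc k) * H (exp (- real (Suc k) * r))))" "M r \<le> M s"
proof -
  have le: "real (Suc k) * (b (Suc k) * H (exp (- real (Suc k) * r))) \<le> real (Suc k) * (b (Suc k) * H (exp (- real (Suc k) * s)))" for k
  proof (intro mult_left_mono H_mono b_ge_0)
    show "exp (- real (Suc k) * r) \<le> exp (- real (Suc k) * s)"
      using assms by (simp add: mult_left_mono del: of_nat_Suc)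
    show "exp (- real (Suc k) * s) < 1" using assms by (simp del: of_nat_Suc)
  qed auto
  have nonneg: "0 \<le> real (Suc k) * (b (Suc k) * H (exp (- real (Suc k) * r)))" for k
    using assms by (intro mult_nonneg_nonneg b_ge_0 H_nonneg) (auto simp del: of_nat_Suc)
  show *: "summable (\<lambda>k. real (Suc k) * (b (Suc k) * H (exp (- real (Suc k) * r))))"
    by (rule summable_comparison_test'[OF assms(1)]) (use le nonneg in \<open>simp del: of_nat_Suc\<close>)
  show "M r \<le> M s" unfolding M_def by (rule suminf_le[OF le * assms(1)])
qed

end

section \<open>Concentration and scaling\<close>

lemma sum_UN_le:
  fixes w :: "'a \<Rightarrow> real"
  assumes "finite T" "\<And>t. t \<in> T \<Longrightarrow> finite (A t)" "\<And>p t. t \<in> T \<Longrightarrow> p \<in> A t \<Longrightarrow> 0 \<le> w p"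
  shows "(\<Sum>p\<in>(\<Union>t\<in>T. A t). w p) \<le> (\<Sum>t\<in>T. \<Sum>p\<in>A t. w p)"
  using assms
proof (induction T rule: finite_induct)
  case (insert t T)
  have "(\<Sum>p\<in>(\<Union>t\<in>insert t T. A t). w p) =
      sum w (A t) + sum w (\<Union>t\<in>T. A t) - sum w (A t \<inter> (\<Union>t\<in>T. A t))"
    using insert by (simp add: sum_Un)
  also have "0 \<le> sum w (A t \<inter> (\<Union>t\<in>T. A t))"
    using insert.prems(2) by (intro sum_nonneg) auto
  then have "sum w (A t) + sum w (\<Union>t\<in>T. A t) - sum w (A t \<inter> (\<Union>t\<in>T. A t)) \<le>
      sum w (A t) + sum w (\<Union>t\<in>T. A t)" by simp
  also have "sum w (\<Union>t\<in>T. A t) \<le> (\<Sum>t\<in>T. \<Sum>p\<in>A t. w p)"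
    by (rule insert.IH) (use insert.prems in blast)+
  finally show ?case using insert by simp
qed simp

text \<open>A sequence that varies regularly with index p, extended as a step function, has a slowly
  varying denominator once the power x^p is split off.\<close>

lemma slowly_varying_quotient:
  fixes a :: "nat \<Rightarrow> real"
  assumes p: "\<And>y. y > 0 \<Longrightarrow> ((\<lambda>x. a (nat \<lfloor>x * y\<rfloor>) / a (nat \<lfloor>x\<rfloor>)) \<longlongrightarrow> y powr p) at_top"
  shows "slowly_varying (\<lambda>x. x powr p / a (nat \<lfloor>x\<rfloor>))"
  unfolding slowly_varying_def
proof (intro conjI allI impI)
  have "(\<lambda>x::real. nat \<lfloor>x\<rfloor>) \<in> measurable borel (count_space UNIV)"
    by measurable
  then have "(\<lambda>x::real. a (nat \<lfloor>x\<rfloor>)) \<in> borel_measurable borel"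
    by (rule measurable_compose) simp
  then have "(\<lambda>x::real. x powr p / a (nat \<lfloor>x\<rfloor>)) \<in> borel_measurable borel"
    by measurable
  then have "(\<lambda>x::real. x powr p / a (nat \<lfloor>x\<rfloor>)) \<in> borel_measurable lebesgue"
    by (intro measurable_completion) simp
  then show "(\<lambda>x. x powr p / a (nat \<lfloor>x\<rfloor>)) \<in> borel_measurable (lebesgue_on {0<..})"
    by (rule measurable_restrict_space1)
next
  fix y :: real assume y: "y > 0"
  have "((\<lambda>x. y powr p * inverse (a (nat \<lfloor>x * y\<rfloor>) / a (nat \<lfloor>x\<rfloor>))) \<longlongrightarrow> y powr p * inverse (y powr p)) at_top"
    using y by (intro tendsto_intros p) auto
  then have "((\<lambda>x. y powr p * inverse (a (nat \<lfloor>x * y\<rfloor>) / a (nat \<lfloor>x\<rfloor>))) \<longlongrightarrow> 1) at_top"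
    using y by simp
  moreover have "\<forall>\<^sub>F x in at_top. y powr p * inverse (a (nat \<lfloor>x * y\<rfloor>) / a (nat \<lfloor>x\<rfloor>)) =
      ((x * y) powr p / a (nat \<lfloor>x * y\<rfloor>)) / (x powr p / a (nat \<lfloor>x\<rfloor>))"
    using eventually_gt_at_top[of 0] by eventually_elim (use y in \<open>simp add: powr_mult field_simps\<close>)
  ultimately show "((\<lambda>x. ((x * y) powr p / a (nat \<lfloor>x * y\<rfloor>)) / (x powr p / a (nat \<lfloor>x\<rfloor>))) \<longlongrightarrow> 1) at_top"
    by (rule Lim_transform_eventually)
qed

section \<open>The parameters x_n and their scale\<close>

locale ergodic_sequence = ergodic_model f b \<beta> m c C
  for f :: "real fps" and b :: "nat \<Rightarrow> real" and \<beta> :: real and m :: nat and c C :: real +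
  fixes x :: "nat \<Rightarrow> real" and \<gamma> :: real
  assumes x_pos: "\<And>n. n \<ge> 1 \<Longrightarrow> x n > 0"
    and x_summable: "\<And>n. n \<ge> 1 \<Longrightarrow> summable (\<lambda>j. fps_nth (gen_fun f b) j * x n ^ j)"
    and x_mean: "\<And>n. n \<ge> 1 \<Longrightarrow> (\<integral>p. real (sum_mset p) \<partial>grand_canonical f b (x n)) = real n"
    and \<gamma>_pos: "\<gamma> > 0"
    and local_bound: "eventually (\<lambda>n. measure (grand_canonical f b (x n)) (partitions_of n)
           \<ge> real n powr (- \<gamma>)) sequentially"
begin

lemma x_less_1: "n \<ge> 1 \<Longrightarrow> x n < 1"
  using pm.summable_imp_less_1[OF x_summable not_summable_b] .

text \<open>The irrelevant value at \<open>n = 0\<close> is replaced by the one at \<open>n = 1\<close>.\<close>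

definition \<sigma> :: "nat \<Rightarrow> real" where "\<sigma> n = - ln (x (max 1 n))"
definition \<alpha> :: "nat \<Rightarrow> real" where "\<alpha> n = 1 / (1 - exp (- \<sigma> n))"

lemma \<sigma>_pos: "\<sigma> n > 0"
  using x_pos[of "max 1 n"] x_less_1[of "max 1 n"] by (simp add: \<sigma>_def)

lemma x_eq: "n \<ge> 1 \<Longrightarrow> x n = exp (- \<sigma> n)"
  using x_pos[of n] by (simp add: \<sigma>_def max_def)

lemma x_power: "n \<ge> 1 \<Longrightarrow> x n ^ k = exp (- real k * \<sigma> n)"
  by (simp add: x_eq exp_of_nat_mult [symmetric])

lemma M_\<sigma>:
  assumes "n \<ge> 1"
  shows "summable (\<lambda>k. real (Suc k) * (b (Suc k) * H (exp (- real (Suc k) * \<sigma> n))))" "M (\<sigma> n) = real n"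
proof -
  have "(\<lambda>k. real k * (b k * H (x n ^ k))) sums real n"
    using pm.mean_parts_sums[OF x_pos[OF assms] x_less_1[OF assms] x_summable[OF assms] x_mean[OF assms]] assms
    by (simp add: tilt_mean_eq)
  then have "(\<lambda>k. real (Suc k) * (b (Suc k) * H (x n ^ Suc k))) sums real n"
    by (subst sums_Suc_iff) simp
  then have "(\<lambda>k. real (Suc k) * (b (Suc k) * H (exp (- real (Suc k) * \<sigma> n)))) sums real n"
    using x_power[OF assms] by (simp only:)
  then show "summable (\<lambda>k. real (Suc k) * (b (Suc k) * H (exp (- real (Suc k) * \<sigma> n))))" "M (\<sigma> n) = real n"
    unfolding M_def by (simp_all only: sums_iff)
qed

text \<open>If \<sigma>_n \<ge> s for a fixed s at which M converges, then n = M(\<sigma>_n) \<le>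
  M(s), which holds for finitely many n only.\<close>

lemma \<sigma>_tendsto_0: "\<sigma> \<longlonglongrightarrow> 0"
proof (rule order_tendstoI)
  fix a :: real assume "a < 0"
  then show "\<forall>\<^sub>F n in sequentially. a < \<sigma> n"
    using \<sigma>_pos by (intro always_eventually allI) (auto intro: less_trans)
next
  fix a :: real assume a: "0 < a"
  obtain y0 where y0: "y0 \<ge> 1" "\<And>s. s > 0 \<Longrightarrow> 1 / s \<ge> y0 \<Longrightarrow> summable (\<lambda>k. real (Suc k) * (b (Suc k) * H (exp (- real (Suc k) * s))))"
    using M_sums by blast
  define s where "s = min a (1 / y0)"
  have s: "s > 0" "1 / s \<ge> y0" "s \<le> a"
    using a y0(1) by (auto simp: s_def field_simps min_def)
  show "\<forall>\<^sub>F n in sequentially. \<sigma> n < a"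
    using eventually_gt_at_top[of "nat \<lceil>M s\<rceil>"] eventually_ge_at_top[of 1]
  proof eventually_elim
    case (elim n)
    show ?case
    proof (rule ccontr)
      assume "\<not> \<sigma> n < a"
      then have "s \<le> \<sigma> n" using s by simp
      then have "M (\<sigma> n) \<le> M s" using summable_M_mono(2)[OF y0(2)[OF s(1,2)] s(1)] by blast
      then show False using M_\<sigma>(2)[of n] elim by linarith
    qed
  qed
qed

lemma \<sigma>_limit: "(\<lambda>n. \<sigma> n * real n / B (1 / \<sigma> n)) \<longlonglongrightarrow> \<Omega>"
proof -
  have "(\<lambda>n. \<sigma> n * M (\<sigma> n) / B (1 / \<sigma> n)) \<longlonglongrightarrow> \<Omega>"
    by (rule M_limit[OF \<sigma>_pos \<sigma>_tendsto_0])
  moreover have "\<forall>\<^sub>F n in sequentially. \<sigma> n * M (\<sigma> n) / B (1 / \<sigma> n) = \<sigma> n * real n / B (1 / \<sigma> n)"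
    using eventually_ge_at_top[of 1] by eventually_elim (simp add: M_\<sigma>(2))
  ultimately show ?thesis by (rule Lim_transform_eventually)
qed

lemma \<alpha>_eq: "n \<ge> 1 \<Longrightarrow> 1 / (1 - x n) = \<alpha> n"
  by (simp add: \<alpha>_def x_eq)

lemma \<alpha>_pos: "\<alpha> n > 0"
  using \<sigma>_pos[of n] by (simp add: \<alpha>_def)

text \<open>The inequality is used in addition to the limit: k > \<alpha> t implies k \<sigma> > t
  without any loss.\<close>

lemma \<alpha>\<sigma>_ge_1: "\<alpha> n * \<sigma> n \<ge> 1"
proof -
  have "1 - exp (- \<sigma> n) \<le> \<sigma> n" using exp_ge_add_one_self[of "- \<sigma> n"] by linarith
  then show ?thesis using \<sigma>_pos[of n] by (simp add: \<alpha>_def field_simps)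
qed

lemma \<sigma>_at_right: "filterlim \<sigma> (at_right 0) sequentially"
proof -
  have "\<sigma> n \<noteq> 0" for n using \<sigma>_pos[of n] by simp
  then show ?thesis using \<sigma>_tendsto_0 \<sigma>_pos by (auto simp: filterlim_at)
qed

lemma \<alpha>\<sigma>_tendsto_1: "(\<lambda>n. \<alpha> n * \<sigma> n) \<longlonglongrightarrow> 1"
proof -
  have "((\<lambda>s::real. 1 / (1 - exp (- s)) * s) \<longlongrightarrow> 1) (at_right 0)" by real_asymp
  from filterlim_compose[OF this \<sigma>_at_right] show ?thesis by (simp add: \<alpha>_def)
qed

lemma inverse_\<sigma>_at_top: "filterlim (\<lambda>n. 1 / \<sigma> n) at_top sequentially"
  by (rule scale_at_top[OF \<sigma>_tendsto_0 \<sigma>_pos])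

lemma B_\<sigma>_at_top: "filterlim (\<lambda>n. B (1 / \<sigma> n)) at_top sequentially"
  by (rule filterlim_compose[OF B_at_top inverse_\<sigma>_at_top])

lemma B_scaled: "r > 0 \<Longrightarrow> (\<lambda>n. B (1 / (r * \<sigma> n)) / B (1 / \<sigma> n)) \<longlonglongrightarrow> r powr (- \<beta>)"
proof -
  assume r: "r > 0"
  then have "(1 / r) powr \<beta> = r powr (- \<beta>)" by (simp add: powr_minus_divide powr_divide)
  then show ?thesis
    using filterlim_compose[OF B_regular[of "1 / r"] inverse_\<sigma>_at_top] r by simp
qed

text \<open>The unit n / \<alpha> in which \<open>ergodic\<close> measures
  \<open>parts_above\<close> is thus proportional to B(1 / \<sigma>), the scale of the exponents in
  Chernoff's bound.\<close>

lemma mean_scaled: "(\<lambda>n. real n / \<alpha> n / B (1 / \<sigma> n)) \<longlonglongrightarrow> \<Omega>"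
proof -
  have "(\<lambda>n. \<sigma> n * real n / B (1 / \<sigma> n) * inverse (\<alpha> n * \<sigma> n)) \<longlonglongrightarrow> \<Omega> * inverse 1"
    by (intro tendsto_intros \<sigma>_limit \<alpha>\<sigma>_tendsto_1) simp
  moreover have "\<sigma> n * real n / B (1 / \<sigma> n) * inverse (\<alpha> n * \<sigma> n) = real n / \<alpha> n / B (1 / \<sigma> n)" for n
    using \<sigma>_pos[of n] \<alpha>_pos[of n] by (simp add: field_simps)
  ultimately show ?thesis by simp
qed

lemma tail_scaled:
  assumes "t > 0" "r > 0"
  shows "(\<lambda>n. tail (r * \<sigma> n) t / B (1 / \<sigma> n)) \<longlonglongrightarrow> r powr (- \<beta>) * \<Phi> t"
proof -
  have pos: "\<And>n. r * \<sigma> n > 0" using assms \<sigma>_pos by simp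
  have 0: "(\<lambda>n. r * \<sigma> n) \<longlonglongrightarrow> 0" using tendsto_mult[OF tendsto_const \<sigma>_tendsto_0, of r] by simp
  have "(\<lambda>n. B (1 / (r * \<sigma> n)) / B (1 / \<sigma> n) * (tail (r * \<sigma> n) t / B (1 / (r * \<sigma> n)))) \<longlonglongrightarrow> r powr (- \<beta>) * \<Phi> t"
    using assms by (intro tendsto_mult B_scaled tail_limit pos 0)
  moreover have "\<forall>\<^sub>F n in sequentially. B (1 / (r * \<sigma> n)) / B (1 / \<sigma> n) * (tail (r * \<sigma> n) t / B (1 / (r * \<sigma> n))) =
      tail (r * \<sigma> n) t / B (1 / \<sigma> n)"
    using scale_at_top[OF 0 pos, unfolded filterlim_at_top, rule_format, of 1]
  proof eventually_elim
    case (elim n)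
    then have "B (1 / (r * \<sigma> n)) \<ge> 1" by (rule B_ge_1)
    then show ?case by simp
  qed
  ultimately show ?thesis by (rule Lim_transform_eventually)
qed

lemma tail_scaled_sums:
  assumes "t > 0" "r > 0"
  shows "\<forall>\<^sub>F n in sequentially. (\<lambda>k. tail_term (r * \<sigma> n) t (Suc k)) sums tail (r * \<sigma> n) t"
proof -
  have pos: "\<And>n. r * \<sigma> n > 0" using assms \<sigma>_pos by simp
  have 0: "(\<lambda>n. r * \<sigma> n) \<longlonglongrightarrow> 0" using tendsto_mult[OF tendsto_const \<sigma>_tendsto_0, of r] by simp
  obtain y0 where y0: "\<And>s. s > 0 \<Longrightarrow> 1 / s \<ge> y0 \<Longrightarrow> summable (\<lambda>k. tail_term s t (Suc k))"
    using tail_summable[OF assms(1)] by blast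
  show ?thesis
    using scale_at_top[OF 0 pos, unfolded filterlim_at_top, rule_format, of y0]
    by eventually_elim (unfold tail_def, intro summable_sums y0 pos)
qed

text \<open>The local lower bound costs only a power of \<open>n\<close>, that is a power of \<open>B(1/\<sigma>\<^sub>n)\<close>, which
  the exponential bound absorbs.\<close>

lemma exponential_smallness:
  assumes d: "d > 0"
    and X: "\<forall>\<^sub>F n in sequentially. measure (small_canonical f b n) (X n) *
      measure (grand_canonical f b (x n)) (partitions_of n) \<le> exp (- d * B (1 / \<sigma> n))"
  shows "(\<lambda>n. measure (small_canonical f b n) (X n)) \<longlonglongrightarrow> 0"
proof -
  obtain c0 y0 where c0: "c0 > 0" "y0 \<ge> 1" "\<And>y. y \<ge> y0 \<Longrightarrow> c0 * y powr (\<beta> / 2) \<le> B y"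
    using B_lower by blast
  \<comment> \<open>From n \<le> 2 \<Omega> B(1 / \<sigma>) / \<sigma> and 1 / \<sigma> \<le> (B(1 /
    \<sigma>) / c0)^(2 / \<beta>).\<close>
  define q where "q = 1 + 2 / \<beta>"
  define A where "A = 2 * \<Omega> * (1 / c0) powr (2 / \<beta>)"
  have A_pos: "A > 0" using \<Omega>_pos c0 by (simp add: A_def)
  have ev: "\<forall>\<^sub>F n in sequentially. \<sigma> n * real n / B (1 / \<sigma> n) < 2 * \<Omega>"
    using \<Omega>_pos by (intro order_tendstoD(2)[OF \<sigma>_limit]) simp
  have n_le: "\<forall>\<^sub>F n in sequentially. real n \<le> A * B (1 / \<sigma> n) powr q"
    using ev inverse_\<sigma>_at_top[unfolded filterlim_at_top, rule_format, of y0]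
  proof eventually_elim
    case (elim n)
    let ?B = "B (1 / \<sigma> n)"
    have B1: "?B \<ge> 1" using elim c0 by (intro B_ge_1) linarith
    have "c0 * (1 / \<sigma> n) powr (\<beta> / 2) \<le> ?B" using elim by (intro c0)
    then have "(1 / \<sigma> n) powr (\<beta> / 2) \<le> 1 / c0 * ?B" using c0 by (simp add: field_simps)
    then have "((1 / \<sigma> n) powr (\<beta> / 2)) powr (2 / \<beta>) \<le> (1 / c0 * ?B) powr (2 / \<beta>)"
      using \<beta>_pos by (intro powr_mono2) auto
    then have s: "1 / \<sigma> n \<le> (1 / c0) powr (2 / \<beta>) * ?B powr (2 / \<beta>)"
      using \<beta>_pos \<sigma>_pos[of n] c0 B1 by (simp add: powr_powr powr_mult powr_divide)
    have "real n * \<sigma> n \<le> 2 * \<Omega> * ?B" using elim B1 by (simp add: field_simps)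
    then have "real n \<le> 2 * \<Omega> * ?B * (1 / \<sigma> n)" using \<sigma>_pos[of n] by (simp add: field_simps)
    also have "\<dots> \<le> 2 * \<Omega> * ?B * ((1 / c0) powr (2 / \<beta>) * ?B powr (2 / \<beta>))"
      using s \<Omega>_pos B1 by (intro mult_left_mono) auto
    also have "\<dots> = A * ?B powr q" using B1 by (simp add: A_def q_def powr_add)
    finally show ?case .
  qed
  have "((\<lambda>y. A powr \<gamma> * (y powr (q * \<gamma>) * exp (- d * y))) \<longlongrightarrow> 0) at_top"
    using d A_pos by real_asymp
  from filterlim_compose[OF this B_\<sigma>_at_top]
  have lim: "(\<lambda>n. A powr \<gamma> * (B (1 / \<sigma> n) powr (q * \<gamma>) * exp (- d * B (1 / \<sigma> n)))) \<longlonglongrightarrow> 0" .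
  show ?thesis
  proof (rule tendsto_sandwich[OF _ _ tendsto_const lim])
    show "\<forall>\<^sub>F n in sequentially. measure (small_canonical f b n) (X n) \<le>
        A powr \<gamma> * (B (1 / \<sigma> n) powr (q * \<gamma>) * exp (- d * B (1 / \<sigma> n)))"
      using X local_bound n_le eventually_ge_at_top[of 1]
    proof eventually_elim
      case (elim n)
      have n: "real n powr \<gamma> > 0" using elim by simp
      have "measure (small_canonical f b n) (X n) * real n powr (- \<gamma>) \<le> exp (- d * B (1 / \<sigma> n))"
        using mult_left_mono[OF elim(2), of "measure (small_canonical f b n) (X n)"] elim(1) by simp
      then have "measure (small_canonical f b n) (X n) \<le> real n powr \<gamma> * exp (- d * B (1 / \<sigma> n))"
        using n by (simp add: powr_minus field_simps)
      also have "\<dots> \<le> (A * B (1 / \<sigma> n) powr q) powr \<gamma> * exp (- d * B (1 / \<sigma> n))"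
        using elim \<gamma>_pos by (intro mult_right_mono powr_mono2) auto
      also have "\<dots> = A powr \<gamma> * (B (1 / \<sigma> n) powr (q * \<gamma>) * exp (- d * B (1 / \<sigma> n)))"
        using A_pos by (simp add: powr_mult powr_powr)
      finally show ?case .
    qed
  qed auto
qed

text \<open>The exponents below are known only up to o(B(1 / \<sigma>)); half of the negative limit
  is kept as a safe rate.\<close>

lemma exponential_smallness_limit:
  assumes X: "\<forall>\<^sub>F n in sequentially. measure (small_canonical f b n) (X n) *
      measure (grand_canonical f b (x n)) (partitions_of n) \<le> exp (a n)"
    and a: "(\<lambda>n. a n / B (1 / \<sigma> n)) \<longlonglongrightarrow> L" "L < 0"
  shows "(\<lambda>n. measure (small_canonical f b n) (X n)) \<longlonglongrightarrow> 0"
proof (rule exponential_smallness[of "- L / 2"])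
  have "\<forall>\<^sub>F n in sequentially. a n / B (1 / \<sigma> n) < L / 2"
    using a(2) by (intro order_tendstoD(2)[OF a(1)]) simp
  with X show "\<forall>\<^sub>F n in sequentially. measure (small_canonical f b n) (X n) *
      measure (grand_canonical f b (x n)) (partitions_of n) \<le> exp (- (- L / 2) * B (1 / \<sigma> n))"
    using B_\<sigma>_at_top[unfolded filterlim_at_top, rule_format, of 1]
  proof eventually_elim
    case (elim n)
    have "a n < L / 2 * B (1 / \<sigma> n)" using elim by (simp add: pos_divide_less_eq)
    then have "exp (a n) \<le> exp (- (- L / 2) * B (1 / \<sigma> n))" by simp
    with elim(1) show ?case by linarith
  qed
qed (use a(2) in simp)

text \<open>For \<open>k \<sigma> > t\<close> a shift of the exponent \<open>k \<sigma>\<close> by \<open>\<theta>\<close> is dominated by the dilation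
  of \<open>\<sigma>\<close> by the factor \<open>r = 1 - \<theta> / t\<close>; this reduces everything to the function \<open>tail\<close>.\<close>

lemma shape_tilt_limit:
  assumes t: "t > 0" and e: "e > 0" and j: "j \<in> {1, 2 :: nat}"
  shows "\<exists>\<eta>0>0. \<forall>\<eta>. \<bar>\<eta>\<bar> \<le> \<eta>0 \<longrightarrow> 1 - \<eta> / t > 0 \<and>
    \<bar>(1 - \<eta> / t) powr (- \<beta>) * \<Phi> ((1 - \<eta> / t) ^ j * t) - \<Phi> t\<bar> < e"
proof -
  let ?G = "\<lambda>\<eta>. (1 - \<eta> / t) powr (- \<beta>) * \<Phi> ((1 - \<eta> / t) ^ j * t)"
  have "((\<lambda>\<eta>. (1 - \<eta> / t) ^ j * t) \<longlongrightarrow> (1 - 0 / t) ^ j * t) (at 0)"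
    using t by (intro tendsto_intros) auto
  then have "((\<lambda>\<eta>. (1 - \<eta> / t) ^ j * t) \<longlongrightarrow> t) (at 0)" by simp
  then have "((\<lambda>\<eta>. \<Phi> ((1 - \<eta> / t) ^ j * t)) \<longlongrightarrow> \<Phi> t) (at 0)"
    by (rule isCont_tendsto_compose[OF isCont_\<Phi>[OF t]])
  moreover have "((\<lambda>\<eta>. (1 - \<eta> / t) powr (- \<beta>)) \<longlongrightarrow> (1 - 0 / t) powr (- \<beta>)) (at 0)"
    using t by (intro tendsto_intros) auto
  ultimately have "(?G \<longlongrightarrow> (1 - 0 / t) powr (- \<beta>) * \<Phi> t) (at 0)"
    by (intro tendsto_mult)
  then have "(?G \<longlongrightarrow> \<Phi> t) (at 0)" by simp
  then have 1: "\<forall>\<^sub>F \<eta> in at 0. \<bar>?G \<eta> - \<Phi> t\<bar> < e"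
    using e by (auto dest: tendstoD simp: dist_real_def)
  have "((\<lambda>\<eta>. 1 - \<eta> / t) \<longlongrightarrow> 1 - 0 / t) (at 0)" using t by (intro tendsto_intros) auto
  then have 2: "\<forall>\<^sub>F \<eta> in at 0. 1 - \<eta> / t > 0"
    by (rule order_tendstoD) simp
  from eventually_conj[OF 1 2] obtain \<delta> where \<delta>: "\<delta> > 0"
    "\<And>\<eta>. \<eta> \<noteq> 0 \<Longrightarrow> \<bar>\<eta>\<bar> < \<delta> \<Longrightarrow> \<bar>?G \<eta> - \<Phi> t\<bar> < e \<and> 1 - \<eta> / t > 0"
    by (auto simp: eventually_at dist_real_def)
  have "1 - \<eta> / t > 0 \<and> \<bar>?G \<eta> - \<Phi> t\<bar> < e" if "\<bar>\<eta>\<bar> \<le> \<delta> / 2" for \<eta>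
    using \<delta>(2)[of \<eta>] that \<delta>(1) e by (cases "\<eta> = 0") auto
  then show ?thesis using \<delta>(1) by (intro exI[of _ "\<delta> / 2"]) auto
qed

text \<open>Chernoff with \<theta> = \<eta> > 0, where d consists of the tail terms at r \<sigma>
  with cut r t and r = 1 - \<eta> / t. Divided by B(1 / \<sigma>), the exponent tends to \<eta>
  times r^(-\<beta>) \<Phi>(r t) - \<Phi>(t) - \<Omega> e, and \<eta> is so small that dilation
  changes \<Phi> by less than \<Omega> e / 2.\<close>

lemma upper_deviation:
  assumes t: "t > 0" and e: "e > 0"
  shows "(\<lambda>n. measure (small_canonical f b n)
    {p \<in> partitions_of n. parts_above p (\<alpha> n * t) \<ge> (\<Phi> t / \<Omega> + e) * (real n / \<alpha> n)}) \<longlonglongrightarrow> 0"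
proof -
  have e': "\<Omega> * e / 2 > 0" using e \<Omega>_pos by simp
  obtain \<eta> where \<eta>: "\<eta> > 0" "1 - \<eta> / t > 0"
    "\<bar>(1 - \<eta> / t) powr (- \<beta>) * \<Phi> ((1 - \<eta> / t) * t) - \<Phi> t\<bar> < \<Omega> * e / 2"
    using shape_tilt_limit[OF t e', of 1] by (metis abs_of_pos insertI1 order_refl power_one_right)
  define r where "r = 1 - \<eta> / t"
  have r: "0 < r" "r < 1" "r * t = t - \<eta>" using \<eta> t by (auto simp: r_def field_simps)
  let ?X = "\<lambda>n. {p \<in> partitions_of n. parts_above p (\<alpha> n * t) \<ge> (\<Phi> t / \<Omega> + e) * (real n / \<alpha> n)}"
  let ?s = "\<lambda>n. r * \<sigma> n"
  have rt: "r * t > 0" using r(1) t by (rule mult_pos_pos)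
  have bound: "\<forall>\<^sub>F n in sequentially. measure (small_canonical f b n) (?X n) *
      measure (grand_canonical f b (x n)) (partitions_of n) \<le>
      exp (\<eta> * tail (?s n) (r * t) - \<eta> * ((\<Phi> t / \<Omega> + e) * (real n / \<alpha> n)))"
    using tail_scaled_sums[OF rt r(1)] eventually_ge_at_top[of 1]
  proof eventually_elim
    case (elim n)
    \<comment> \<open>For k \<sigma> > t the shift \<eta> is at most the fraction \<eta> / t of k
      \<sigma>.\<close>
    have shift: "x n ^ k * exp \<eta> \<le> exp (- real k * ?s n)" "real k * ?s n > r * t" if k: "real k > \<alpha> n * t" for k
    proof -
      have "t * 1 \<le> t * (\<alpha> n * \<sigma> n)" using \<alpha>\<sigma>_ge_1[of n] t by (intro mult_left_mono) auto
      also have "\<dots> < real k * \<sigma> n" using k \<sigma>_pos[of n] by (simp add: mult_ac mult_strict_right_mono)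
      finally have kt: "real k * \<sigma> n > t" by simp
      then have "\<eta> / t * t \<le> \<eta> / t * (real k * \<sigma> n)" using \<eta> t by (intro mult_left_mono) auto
      then have "\<eta> - real k * \<sigma> n \<le> - real k * ?s n"
        using t by (simp add: r_def algebra_simps)
      then show "x n ^ k * exp \<eta> \<le> exp (- real k * ?s n)"
        using x_power[OF elim(2), of k] by (simp add: exp_add [symmetric] algebra_simps)
      show "real k * ?s n > r * t" using mult_strict_left_mono[OF kt r(1)] by (simp only: mult.left_commute)
    qed
    have s_pos: "?s n > 0" using r \<sigma>_pos[of n] by simp
    show ?case
    proof (rule chernoff[OF x_pos[OF elim(2)] x_less_1[OF elim(2)] x_summable[OF elim(2)], where T = "\<alpha> n * t" and d = "tail_term (?s n) (r * t)"])
      fix k :: nat assume k: "k \<ge> 1" "real k > \<alpha> n * t"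
      have "exp (- real k * ?s n) < 1" using k s_pos by simp
      with shift(1)[OF k(2)] show "x n ^ k * exp \<eta> < 1" by linarith
    next
      fix k :: nat assume k: "k \<ge> 1"
      have lt: "exp (- real k * ?s n) < 1" using k s_pos by simp
      show "(if real k > \<alpha> n * t then \<eta> * (b k * H (x n ^ k * exp \<eta>)) else 0) \<le> \<eta> * tail_term (?s n) (r * t) k"
      proof (cases "real k > \<alpha> n * t")
        case True
        have "H (x n ^ k * exp \<eta>) \<le> H (exp (- real k * ?s n))"
          using x_pos[OF elim(2)] shift(1)[OF True] lt by (intro H_mono) auto
        then show ?thesis
          using True shift(2)[OF True] \<eta> b_ge_0[OF k] by (simp add: tail_term_def mult_left_mono)
      next
        case False
        have "0 \<le> tail_term (?s n) (r * t) k"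
          unfolding tail_term_def using lt by (auto intro!: mult_nonneg_nonneg b_ge_0 H_nonneg k)
        with False \<eta> show ?thesis by simp
      qed
    next
      fix p assume "p \<in> ?X n"
      then show "\<eta> * ((\<Phi> t / \<Omega> + e) * (real n / \<alpha> n)) \<le> \<eta> * parts_above p (\<alpha> n * t)"
        using \<eta> by (intro mult_left_mono) auto
    qed (use elim in auto)
  qed
  have "(\<lambda>n. \<eta> * (tail (?s n) (r * t) / B (1 / \<sigma> n)) - \<eta> * ((\<Phi> t / \<Omega> + e) * (real n / \<alpha> n / B (1 / \<sigma> n)))) \<longlonglongrightarrow>
      \<eta> * (r powr (- \<beta>) * \<Phi> (r * t)) - \<eta> * ((\<Phi> t / \<Omega> + e) * \<Omega>)"
    by (intro tendsto_intros mean_scaled tail_scaled rt r)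
  then have lim: "(\<lambda>n. (\<eta> * tail (?s n) (r * t) - \<eta> * ((\<Phi> t / \<Omega> + e) * (real n / \<alpha> n))) / B (1 / \<sigma> n)) \<longlonglongrightarrow>
      \<eta> * (r powr (- \<beta>) * \<Phi> (r * t)) - \<eta> * ((\<Phi> t / \<Omega> + e) * \<Omega>)"
    by (simp add: diff_divide_distrib)
  have eq: "(\<Phi> t / \<Omega> + e) * \<Omega> = \<Phi> t + \<Omega> * e" using \<Omega>_pos by (simp add: field_simps)
  have "r powr (- \<beta>) * \<Phi> (r * t) < (\<Phi> t / \<Omega> + e) * \<Omega>"
    using \<eta>(3) e' unfolding abs_less_iff r_def eq by linarith
  then have "\<eta> * (r powr (- \<beta>) * \<Phi> (r * t)) - \<eta> * ((\<Phi> t / \<Omega> + e) * \<Omega>) < 0"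
    using \<eta>(1) by (simp only: diff_less_0_iff_less mult_less_cancel_left_pos)
  with bound lim show ?thesis by (rule exponential_smallness_limit)
qed

text \<open>Chernoff with \<theta> = -\<eta> and r = 1 + \<eta> / t. As \<theta> is negative, d has
  to bound the tilted means from below, and its support has to lie inside k > \<alpha> t.\<close>

lemma lower_deviation:
  assumes t: "t > 0" and e: "e > 0"
  shows "(\<lambda>n. measure (small_canonical f b n)
    {p \<in> partitions_of n. parts_above p (\<alpha> n * t) \<le> (\<Phi> t / \<Omega> - e) * (real n / \<alpha> n)}) \<longlonglongrightarrow> 0"
proof -
  have e': "\<Omega> * e / 2 > 0" using e \<Omega>_pos by simp
  \<comment> \<open>The cut is r^2 t: one factor r belongs to the dilation of \<sigma>, the other
    one absorbs the excess of \<alpha> \<sigma> over 1.\<close>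
  obtain \<eta>0 where \<eta>0: "\<eta>0 > 0" "\<And>\<eta>. \<bar>\<eta>\<bar> \<le> \<eta>0 \<Longrightarrow>
    \<bar>(1 - \<eta> / t) powr (- \<beta>) * \<Phi> ((1 - \<eta> / t) ^ 2 * t) - \<Phi> t\<bar> < \<Omega> * e / 2"
    using shape_tilt_limit[OF t e', of 2] by auto
  define \<eta> where "\<eta> = \<eta>0"
  define r where "r = 1 + \<eta> / t"
  have \<eta>: "\<eta> > 0" "\<bar>r powr (- \<beta>) * \<Phi> (r ^ 2 * t) - \<Phi> t\<bar> < \<Omega> * e / 2"
    using \<eta>0(1) \<eta>0(2)[of "- \<eta>0"] by (auto simp: \<eta>_def r_def)
  have r: "0 < r" "1 < r" using \<eta> t by (auto simp: r_def add_pos_pos)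
  let ?X = "\<lambda>n. {p \<in> partitions_of n. parts_above p (\<alpha> n * t) \<le> (\<Phi> t / \<Omega> - e) * (real n / \<alpha> n)}"
  let ?s = "\<lambda>n. r * \<sigma> n"
  have rt: "r ^ 2 * t > 0" using r t by simp
  have bound: "\<forall>\<^sub>F n in sequentially. measure (small_canonical f b n) (?X n) *
      measure (grand_canonical f b (x n)) (partitions_of n) \<le>
      exp (- \<eta> * tail (?s n) (r ^ 2 * t) - - \<eta> * ((\<Phi> t / \<Omega> - e) * (real n / \<alpha> n)))"
    using tail_scaled_sums[OF rt r(1)] eventually_ge_at_top[of 1] order_tendstoD(2)[OF \<alpha>\<sigma>_tendsto_1 r(2)]
  proof eventually_elim
    case (elim n)
    have s_pos: "?s n > 0" using r \<sigma>_pos[of n] by simp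
    \<comment> \<open>This is where \<alpha> \<sigma> < r, valid for large n, is used.\<close>
    have above: "real k > \<alpha> n * t" if "real k * ?s n > r ^ 2 * t" for k
    proof -
      have "(r * \<sigma> n) * (\<alpha> n * t) = r * t * (\<alpha> n * \<sigma> n)" by simp
      also have "\<dots> \<le> r * t * r" using elim r t by (intro mult_left_mono) auto
      also have "\<dots> < (r * \<sigma> n) * real k" using that by (simp add: power2_eq_square mult_ac)
      finally have "(r * \<sigma> n) * (\<alpha> n * t) < (r * \<sigma> n) * real k" .
      with s_pos show ?thesis by (simp only: mult_less_cancel_left_pos)
    qed
    have shift: "exp (- real k * ?s n) \<le> x n ^ k * exp (- \<eta>)" if k: "real k > \<alpha> n * t" for k
    proof -
      have "t * 1 \<le> t * (\<alpha> n * \<sigma> n)" using \<alpha>\<sigma>_ge_1[of n] t by (intro mult_left_mono) auto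
      also have "\<dots> < real k * \<sigma> n" using k \<sigma>_pos[of n] by (simp add: mult_ac mult_strict_right_mono)
      finally have kt: "real k * \<sigma> n > t" by simp
      then have "\<eta> / t * t \<le> \<eta> / t * (real k * \<sigma> n)" using \<eta> t by (intro mult_left_mono) auto
      then have "- real k * ?s n \<le> - \<eta> - real k * \<sigma> n"
        using t by (simp add: r_def algebra_simps)
      then show ?thesis
        using x_power[OF elim(2), of k] by (simp add: exp_add [symmetric] algebra_simps)
    qed
    have lt: "x n ^ k * exp (- \<eta>) < 1" if "k \<ge> 1" for k
    proof -
      have "x n ^ k < 1" using x_pos[OF elim(2)] x_less_1[OF elim(2)] that by (intro pm.power_less_1) auto
      moreover have "x n ^ k * exp (- \<eta>) \<le> x n ^ k * 1" using x_pos[OF elim(2)] \<eta> by (intro mult_left_mono) auto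
      ultimately show ?thesis by linarith
    qed
    show ?case
    proof (rule chernoff[OF x_pos[OF elim(2)] x_less_1[OF elim(2)] x_summable[OF elim(2)], where T = "\<alpha> n * t" and d = "tail_term (?s n) (r ^ 2 * t)"])
      fix k :: nat assume k: "k \<ge> 1"
      show "(if real k > \<alpha> n * t then - \<eta> * (b k * H (x n ^ k * exp (- \<eta>))) else 0) \<le> - \<eta> * tail_term (?s n) (r ^ 2 * t) k"
      proof (cases "real k > \<alpha> n * t")
        case True
        have "H (exp (- real k * ?s n)) \<le> H (x n ^ k * exp (- \<eta>))"
          using shift[OF True] lt[OF k] by (intro H_mono) auto
        moreover have "0 \<le> H (x n ^ k * exp (- \<eta>))"
          using x_pos[OF elim(2)] lt[OF k] by (intro H_nonneg) auto
        ultimately have "tail_term (?s n) (r ^ 2 * t) k \<le> b k * H (x n ^ k * exp (- \<eta>))"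
          using b_ge_0[OF k] by (auto simp: tail_term_def intro!: mult_left_mono)
        then show ?thesis using True \<eta> by (simp add: mult_left_mono)
      next
        case False
        then have "tail_term (?s n) (r ^ 2 * t) k = 0" using above[of k] by (auto simp: tail_term_def)
        with False show ?thesis by simp
      qed
    next
      fix p assume "p \<in> ?X n"
      then show "- \<eta> * ((\<Phi> t / \<Omega> - e) * (real n / \<alpha> n)) \<le> - \<eta> * parts_above p (\<alpha> n * t)"
        using \<eta> by (intro mult_left_mono_neg) auto
    qed (use elim lt in auto)
  qed
  have "(\<lambda>n. - \<eta> * (tail (?s n) (r ^ 2 * t) / B (1 / \<sigma> n)) - - \<eta> * ((\<Phi> t / \<Omega> - e) * (real n / \<alpha> n / B (1 / \<sigma> n)))) \<longlonglongrightarrow>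
      - \<eta> * (r powr (- \<beta>) * \<Phi> (r ^ 2 * t)) - - \<eta> * ((\<Phi> t / \<Omega> - e) * \<Omega>)"
    by (intro tendsto_diff tendsto_mult tendsto_const mean_scaled tail_scaled rt r)
  then have lim: "(\<lambda>n. (- \<eta> * tail (?s n) (r ^ 2 * t) - - \<eta> * ((\<Phi> t / \<Omega> - e) * (real n / \<alpha> n))) / B (1 / \<sigma> n)) \<longlonglongrightarrow>
      - \<eta> * (r powr (- \<beta>) * \<Phi> (r ^ 2 * t)) - - \<eta> * ((\<Phi> t / \<Omega> - e) * \<Omega>)"
    by (simp add: add_divide_distrib diff_divide_distrib)
  have eq: "(\<Phi> t / \<Omega> - e) * \<Omega> = \<Phi> t - \<Omega> * e" using \<Omega>_pos by (simp add: field_simps)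
  have "(\<Phi> t / \<Omega> - e) * \<Omega> < r powr (- \<beta>) * \<Phi> (r ^ 2 * t)"
    using \<eta>(2) e' unfolding abs_less_iff eq by linarith
  then have "- \<eta> * (r powr (- \<beta>) * \<Phi> (r ^ 2 * t)) - - \<eta> * ((\<Phi> t / \<Omega> - e) * \<Omega>) < 0"
    using \<eta>(1) by (simp only: diff_less_0_iff_less mult_less_cancel_left_neg neg_less_0_iff_less)
  with bound lim show ?thesis by (rule exponential_smallness_limit)
qed

text \<open>The complement is covered by an upper and a lower deviation event for each of the
  finitely many t, so a union bound on weights suffices.\<close>

lemma small_canonical_concentration:
  assumes e: "e > 0" and T: "finite T" "\<And>t. t \<in> T \<Longrightarrow> t > 0"
  shows "(\<lambda>n. measure (small_canonical f b n)
    {p \<in> partitions_of n. \<forall>t\<in>T. \<bar>\<alpha> n / real n * parts_above p (\<alpha> n * t) - \<Phi> t / \<Omega>\<bar> < e}) \<longlonglongrightarrow> 1"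
proof -
  let ?m = "\<lambda>n. measure (small_canonical f b n)"
  let ?U = "\<lambda>t n. {p \<in> partitions_of n. parts_above p (\<alpha> n * t) \<ge> (\<Phi> t / \<Omega> + e) * (real n / \<alpha> n)}"
  let ?L = "\<lambda>t n. {p \<in> partitions_of n. parts_above p (\<alpha> n * t) \<le> (\<Phi> t / \<Omega> - e) * (real n / \<alpha> n)}"
  let ?good = "\<lambda>n p. \<forall>t\<in>T. \<bar>\<alpha> n / real n * parts_above p (\<alpha> n * t) - \<Phi> t / \<Omega>\<bar> < e"
  have sub: "?m n {p \<in> partitions_of n. \<not> ?good n p} \<le> (\<Sum>t\<in>T. ?m n (?U t n) + ?m n (?L t n))" if n: "n \<ge> 1" for n
  proof -
    let ?w = "\<lambda>p. weight f b p / fps_nth (gen_fun f b) n"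
    have w: "?w p \<ge> 0" if "p \<in> partitions_of n" for p
      using that pm.gen_fun_pos[of n] pm.partitions_of_subset pm.weight_nonneg[of p] by (auto intro: divide_nonneg_pos)
    have m: "?m n X = (\<Sum>p\<in>X. ?w p)" if "X \<subseteq> partitions_of n" for X
      using pm.measure_small_canonical[OF that] by (simp add: sum_divide_distrib)
    have "{p \<in> partitions_of n. \<not> ?good n p} \<subseteq> (\<Union>t\<in>T. ?U t n \<union> ?L t n)"
    proof
      fix p assume p: "p \<in> {p \<in> partitions_of n. \<not> ?good n p}"
      then obtain t where t: "t \<in> T" "\<bar>\<alpha> n / real n * parts_above p (\<alpha> n * t) - \<Phi> t / \<Omega>\<bar> \<ge> e"
        by (auto simp: not_less)
      have "parts_above p (\<alpha> n * t) = (\<alpha> n / real n * parts_above p (\<alpha> n * t)) * (real n / \<alpha> n)"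
        using n \<alpha>_pos[of n] by simp
      moreover from t(2) have "\<alpha> n / real n * parts_above p (\<alpha> n * t) \<ge> \<Phi> t / \<Omega> + e \<or>
          \<alpha> n / real n * parts_above p (\<alpha> n * t) \<le> \<Phi> t / \<Omega> - e" by linarith
      moreover have "0 \<le> real n / \<alpha> n" using \<alpha>_pos[of n] by simp
      ultimately have "parts_above p (\<alpha> n * t) \<ge> (\<Phi> t / \<Omega> + e) * (real n / \<alpha> n) \<or>
          parts_above p (\<alpha> n * t) \<le> (\<Phi> t / \<Omega> - e) * (real n / \<alpha> n)"
        by (metis mult_right_mono)
      with p t(1) show "p \<in> (\<Union>t\<in>T. ?U t n \<union> ?L t n)" by auto
    qed
    then have "?m n {p \<in> partitions_of n. \<not> ?good n p} \<le> (\<Sum>p\<in>(\<Union>t\<in>T. ?U t n \<union> ?L t n). ?w p)"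
      using w T finite_partitions_of[of n] by (subst m) (auto intro!: sum_mono2)
    also have "\<dots> \<le> (\<Sum>t\<in>T. \<Sum>p\<in>?U t n \<union> ?L t n. ?w p)"
      using w T finite_partitions_of[of n] by (intro sum_UN_le) auto
    also have "\<dots> \<le> (\<Sum>t\<in>T. ?m n (?U t n) + ?m n (?L t n))"
    proof (rule sum_mono)
      fix t assume "t \<in> T"
      have "(\<Sum>p\<in>?U t n \<union> ?L t n. ?w p) = sum ?w (?U t n) + sum ?w (?L t n) - sum ?w (?U t n \<inter> ?L t n)"
        using finite_partitions_of[of n] by (intro sum_Un) auto
      also have "\<dots> \<le> sum ?w (?U t n) + sum ?w (?L t n)"
      proof -
        have "0 \<le> sum ?w (?U t n \<inter> ?L t n)"
          by (intro sum_nonneg w) auto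
        then show ?thesis by simp
      qed
      also have "\<dots> = ?m n (?U t n) + ?m n (?L t n)"
        by (subst (1 2) m) auto
      finally show "(\<Sum>p\<in>?U t n \<union> ?L t n. ?w p) \<le> ?m n (?U t n) + ?m n (?L t n)" .
    qed
    finally show ?thesis .
  qed
  have "(\<lambda>n. \<Sum>t\<in>T. ?m n (?U t n) + ?m n (?L t n)) \<longlonglongrightarrow> (\<Sum>t\<in>T. 0 + 0)"
    using T e by (intro tendsto_sum tendsto_add upper_deviation lower_deviation) auto
  then have lim: "(\<lambda>n. \<Sum>t\<in>T. ?m n (?U t n) + ?m n (?L t n)) \<longlonglongrightarrow> 0" by simp
  have "(\<lambda>n. ?m n {p \<in> partitions_of n. \<not> ?good n p}) \<longlonglongrightarrow> 0"
  proof (rule tendsto_sandwich[OF _ _ tendsto_const lim])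
    show "\<forall>\<^sub>F n in sequentially. ?m n {p \<in> partitions_of n. \<not> ?good n p} \<le> (\<Sum>t\<in>T. ?m n (?U t n) + ?m n (?L t n))"
      using eventually_ge_at_top[of 1] by eventually_elim (rule sub)
  qed simp
  then have "(\<lambda>n. 1 - (1 - ?m n {p \<in> partitions_of n. ?good n p})) \<longlonglongrightarrow> 1 - 0" 
    unfolding pm.measure_small_canonical_Compl by (intro tendsto_diff tendsto_const)
  then show ?thesis by simp
qed

section \<open>Regular variation of the scaling\<close>

lemma filterlim_nat_floor: "filterlim (\<lambda>z::real. nat \<lfloor>z\<rfloor>) sequentially at_top"
  by (intro filterlim_compose[OF filterlim_nat_sequentially filterlim_floor_sequentially])

text \<open>Inversion of M. With N = \<lfloor>X\<rfloor> and N' = \<lfloor>X y\<rfloor>, M(a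
  \<sigma>_N) / N tends to a^(-(\<beta> + 1)), while M(\<sigma>_N') / N = N' / N tends to y. As M is
  nonincreasing, comparing the two limits places \<sigma>_N' on the right side of a
  \<sigma>_N.\<close>

lemma \<sigma>_ratio:
  assumes y: "y > 0" and X: "filterlim X at_top sequentially"
  shows "(\<lambda>i. \<sigma> (nat \<lfloor>X i * y\<rfloor>) / \<sigma> (nat \<lfloor>X i\<rfloor>)) \<longlonglongrightarrow> y powr (- 1 / (\<beta> + 1))"
proof -
  let ?N = "\<lambda>i. nat \<lfloor>X i\<rfloor>" and ?N' = "\<lambda>i. nat \<lfloor>X i * y\<rfloor>"
  have N: "filterlim ?N sequentially sequentially"
    by (rule filterlim_compose[OF filterlim_nat_floor X])
  have "filterlim (\<lambda>i. X i * y) at_top sequentially"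
    using X y by (intro filterlim_at_top_mult_tendsto_pos[OF tendsto_const])
  then have N': "filterlim ?N' sequentially sequentially"
    by (rule filterlim_compose[OF filterlim_nat_floor])
  have ratio: "(\<lambda>i. real (?N' i) / real (?N i)) \<longlonglongrightarrow> y"
  proof -
    have "((\<lambda>z. real (nat \<lfloor>z * y\<rfloor>) / real (nat \<lfloor>z\<rfloor>)) \<longlongrightarrow> y) at_top"
      using y by real_asymp
    from filterlim_compose[OF this X] show ?thesis .
  qed
  have M_ratio: "(\<lambda>i. M (a * \<sigma> (?N i)) / real (?N i)) \<longlonglongrightarrow> a powr (- (\<beta> + 1))" if a: "a > 0" for a
  proof -
    have pos: "a * \<sigma> n > 0" for n using a \<sigma>_pos by simp
    have 0: "(\<lambda>n. a * \<sigma> n) \<longlonglongrightarrow> 0" using tendsto_mult[OF tendsto_const \<sigma>_tendsto_0, of a] by simp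
    \<comment> \<open>Each factor has a known limit, and the product telescopes to M(a \<sigma>_n) /
      n.\<close>
    have "(\<lambda>n. (a * \<sigma> n * M (a * \<sigma> n) / B (1 / (a * \<sigma> n))) * (B (1 / (a * \<sigma> n)) / B (1 / \<sigma> n)) *
        inverse (\<sigma> n * real n / B (1 / \<sigma> n)) * inverse a) \<longlonglongrightarrow> \<Omega> * a powr (- \<beta>) * inverse \<Omega> * inverse a"
      using \<Omega>_pos a by (intro tendsto_mult tendsto_inverse tendsto_const M_limit[OF pos 0] B_scaled \<sigma>_limit) auto
    moreover have "\<Omega> * a powr (- \<beta>) * inverse \<Omega> * inverse a = a powr (- (\<beta> + 1))"
      using \<Omega>_pos a powr_diff[of a "- \<beta>" 1] by (simp add: divide_inverse)
    moreover have "\<forall>\<^sub>F n in sequentially. (a * \<sigma> n * M (a * \<sigma> n) / B (1 / (a * \<sigma> n))) * (B (1 / (a * \<sigma> n)) / B (1 / \<sigma> n)) *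
        inverse (\<sigma> n * real n / B (1 / \<sigma> n)) * inverse a = M (a * \<sigma> n) / real n"
      using scale_at_top[OF 0 pos, unfolded filterlim_at_top, rule_format, of 1]
        inverse_\<sigma>_at_top[unfolded filterlim_at_top, rule_format, of 1]
    proof eventually_elim
      case (elim n)
      have "B (1 / (a * \<sigma> n)) \<ge> 1" "B (1 / \<sigma> n) \<ge> 1" using elim by (auto intro!: B_ge_1)
      then show ?case using a \<sigma>_pos[of n] by (simp add: field_simps)
    qed
    ultimately have "(\<lambda>n. M (a * \<sigma> n) / real n) \<longlonglongrightarrow> a powr (- (\<beta> + 1))"
      using Lim_transform_eventually by fastforce
    from filterlim_compose[OF this N] show ?thesis .
  qed
  let ?L = "y powr (- 1 / (\<beta> + 1))"
  have L: "?L > 0" "?L powr (- (\<beta> + 1)) = y"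
  proof -
    have "- 1 / (\<beta> + 1) * - (\<beta> + 1) = 1" using \<beta>_pos by (simp add: field_simps)
    then show "?L powr (- (\<beta> + 1)) = y" using y by (simp only: powr_powr) simp
  qed (use y in simp)
  obtain y0 where y0: "y0 \<ge> 1" "\<And>s. s > 0 \<Longrightarrow> 1 / s \<ge> y0 \<Longrightarrow> summable (\<lambda>k. real (Suc k) * (b (Suc k) * H (exp (- real (Suc k) * s))))"
    using M_sums by blast
  have ge1: "\<forall>\<^sub>F i in sequentially. ?N i \<ge> 1 \<and> ?N' i \<ge> 1"
    using N N' by (intro eventually_conj) (simp_all add: filterlim_at_top)
  show ?thesis
  proof (rule order_tendstoI)
    fix a assume a: "a > ?L"
    then have a0: "a > 0" using L by linarith
    have "a powr (- (\<beta> + 1)) < ?L powr (- (\<beta> + 1))"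
      using a L \<beta>_pos by (intro powr_less_mono2_neg) auto
    then have "a powr (- (\<beta> + 1)) - y < 0" using L by simp
    then have 1: "\<forall>\<^sub>F i in sequentially. M (a * \<sigma> (?N i)) / real (?N i) - real (?N' i) / real (?N i) < 0"
      by (intro order_tendstoD(2)[OF tendsto_diff[OF M_ratio[OF a0] ratio]])
    have pos: "a * \<sigma> n > 0" for n using a0 \<sigma>_pos by simp
    have 0: "(\<lambda>n. a * \<sigma> n) \<longlonglongrightarrow> 0" using tendsto_mult[OF tendsto_const \<sigma>_tendsto_0, of a] by simp
    have 2: "\<forall>\<^sub>F i in sequentially. 1 / (a * \<sigma> (?N i)) \<ge> y0"
      using filterlim_compose[OF scale_at_top[OF 0 pos] N] by (simp add: filterlim_at_top)
    show "\<forall>\<^sub>F i in sequentially. \<sigma> (?N' i) / \<sigma> (?N i) < a"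
      using 1 2 ge1
    proof eventually_elim
      case (elim i)
      have "M (a * \<sigma> (?N i)) < real (?N' i)"
        using elim by (simp add: divide_less_0_iff zero_less_divide_iff flip: diff_divide_distrib)
      moreover have "M (\<sigma> (?N' i)) = real (?N' i)" using elim by (intro M_\<sigma>(2)) auto
      ultimately have "\<not> a * \<sigma> (?N i) \<le> \<sigma> (?N' i)"
        using summable_M_mono(2)[OF y0(2)[OF pos elim(2)] pos, of "\<sigma> (?N' i)"] by linarith
      then show ?case using \<sigma>_pos[of "?N i"] by (simp add: field_simps)
    qed
  next
    fix a assume a: "a < ?L"
    show "\<forall>\<^sub>F i in sequentially. a < \<sigma> (?N' i) / \<sigma> (?N i)"
    proof (cases "a > 0")
      case False
      then have "a < \<sigma> (?N' i) / \<sigma> (?N i)" for i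
        using divide_pos_pos[OF \<sigma>_pos[of "?N' i"] \<sigma>_pos[of "?N i"]] by linarith
      then show ?thesis by simp
    next
      case a0: True
      have "a powr (- (\<beta> + 1)) > ?L powr (- (\<beta> + 1))"
        using a a0 \<beta>_pos by (intro powr_less_mono2_neg) auto
      then have "a powr (- (\<beta> + 1)) - y > 0" using L by simp
      then have 1: "\<forall>\<^sub>F i in sequentially. M (a * \<sigma> (?N i)) / real (?N i) - real (?N' i) / real (?N i) > 0"
        by (intro order_tendstoD(1)[OF tendsto_diff[OF M_ratio[OF a0] ratio]])
      show ?thesis
        using 1 ge1
      proof eventually_elim
        case (elim i)
        have "M (a * \<sigma> (?N i)) > real (?N' i)"
        using elim by (simp add: divide_less_0_iff zero_less_divide_iff flip: diff_divide_distrib)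
        moreover have "M (\<sigma> (?N' i)) = real (?N' i)" using elim by (intro M_\<sigma>(2)) auto
        ultimately have "\<not> \<sigma> (?N' i) \<le> a * \<sigma> (?N i)"
          using summable_M_mono(2)[OF M_\<sigma>(1) \<sigma>_pos, of "?N' i" "a * \<sigma> (?N i)"] elim by linarith
        then show ?case using \<sigma>_pos[of "?N i"] by (simp add: field_simps)
      qed
    qed
  qed
qed

lemma \<alpha>_ratio:
  assumes y: "y > 0"
  shows "((\<lambda>z. \<alpha> (nat \<lfloor>z * y\<rfloor>) / \<alpha> (nat \<lfloor>z\<rfloor>)) \<longlongrightarrow> y powr (1 / (\<beta> + 1))) at_top"
proof (rule tendsto_at_topI_sequentially)
  fix X :: "nat \<Rightarrow> real" assume X: "filterlim X at_top sequentially"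
  let ?N = "\<lambda>i. nat \<lfloor>X i\<rfloor>" and ?N' = "\<lambda>i. nat \<lfloor>X i * y\<rfloor>"
  have N: "filterlim ?N sequentially sequentially"
    by (rule filterlim_compose[OF filterlim_nat_floor X])
  have "filterlim (\<lambda>i. X i * y) at_top sequentially"
    using X y by (intro filterlim_at_top_mult_tendsto_pos[OF tendsto_const])
  then have N': "filterlim ?N' sequentially sequentially"
    by (rule filterlim_compose[OF filterlim_nat_floor])
  have "(\<lambda>i. \<alpha> (?N' i) * \<sigma> (?N' i) * inverse (\<alpha> (?N i) * \<sigma> (?N i)) * inverse (\<sigma> (?N' i) / \<sigma> (?N i)))
      \<longlonglongrightarrow> 1 * inverse 1 * inverse (y powr (- 1 / (\<beta> + 1)))"
    using y by (intro tendsto_mult tendsto_inverse \<sigma>_ratio[OF y X]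
      filterlim_compose[OF \<alpha>\<sigma>_tendsto_1 N] filterlim_compose[OF \<alpha>\<sigma>_tendsto_1 N']) auto
  moreover have "\<alpha> (?N' i) * \<sigma> (?N' i) * inverse (\<alpha> (?N i) * \<sigma> (?N i)) * inverse (\<sigma> (?N' i) / \<sigma> (?N i)) =
      \<alpha> (?N' i) / \<alpha> (?N i)" for i
    using \<sigma>_pos[of "?N i"] \<sigma>_pos[of "?N' i"] by (simp add: field_simps)
  moreover have "1 * inverse 1 * inverse (y powr (- 1 / (\<beta> + 1))) = y powr (1 / (\<beta> + 1))"
    by (simp add: powr_minus)
  ultimately show "(\<lambda>i. \<alpha> (?N' i) / \<alpha> (?N i)) \<longlonglongrightarrow> y powr (1 / (\<beta> + 1))"
    by simp
qed

lemma ergodic: "ergodic (small_canonical f b) (\<lambda>n. 1 / (1 - x n)) (limit_shape f \<beta>)"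
  unfolding ergodic_def
proof (intro conjI allI impI)
  fix n :: nat assume "n \<ge> 1"
  then show "1 / (1 - x n) > 0" using x_less_1 by simp
next
  fix e :: real and T assume e: "e > 0" and T: "finite T" "\<forall>t\<in>T. t > 0 \<and> isCont (limit_shape f \<beta>) t"
  have "(\<lambda>n. measure (small_canonical f b n)
    {p \<in> partitions_of n. \<forall>t\<in>T. \<bar>\<alpha> n / real n * parts_above p (\<alpha> n * t) - \<Phi> t / \<Omega>\<bar> < e}) \<longlonglongrightarrow> 1"
    using T by (intro small_canonical_concentration e) auto
  moreover have "\<forall>\<^sub>F n in sequentially. measure (small_canonical f b n)
    {p \<in> partitions_of n. \<forall>t\<in>T. \<bar>\<alpha> n / real n * parts_above p (\<alpha> n * t) - \<Phi> t / \<Omega>\<bar> < e} =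
    measure (small_canonical f b n) {p \<in> space (small_canonical f b n). \<forall>t\<in>T.
      \<bar>1 / (1 - x n) / real n * parts_above p (1 / (1 - x n) * t) - limit_shape f \<beta> t\<bar> < e}"
    using eventually_ge_at_top[of 1]
  proof eventually_elim
    case (elim n)
    have "{p \<in> partitions_of n. \<forall>t\<in>T. \<bar>\<alpha> n / real n * parts_above p (\<alpha> n * t) - \<Phi> t / \<Omega>\<bar> < e} =
      {p \<in> space (small_canonical f b n). \<forall>t\<in>T.
        \<bar>1 / (1 - x n) / real n * parts_above p (1 / (1 - x n) * t) - limit_shape f \<beta> t\<bar> < e}"
      unfolding \<alpha>_eq[OF elim] pm.space_small_canonical using T(2) by (auto simp: limit_shape_eq)
    then show ?case by (rule arg_cong)
  qed
  ultimately show "(\<lambda>n. measure (small_canonical f b n) {p \<in> space (small_canonical f b n). \<forall>t\<in>T.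
      \<bar>1 / (1 - x n) / real n * parts_above p (1 / (1 - x n) * t) - limit_shape f \<beta> t\<bar> < e}) \<longlonglongrightarrow> 1"
    by (rule Lim_transform_eventually)
qed (use limit_shape_nonneg piecewise_continuous_limit_shape limit_shape_has_integral in auto)

lemma scaling_form:
  "\<exists>l1. slowly_varying l1 \<and> (\<forall>n\<ge>1. 1 / (1 - x n) = real n powr (1 / (\<beta> + 1)) / l1 (real n))"
proof (intro exI conjI allI impI)
  \<comment> \<open>The witness makes the required identity hold by cancellation; the content is its
    slow variation.\<close>
  show "slowly_varying (\<lambda>z. z powr (1 / (\<beta> + 1)) / \<alpha> (nat \<lfloor>z\<rfloor>))"
    by (rule slowly_varying_quotient) (rule \<alpha>_ratio)
  fix n :: nat assume n: "n \<ge> 1"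
  then show "1 / (1 - x n) = real n powr (1 / (\<beta> + 1)) / (real n powr (1 / (\<beta> + 1)) / \<alpha> (nat \<lfloor>real n\<rfloor>))"
    unfolding \<alpha>_eq[OF n] by simp
qed

end

theorem theorem9:
  fixes f :: "real fps" and b :: "nat \<Rightarrow> real" and \<beta> \<gamma> :: real
    and l :: "real \<Rightarrow> real" and x :: "nat \<Rightarrow> real"
  assumes "fps_nth f 0 = 1"
    and "fps_conv_radius f > 0"
    and "b 1 = 1"
    and "\<forall>k\<ge>1. b k \<ge> 0"
    and "\<forall>k\<ge>1. \<forall>j. fps_nth (fps_rpow f (b k)) j \<ge> 0"
    and "\<beta> > 0"
    and "slowly_varying l"
    and "\<forall>k\<ge>1. (\<Sum>j=1..k. b j) = real k powr \<beta> * l (real k)"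
    and "\<forall>n. fps_nth (gen_fun f b) n > 0"
    and "\<forall>n\<ge>1. x n > 0 \<and> summable (\<lambda>m. fps_nth (gen_fun f b) m * x n ^ m) \<and>
           (\<integral>p. real (sum_mset p) \<partial>grand_canonical f b (x n)) = real n"
    and "\<gamma> > 0"
    and "eventually (\<lambda>n. measure (grand_canonical f b (x n)) (partitions_of n)
           \<ge> real n powr (- \<gamma>)) sequentially"
    and "fps_conv_radius f > 1 \<or> (fps_conv_radius f = 1 \<and> isolated_pole_at_1 f)"
  shows "ergodic (small_canonical f b) (\<lambda>n. 1 / (1 - x n)) (limit_shape f \<beta>) \<and>
    (\<exists>l1. slowly_varying l1 \<and>
       (\<forall>n\<ge>1. 1 / (1 - x n) = real n powr (1 / (\<beta> + 1)) / l1 (real n)))"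
proof -
  interpret pm: partition_model f b
    by unfold_locales (use assms(1,3,4,5,9,13) in auto)
  interpret rw: regular_weights b \<beta>
    by (rule regular_weightsI[of b \<beta> l]) (use assms(3,4,6,7,8) in auto)
  have "\<exists>m c C. c > 0 \<and> (\<forall>u. 0 \<le> u \<longrightarrow> u < 1 \<longrightarrow>
      c \<le> eval_fps f u * (1 - u) ^ m \<and> eval_fps f u * (1 - u) ^ m \<le> C)"
  proof (cases "fps_conv_radius f > 1")
    case True
    \<comment> \<open>The case m = 0: f lies between 1 and f(1) on [0, 1).\<close>
    then show ?thesis
      using power_singularity_of_radius[OF True pm.f0 pm.f_nonneg]
      by (intro exI[of _ 0] exI[of _ "1::real"] exI[of _ "eval_fps f 1"]) auto
  next
    case False
    with assms(13) show ?thesis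
      using power_singularity_of_pole[OF _ _ pm.f0 pm.f_nonneg] by metis
  qed
  then obtain m c C where "c > 0" "\<And>u. 0 \<le> u \<Longrightarrow> u < 1 \<Longrightarrow>
      c \<le> eval_fps f u * (1 - u) ^ m \<and> eval_fps f u * (1 - u) ^ m \<le> C"
    by blast
  then interpret ps: power_singularity f m c C
    by unfold_locales (use pm.f0 pm.f_nonneg pm.f1_pos pm.radius in auto)
  interpret ergodic_sequence f b \<beta> m c C x \<gamma>
    by unfold_locales (use assms(10,11,12) in auto)
  show ?thesis
    using ergodic scaling_form by blast
qed

end
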